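(* Let $n\ge 1$, $\alpha\in[1,2)$, $\gamma\in\left(\frac12,\frac{\alpha+1}{2}\right]$ and $\omega\in\mathbb{R}$. Let $\sigma=(\sigma_1,\dots,\sigma_n)\in\mathbb{R}^n$ satisfy $$\sigma_1>\sqrt{\frac{\alpha}{2(1+\alpha)}}\,\sqrt{\sigma_2^2+\cdots+\sigma_n^2}$$ (for $n=1$ this means $\sigma_1>0$). For $x\in\mathbb{R}^n$ define $$\varphi(x):=\int_{-\infty}^{\sigma\cdot x}\frac{\mathrm{d}s}{\langle s+\omega\rangle^{2\gamma}},\qquad \phi(x):=\frac{1}{\langle\sigma\cdot x+\omega\rangle^{\gamma}}.$$ Then there exist positive constants $c_1,c_2$, depending only on $\alpha,n,\sigma,\gamma$, such that for every (real-valued) $u\in\mathcal{S}(\mathbb{R}^n)$ $$\int_{\mathbb{R}^n}u\,\varphi\,\partial_{x_1}|\nabla_x|^{\alpha}u\,\mathrm{d}x\le -c_1\int_{\mathbb{R}^n}\big||\nabla_x|^{\frac{\alpha}{2}}(u\phi)\big|^2\,\mathrm{d}x+c_2\int_{\mathbb{R}^n}u^2\phi^2\,\mathrm{d}x.$$ In particular: (i) if $n=1$, one can take $c_1=\frac{\alpha+1}{2}\sigma_1$; (ii) if $n\ge2$ and $\sigma_j=0$ for all $2\le j\le n$, one can take $c_1=\frac{\sigma_1}{2}$.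
   Context: $\langle y\rangle:=(1+|y|^2)^{1/2}$. For $\beta>0$, $|\nabla_x|^{\beta}$ is the Fourier multiplier on $\mathbb{R}^n$ with symbol $|\xi|^{\beta}$. $\mathcal{S}(\mathbb{R}^n)$ is the Schwartz class. *)

theory Defs
  imports "HOL-Analysis.Analysis"
begin

definition japanese_bracket :: "'a::real_normed_vector \<Rightarrow> real" where
  "japanese_bracket y = sqrt (1 + (norm y)\<^sup>2)"

definition partial_deriv :: "'n::finite \<Rightarrow> (real^'n \<Rightarrow> real) \<Rightarrow> real^'n \<Rightarrow> real" where
  "partial_deriv i f x = deriv (\<lambda>t. f (x + t *\<^sub>R axis i 1)) 0"

text \<open>Multi-indices are replaced by finite sequences of coordinate directions; this only adds
  reorderings of the same mixed derivatives.\<close>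

primrec iterated_partial :: "'n::finite list \<Rightarrow> (real^'n \<Rightarrow> real) \<Rightarrow> real^'n \<Rightarrow> real" where
  "iterated_partial [] f = f"
| "iterated_partial (i # is) f = partial_deriv i (iterated_partial is f)"

text \<open>If every iterated partial derivative is differentiable everywhere, then every iterated
  partial derivative is continuous, so the first conjunct says that the function is smooth.\<close>

definition schwartz :: "(real^'n::finite \<Rightarrow> real) \<Rightarrow> bool" where
  "schwartz f \<longleftrightarrow>
     (\<forall>is x. iterated_partial is f differentiable (at x)) \<and>
     (\<forall>is (m::nat). \<exists>C. \<forall>x. norm x ^ m * \<bar>iterated_partial is f x\<bar> \<le> C)"

text \<open>The normalisation is the one for which \<open>\<partial>\<^sub>j\<close> has symbol \<open>\<i> \<xi>\<^sub>j\<close>.\<close>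

definition fourier :: "(real^'n::finite \<Rightarrow> complex) \<Rightarrow> real^'n \<Rightarrow> complex" where
  "fourier f \<xi> = (LINT x|lborel. cis (- (x \<bullet> \<xi>)) * f x)"

definition inverse_fourier :: "(real^'n::finite \<Rightarrow> complex) \<Rightarrow> real^'n \<Rightarrow> complex" where
  "inverse_fourier g x =
     (LINT \<xi>|lborel. cis (x \<bullet> \<xi>) * g \<xi>) / of_real ((2 * pi) ^ CARD('n))"

definition fourier_multiplier ::
  "(real^'n::finite \<Rightarrow> complex) \<Rightarrow> (real^'n \<Rightarrow> complex) \<Rightarrow> real^'n \<Rightarrow> complex" where
  "fourier_multiplier m f = inverse_fourier (\<lambda>\<xi>. m \<xi> * fourier f \<xi>)"

text \<open>The operator \<open>|\<nabla>|\<^sup>\<beta>\<close> on real-valued functions. The real part discards nothing,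
  see \<open>complex_of_real_abs_nabla\<close> below.\<close>

definition abs_nabla :: "real \<Rightarrow> (real^'n::finite \<Rightarrow> real) \<Rightarrow> real^'n \<Rightarrow> real" where
  "abs_nabla \<beta> u x =
     Re (fourier_multiplier (\<lambda>\<xi>. of_real (norm \<xi> powr \<beta>)) (\<lambda>y. of_real (u y)) x)"

lemma lborel_integral_uminus:
  fixes h :: "'a::euclidean_space \<Rightarrow> 'b::{banach, second_countable_topology}"
  shows "(LINT \<xi>|lborel. h (- \<xi>)) = (LINT \<xi>|lborel. h \<xi>)"
proof (cases "h \<in> borel_measurable borel")
  case True
  have "lborel = distr lborel borel (uminus :: 'a \<Rightarrow> 'a)"
    using lborel_affine[of "-1" "0::'a"] by (simp add: density_1)
  then have "(LINT \<xi>|lborel. h \<xi>) = (LINT \<xi>|distr lborel borel uminus. h \<xi>)"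
    by simp
  also have "\<dots> = (LINT \<xi>|lborel. h (- \<xi>))"
    using True by (subst integral_distr) auto
  finally show ?thesis by simp
next
  case False
  have "(\<lambda>\<xi>. h (- \<xi>)) \<notin> borel_measurable borel"
  proof
    assume "(\<lambda>\<xi>. h (- \<xi>)) \<in> borel_measurable borel"
    then have "(\<lambda>\<xi>. h (- (- \<xi>))) \<in> borel_measurable borel"
      by (rule measurable_compose[rotated]) simp
    with False show False by simp
  qed
  with False have "\<not> integrable lborel h" "\<not> integrable lborel (\<lambda>\<xi>. h (- \<xi>))"
    using borel_measurable_integrable by fastforce+
  then show ?thesis by (simp add: not_integrable_integral_eq)
qed

lemma complex_of_real_abs_nabla:
  fixes u :: "real^'n::finite \<Rightarrow> real"
  shows "complex_of_real (abs_nabla \<beta> u x) =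
     fourier_multiplier (\<lambda>\<xi>. of_real (norm \<xi> powr \<beta>)) (\<lambda>y. of_real (u y)) x"
proof -
  let ?F = "fourier (\<lambda>y. complex_of_real (u y))"
  have F: "cnj (?F \<xi>) = ?F (- \<xi>)" for \<xi>
    unfolding fourier_def by (simp flip: Bochner_Integration.integral_cnj add: cis_cnj)
  define h where "h = (\<lambda>\<xi>. cis (x \<bullet> \<xi>) * (complex_of_real (norm \<xi> powr \<beta>) * ?F \<xi>))"
  have "cnj (h \<xi>) = h (- \<xi>)" for \<xi>
    by (simp add: h_def F cis_cnj)
  then have "cnj (LINT \<xi>|lborel. h \<xi>) = (LINT \<xi>|lborel. h (- \<xi>))"
    by (simp flip: Bochner_Integration.integral_cnj)
  also have "\<dots> = (LINT \<xi>|lborel. h \<xi>)"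
    by (rule lborel_integral_uminus)
  finally have "(LINT \<xi>|lborel. h \<xi>) \<in> \<real>"
    by (simp add: Reals_cnj_iff)
  then have "(LINT \<xi>|lborel. h \<xi>) / of_real ((2 * pi) ^ CARD('n)) \<in> \<real>"
    by (intro Reals_divide) auto
  then show ?thesis
    unfolding abs_nabla_def fourier_multiplier_def inverse_fourier_def h_def
    by (rule of_real_Re)
qed

definition weight_varphi :: "real \<Rightarrow> real \<Rightarrow> real^'n::finite \<Rightarrow> real^'n \<Rightarrow> real" where
  "weight_varphi \<gamma> \<omega> \<sigma> x =
     (LINT s:{..\<sigma> \<bullet> x}|lborel. 1 / japanese_bracket (s + \<omega>) powr (2 * \<gamma>))"

definition weight_phi :: "real \<Rightarrow> real \<Rightarrow> real^'n::finite \<Rightarrow> real^'n \<Rightarrow> real" where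
  "weight_phi \<gamma> \<omega> \<sigma> x = 1 / japanese_bracket (\<sigma> \<bullet> x + \<omega>) powr \<gamma>"

end

theory Submission
  imports Defs "HOL-Probability.Probability"
begin

text \<open>Write \<open>\<Phi>\<close> for \<open>weight_varphi\<close> and \<open>\<phi>\<close> for \<open>weight_phi\<close>, so that \<open>\<Phi>\<close> is a
  primitive of \<open>\<phi>\<^sup>2\<close> in the variable \<open>\<sigma> \<bullet> x + \<omega>\<close>, and put \<open>v = u \<phi>\<close>.
  The operator \<open>\<partial>\<^sub>k |\<nabla>|\<^sup>\<alpha>\<close> has an odd kernel, a negative multiple of
  \<open>z\<^sub>k / |z|^(n + \<alpha> + 2)\<close>. Because of
  \<open>2 u(x) u(y) = u(x)\<^sup>2 + u(y)\<^sup>2 - (u(x) - u(y))\<^sup>2\<close> the left-hand side equals, up to a term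
  local in \<open>u\<^sup>2\<close>, a negative multiple of the double integral of
  \<open>(u(x + z) - u(x))\<^sup>2 (\<Phi>(x + z) - \<Phi>(x))\<close> against that quotient.
  For \<open>|z| \<le> 1\<close> the increment of \<open>\<Phi>\<close> is \<open>(\<sigma> \<bullet> z) \<phi>(x) \<phi>(x + z)\<close> up to third order in \<open>z\<close>, and
  \<open>(a p - b q)\<^sup>2 = (a - b)\<^sup>2 p q + (p - q) (a\<^sup>2 p - b\<^sup>2 q)\<close> turns the integrand into
  \<open>(\<sigma> \<bullet> z) (v(x + z) - v(x))\<^sup>2\<close>; every error is bounded by the integral of \<open>v\<^sup>2\<close>.
  For \<open>|z| > 1\<close> all terms are errors, since \<open>2 \<gamma> \<le> \<alpha> + 1\<close>.
  On the Fourier side the remaining form has the symbol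
  \<open>|\<xi>|^\<alpha> \<sigma>\<^sub>k + \<alpha> |\<xi>|^(\<alpha> - 2) (\<xi> \<bullet> \<sigma>) \<xi>\<^sub>k\<close> up to a constant factor, and this dominates a multiple of \<open>|\<xi>|^\<alpha>\<close>.\<close>

section \<open>Integration on Euclidean space and Gaussians\<close>

text \<open>The kernel is too singular for absolute convergence, and this shapes the proof.
  Replacing \<open>sin (z \<bullet> \<xi>)\<close> by
  \<open>sin (z \<bullet> \<xi>) - z \<bullet> \<xi>\<close> leaves a factor of third order at the
  origin and of first order at infinity; since 0 < \<alpha> < 2, the exchanges with the frequency
  integral then have integrable majorants. The price is the local term (\<sigma> \<bullet> z / 2)
  times the integral of v^2. The constant of the kernel is never evaluated. Rotation invariance,
  homogeneity and a sign argument give its symbol up to a factor c > 0, and the same c occurs in the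
  leading form, where it cancels. What remains is half of the symbol displayed above; hence the
  explicit c1 in (i) and (ii). That symbol is positive once \<sigma>_k exceeds \<alpha> / (2 sqrt(1
  + \<alpha>)) times the length of the other components. The cone condition beats this by the factor
  sqrt(2 / \<alpha>) > 1, and the margin yields c1 in general. The weight estimates are relative
  bounds in the one variable \<sigma> \<bullet> x + \<omega>, hence uniform in \<omega>.\<close>

lemma borel_measurable_cis [measurable]:
  "f \<in> borel_measurable M \<Longrightarrow> (\<lambda>x. cis (f x)) \<in> borel_measurable M"
  by (rule borel_measurable_continuous_on[of cis]) (auto intro!: continuous_intros)

lemma cis_sum: "finite A \<Longrightarrow> cis (\<Sum>a\<in>A. f a) = (\<Prod>a\<in>A. cis (f a))"
  by (induction A rule: finite_induct) (simp_all flip: cis_mult)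

lemma integrable_pair_product:
  fixes g :: "'a::euclidean_space \<Rightarrow> real" and h :: "'b::euclidean_space \<Rightarrow> real"
  assumes g: "integrable lborel g" and h: "integrable lborel h"
  shows "integrable (lborel \<Otimes>\<^sub>M lborel) (\<lambda>(x, y). g x * h y)"
proof -
  have [measurable]: "g \<in> borel_measurable borel" "h \<in> borel_measurable borel"
    using g h by (auto dest: borel_measurable_integrable)
  show ?thesis
    by (rule lborel_pair.Fubini_integrable) (use g h in \<open>auto simp: abs_mult\<close>)
qed

text \<open>Most exchanges of integrals below rest on this form of majorant: a product with one
  factor in each variable, so that joint integrability reduces to two separate checks.\<close>

lemma integrable_pair_dominated:
  fixes g :: "'a::euclidean_space \<Rightarrow> real" and h :: "'b::euclidean_space \<Rightarrow> real"
    and H :: "'a \<Rightarrow> 'b \<Rightarrow> 'c::{banach, second_countable_topology}"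
  assumes "case_prod H \<in> borel_measurable (lborel \<Otimes>\<^sub>M lborel)"
    and g: "integrable lborel g" and h: "integrable lborel h"
    and "\<And>x y. norm (H x y) \<le> g x * h y"
  shows "integrable (lborel \<Otimes>\<^sub>M lborel) (case_prod H)"
  by (rule Bochner_Integration.integrable_bound[OF integrable_pair_product[OF g h]])
     (use assms order_trans[OF assms(4) abs_ge_self] in auto)

lemma lborel_distr_shift:
  fixes c :: "'a::euclidean_space"
  shows "distr lborel borel (\<lambda>x. x + c) = lborel"
proof -
  have "(\<lambda>x. x + c) = (+) c"
    by (simp add: fun_eq_iff add.commute)
  then show ?thesis
    by (simp add: lborel_distr_plus)
qed

lemma
  fixes f :: "'a::euclidean_space \<Rightarrow> 'b::{banach, second_countable_topology}"
  assumes [measurable]: "f \<in> borel_measurable borel"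
  shows lborel_integral_shift: "(LINT x|lborel. f (x + c)) = (LINT x|lborel. f x)"
    and lborel_integrable_shift: "integrable lborel (\<lambda>x. f (x + c)) \<longleftrightarrow> integrable lborel f"
proof -
  show "(LINT x|lborel. f (x + c)) = (LINT x|lborel. f x)"
    by (subst (2) lborel_distr_shift[of c, symmetric]) (simp add: integral_distr)
  show "integrable lborel (\<lambda>x. f (x + c)) \<longleftrightarrow> integrable lborel f"
    by (subst (2) lborel_distr_shift[of c, symmetric]) (simp add: integrable_distr_eq)
qed

lemma lborel_integral_scale:
  fixes f :: "'a::euclidean_space \<Rightarrow> 'b::{banach, second_countable_topology}"
  assumes [measurable]: "f \<in> borel_measurable borel" and "c > 0"
  shows "(LINT x|lborel. f x) = c ^ DIM('a) *\<^sub>R (LINT x|lborel. f (t + c *\<^sub>R x))"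
  by (subst lborel_affine[of c t]) (use \<open>c > 0\<close> in \<open>simp_all add: integral_density integral_distr\<close>)

lemma lborel_nn_integral_scale:
  fixes f :: "'a::euclidean_space \<Rightarrow> ennreal"
  assumes [measurable]: "f \<in> borel_measurable borel" and "c > 0"
  shows "(\<integral>\<^sup>+x. f x \<partial>lborel) = ennreal (c ^ DIM('a)) * (\<integral>\<^sup>+x. f (c *\<^sub>R x) \<partial>lborel)"
  by (subst lborel_affine[of c 0])
     (use \<open>c > 0\<close> in \<open>simp_all add: nn_integral_density nn_integral_distr nn_integral_cmult ennreal_power\<close>)

lemma
  fixes f :: "'a::euclidean_space \<Rightarrow> real \<Rightarrow> complex"
  assumes "\<And>b. b \<in> Basis \<Longrightarrow> integrable lborel (f b)"
  shows integrable_lborel_prod: "integrable lborel (\<lambda>x. \<Prod>b\<in>Basis. f b (x \<bullet> b))"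
    and integral_lborel_prod:
      "(LINT x|lborel. (\<Prod>b\<in>Basis. f b (x \<bullet> b))) = (\<Prod>b\<in>Basis. LINT t|lborel. f b t)"
proof -
  interpret product_sigma_finite "\<lambda>_::'a. lborel :: real measure" by standard
  have [measurable]: "b \<in> Basis \<Longrightarrow> f b \<in> borel_measurable borel" for b
    using assms by (auto dest: borel_measurable_integrable)
  have *: "(\<Prod>b\<in>Basis. f b ((\<Sum>c\<in>Basis. g c *\<^sub>R c) \<bullet> b)) = (\<Prod>b\<in>Basis. f b (g b))" for g :: "'a \<Rightarrow> real"
    by (intro prod.cong) auto
  show "integrable lborel (\<lambda>x. \<Prod>b\<in>Basis. f b (x \<bullet> b))"
    by (subst lborel_eq)
       (simp add: integrable_distr_eq * product_integrable_prod assms)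
  show "(LINT x|lborel. (\<Prod>b\<in>Basis. f b (x \<bullet> b))) = (\<Prod>b\<in>Basis. LINT t|lborel. f b t)"
    by (subst lborel_eq)
       (simp add: integral_distr * product_integral_prod assms)
qed

text \<open>Up to normalisation this is the characteristic function of the standard normal
  law.\<close>

lemma
  shows integrable_gaussian_1: "integrable lborel (\<lambda>t. cis (x * t) * complex_of_real (exp (- (t\<^sup>2 / 2))))"
    and integral_gaussian_1: "(LINT t|lborel. cis (x * t) * complex_of_real (exp (- (t\<^sup>2 / 2)))) =
      complex_of_real (sqrt (2 * pi) * exp (- (x\<^sup>2 / 2)))"
proof -
  have eq: "cis (x * t) * complex_of_real (exp (- (t\<^sup>2 / 2))) =
      complex_of_real (sqrt (2 * pi)) * (std_normal_density t *\<^sub>R cis (x * t))" for t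
    by (simp add: std_normal_density_def scaleR_conv_of_real)
  have "integrable lborel (\<lambda>t. std_normal_density t *\<^sub>R cis (x * t))"
    by (rule Bochner_Integration.integrable_bound[OF integrable_normal_density[of 1 0]]) auto
  then show "integrable lborel (\<lambda>t. cis (x * t) * complex_of_real (exp (- (t\<^sup>2 / 2))))"
    unfolding eq by (rule integrable_mult_right)
  have "char std_normal_distribution x = complex_of_real (exp (- (x\<^sup>2 / 2)))"
    by (simp add: char_std_normal_distribution)
  moreover have "char std_normal_distribution x = (LINT t|lborel. std_normal_density t *\<^sub>R cis (x * t))"
    unfolding char_def by (subst integral_density) (auto simp: cis_conv_exp)
  ultimately show "(LINT t|lborel. cis (x * t) * complex_of_real (exp (- (t\<^sup>2 / 2)))) =
      complex_of_real (sqrt (2 * pi) * exp (- (x\<^sup>2 / 2)))"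
    unfolding eq by (simp del: mult_scaleR_right)
qed

lemma
  fixes x :: "'a::euclidean_space"
  shows integrable_gaussian: "integrable lborel (\<lambda>\<xi>. cis (x \<bullet> \<xi>) * complex_of_real (exp (- (norm \<xi>)\<^sup>2 / 2)))"
    and integral_gaussian: "(LINT \<xi>|lborel. cis (x \<bullet> \<xi>) * complex_of_real (exp (- (norm \<xi>)\<^sup>2 / 2))) =
      complex_of_real (sqrt (2 * pi) ^ DIM('a) * exp (- (norm x)\<^sup>2 / 2))"
proof -
  have norm2: "- (norm (y::'a))\<^sup>2 / 2 = (\<Sum>b\<in>Basis. - ((y \<bullet> b)\<^sup>2 / 2))" for y
    by (subst power2_norm_eq_inner, subst euclidean_inner)
       (simp add: power2_eq_square sum_negf flip: sum_divide_distrib)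
  have eq: "cis (x \<bullet> \<xi>) * complex_of_real (exp (- (norm \<xi>)\<^sup>2 / 2)) =
    (\<Prod>b\<in>Basis. cis ((x \<bullet> b) * (\<xi> \<bullet> b)) * complex_of_real (exp (- ((\<xi> \<bullet> b)\<^sup>2 / 2))))" for \<xi>
    unfolding norm2
    by (subst euclidean_inner)
       (simp add: prod.distrib exp_sum cis_sum)
  show "integrable lborel (\<lambda>\<xi>. cis (x \<bullet> \<xi>) * complex_of_real (exp (- (norm \<xi>)\<^sup>2 / 2)))"
    unfolding eq by (rule integrable_lborel_prod) (rule integrable_gaussian_1)
  show "(LINT \<xi>|lborel. cis (x \<bullet> \<xi>) * complex_of_real (exp (- (norm \<xi>)\<^sup>2 / 2))) =
      complex_of_real (sqrt (2 * pi) ^ DIM('a) * exp (- (norm x)\<^sup>2 / 2))"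
    unfolding eq
    by (subst integral_lborel_prod[OF integrable_gaussian_1])
       (unfold norm2, simp add: integral_gaussian_1 prod.distrib exp_sum)
qed

lemma integral_gaussian_scaled:
  fixes x :: "'a::euclidean_space"
  assumes "\<epsilon> > 0"
  shows "(LINT \<xi>|lborel. cis (x \<bullet> \<xi>) * complex_of_real (exp (- (norm (\<epsilon> *\<^sub>R \<xi>))\<^sup>2 / 2))) =
      complex_of_real ((sqrt (2 * pi) / \<epsilon>) ^ DIM('a) * exp (- (norm (x /\<^sub>R \<epsilon>))\<^sup>2 / 2))"
    (is "?L = _")
    and "integrable lborel (\<lambda>\<xi>::'a. exp (- (norm (\<epsilon> *\<^sub>R \<xi>))\<^sup>2 / 2))"
proof -
  have "(LINT \<xi>|lborel. cis ((x /\<^sub>R \<epsilon>) \<bullet> \<xi>) * complex_of_real (exp (- (norm \<xi>)\<^sup>2 / 2))) = \<epsilon> ^ DIM('a) *\<^sub>R ?L"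
    using assms by (subst lborel_integral_scale[where c = \<epsilon> and t = 0]) (simp_all add: scaleR_conv_of_real field_simps)
  then show "?L = complex_of_real ((sqrt (2 * pi) / \<epsilon>) ^ DIM('a) * exp (- (norm (x /\<^sub>R \<epsilon>))\<^sup>2 / 2))"
    using assms by (subst (asm) integral_gaussian) (simp add: scaleR_conv_of_real power_divide field_simps)
  have *: "integrable lborel (\<lambda>\<xi>::'a. exp (- (norm \<xi>)\<^sup>2 / 2))"
    using integrable_norm[OF integrable_gaussian[of "0::'a"]] by simp
  have "integrable (density (distr lborel borel (\<lambda>x::'a. 0 + \<epsilon> *\<^sub>R x)) (\<lambda>_. ennreal (\<bar>\<epsilon>\<bar> ^ DIM('a))))
     (\<lambda>\<xi>::'a. exp (- (norm \<xi>)\<^sup>2 / 2))"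
    using * assms by (subst lborel_affine[symmetric]) auto
  then show "integrable lborel (\<lambda>\<xi>::'a. exp (- (norm (\<epsilon> *\<^sub>R \<xi>))\<^sup>2 / 2))"
    using assms by (simp add: integrable_density integrable_distr_eq)
qed

section \<open>Parseval's identity\<close>

lemma borel_measurable_cnj [measurable]:
  "f \<in> borel_measurable M \<Longrightarrow> (\<lambda>x. cnj (f x)) \<in> borel_measurable M"
  by (rule borel_measurable_continuous_on[of cnj]) (auto intro!: continuous_intros)

text \<open>The Gaussian factor makes the integral over the frequency and both space variables
  absolutely convergent, so the frequency can be integrated out first. This leaves a Gaussian of
  width \<epsilon> in x - y, and the substitution x = y + \<epsilon> w exhibits it as an approximate
  identity.\<close>

lemma fourier_parseval_gaussian:
  fixes f g :: "real^'n::finite \<Rightarrow> complex"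
  assumes f: "integrable lborel f" and g: "integrable lborel g" and e: "\<epsilon> > 0"
  shows "(LINT \<xi>|lborel. exp (- (norm (\<epsilon> *\<^sub>R \<xi>))\<^sup>2 / 2) *\<^sub>R (fourier f \<xi> * cnj (fourier g \<xi>))) =
    sqrt (2 * pi) ^ CARD('n) *\<^sub>R
      (LINT y|lborel. (LINT w|lborel. exp (- (norm w)\<^sup>2 / 2) *\<^sub>R (f (y + \<epsilon> *\<^sub>R w) * cnj (g y))))"
    (is "?L = ?R")
proof -
  have [measurable]: "f \<in> borel_measurable borel" "g \<in> borel_measurable borel"
    using f g by (auto dest: borel_measurable_integrable)
  define F where "F = (\<lambda>x y. f x * cnj (g y))"
  define G where "G = (\<lambda>\<xi>::real^'n. exp (- (norm (\<epsilon> *\<^sub>R \<xi>))\<^sup>2 / 2))"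
  define W where "W = (\<lambda>w::real^'n. exp (- (norm w)\<^sup>2 / 2))"
  have [measurable]: "G \<in> borel_measurable borel" "W \<in> borel_measurable borel" 
    unfolding G_def W_def by measurable
  have Gi: "integrable lborel G"
    using integral_gaussian_scaled(2)[OF e] by (simp add: G_def)
  have [measurable]: "(\<lambda>p. F (fst p) (snd p)) \<in> borel_measurable (borel \<Otimes>\<^sub>M borel)"
    unfolding F_def by measurable
  have Fi: "integrable (lborel \<Otimes>\<^sub>M lborel) (\<lambda>(x, y). F x y)"
    by (rule integrable_pair_dominated[of _ "\<lambda>x. norm (f x)" "\<lambda>y. norm (g y)"])
       (use f g in \<open>auto simp: F_def norm_mult\<close>)
  then have Fi': "integrable lborel (\<lambda>p. F (fst p) (snd p))"
    by (simp add: lborel_prod split_def)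
  have prod: "fourier f \<xi> * cnj (fourier g \<xi>) =
      (LINT p|lborel. cis ((snd p - fst p) \<bullet> \<xi>) * F (fst p) (snd p))" for \<xi>
  proof -
    have "integrable (lborel \<Otimes>\<^sub>M lborel)
        (\<lambda>(x, y). (cis (- (x \<bullet> \<xi>)) * f x) * cnj (cis (- (y \<bullet> \<xi>)) * g y))"
      by (rule integrable_pair_dominated[of _ "\<lambda>x. norm (f x)" "\<lambda>y. norm (g y)"])
         (use f g in \<open>auto simp: norm_mult\<close>)
    from lborel_pair.integral_fst[OF this] have "fourier f \<xi> * cnj (fourier g \<xi>) =
      (LINT p|(lborel \<Otimes>\<^sub>M lborel). (cis (- (fst p \<bullet> \<xi>)) * f (fst p)) * cnj (cis (- (snd p \<bullet> \<xi>)) * g (snd p)))"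
      by (simp add: fourier_def split_def del: complex_cnj_mult flip: Bochner_Integration.integral_cnj)
    also have "\<dots> = (LINT p|lborel. cis ((snd p - fst p) \<bullet> \<xi>) * F (fst p) (snd p))"
    proof -
      have "cis ((y - x) \<bullet> \<xi>) = cis (- (x \<bullet> \<xi>)) * cis (y \<bullet> \<xi>)" for x y :: "real^'n"
        by (simp add: cis_mult inner_diff_left)
      then show ?thesis
        unfolding lborel_prod by (simp add: F_def cis_cnj mult_ac)
    qed
    finally show ?thesis .
  qed
  have "?L = (LINT \<xi>|lborel. (LINT p|lborel. G \<xi> *\<^sub>R (cis ((snd p - fst p) \<bullet> \<xi>) * F (fst p) (snd p))))"
    unfolding prod by (simp add: G_def)
  also have "\<dots> = (LINT p|lborel. (LINT \<xi>|lborel. G \<xi> *\<^sub>R (cis ((snd p - fst p) \<bullet> \<xi>) * F (fst p) (snd p))))"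
  proof (rule lborel_pair.Fubini_integral,
      rule integrable_pair_dominated[where g = "\<lambda>p. norm (F (fst p) (snd p))" and h = G])
    define d FF where "d = (\<lambda>p::(real^'n) \<times> (real^'n). snd p - fst p)" and "FF = (\<lambda>p. F (fst p) (snd p))"
    have "d \<in> borel_measurable (borel \<Otimes>\<^sub>M borel)" "FF \<in> borel_measurable (borel \<Otimes>\<^sub>M borel)"
      unfolding d_def FF_def by measurable
    then have [measurable]: "d \<in> borel_measurable borel" "FF \<in> borel_measurable borel"
      by (simp_all add: borel_prod)
    have "(\<lambda>(p, \<xi>). G \<xi> *\<^sub>R (cis (d p \<bullet> \<xi>) * FF p)) \<in> borel_measurable (lborel \<Otimes>\<^sub>M lborel)"
      by measurable
    then show "(\<lambda>(p, \<xi>). G \<xi> *\<^sub>R (cis ((snd p - fst p) \<bullet> \<xi>) * F (fst p) (snd p)))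
        \<in> borel_measurable (lborel \<Otimes>\<^sub>M lborel)"
      by (simp add: d_def FF_def)
    show "norm (G \<xi> *\<^sub>R (cis ((snd p - fst p) \<bullet> \<xi>) * F (fst p) (snd p))) \<le> norm (F (fst p) (snd p)) * G \<xi>" for p \<xi>
      by (simp add: norm_mult G_def)
  qed (use integrable_norm[OF Fi'] Gi in auto)
  also have "\<dots> = (LINT p|lborel. ((sqrt (2 * pi) / \<epsilon>) ^ CARD('n) * W ((fst p - snd p) /\<^sub>R \<epsilon>)) *\<^sub>R F (fst p) (snd p))"
  proof (intro Bochner_Integration.integral_cong refl)
    fix p :: "(real^'n) \<times> (real^'n)"
    have "(LINT \<xi>|lborel. G \<xi> *\<^sub>R (cis ((snd p - fst p) \<bullet> \<xi>) * F (fst p) (snd p))) =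
      (LINT \<xi>|lborel. (cis ((snd p - fst p) \<bullet> \<xi>) * complex_of_real (G \<xi>)) * F (fst p) (snd p))"
      by (simp add: scaleR_conv_of_real mult_ac)
    also have "\<dots> = (LINT \<xi>|lborel. cis ((snd p - fst p) \<bullet> \<xi>) * complex_of_real (G \<xi>)) * F (fst p) (snd p)"
      by simp
    also have "\<dots> = ((sqrt (2 * pi) / \<epsilon>) ^ CARD('n) * W ((fst p - snd p) /\<^sub>R \<epsilon>)) *\<^sub>R F (fst p) (snd p)"
      unfolding G_def integral_gaussian_scaled(1)[OF e]
      by (simp add: W_def scaleR_conv_of_real[where 'a = complex] norm_minus_commute)
    finally show "(LINT \<xi>|lborel. G \<xi> *\<^sub>R (cis ((snd p - fst p) \<bullet> \<xi>) * F (fst p) (snd p))) =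
      ((sqrt (2 * pi) / \<epsilon>) ^ CARD('n) * W ((fst p - snd p) /\<^sub>R \<epsilon>)) *\<^sub>R F (fst p) (snd p)" .
  qed
  also have "\<dots> = (LINT y|lborel. (LINT x|lborel. ((sqrt (2 * pi) / \<epsilon>) ^ CARD('n) * W ((x - y) /\<^sub>R \<epsilon>)) *\<^sub>R F x y))"
  proof -
    have "integrable (lborel \<Otimes>\<^sub>M lborel) (\<lambda>(x, y). ((sqrt (2 * pi) / \<epsilon>) ^ CARD('n) * W ((x - y) /\<^sub>R \<epsilon>)) *\<^sub>R F x y)"
    proof (rule integrable_pair_dominated[where g = "\<lambda>x. (sqrt (2 * pi) / \<epsilon>) ^ CARD('n) * norm (f x)" and h = "\<lambda>y. norm (g y)"])
      fix x y
      have "W ((x - y) /\<^sub>R \<epsilon>) \<le> 1" "W ((x - y) /\<^sub>R \<epsilon>) \<ge> 0"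
        by (simp_all add: W_def)
      from mult_right_mono[OF this(1), of "(sqrt (2 * pi) / \<epsilon>) ^ CARD('n) * (norm (f x) * norm (g y))"] this(2)
      show "norm (((sqrt (2 * pi) / \<epsilon>) ^ CARD('n) * W ((x - y) /\<^sub>R \<epsilon>)) *\<^sub>R F x y)
        \<le> (sqrt (2 * pi) / \<epsilon>) ^ CARD('n) * norm (f x) * norm (g y)"
        using e by (simp add: norm_mult F_def abs_mult mult_ac)
      show "(\<lambda>(x, y). ((sqrt (2 * pi) / \<epsilon>) ^ CARD('n) * W ((x - y) /\<^sub>R \<epsilon>)) *\<^sub>R F x y) \<in> borel_measurable (lborel \<Otimes>\<^sub>M lborel)"
        unfolding F_def by measurable
    qed (use f g in auto)
    from lborel_pair.integral_snd[OF this] show ?thesis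
      by (simp add: lborel_prod split_def)
  qed
  also have "\<dots> = (LINT y|lborel. sqrt (2 * pi) ^ CARD('n) *\<^sub>R (LINT w|lborel. W w *\<^sub>R F (y + \<epsilon> *\<^sub>R w) y))"
  proof (intro Bochner_Integration.integral_cong refl)
    fix y
    define c where "c = (sqrt (2 * pi) / \<epsilon>) ^ CARD('n)"
    have "(LINT x|lborel. (c * W ((x - y) /\<^sub>R \<epsilon>)) *\<^sub>R F x y) =
        \<epsilon> ^ CARD('n) *\<^sub>R (LINT w|lborel. (c * W w) *\<^sub>R F (y + \<epsilon> *\<^sub>R w) y)"
      using e unfolding F_def by (subst lborel_integral_scale[where c = \<epsilon> and t = y]) simp_all
    also have "\<dots> = (\<epsilon> ^ CARD('n) * c) *\<^sub>R (LINT w|lborel. W w *\<^sub>R F (y + \<epsilon> *\<^sub>R w) y)"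
      by (simp only: scaleR_scaleR[symmetric] Bochner_Integration.integral_scaleR_right)
    also have "\<epsilon> ^ CARD('n) * c = sqrt (2 * pi) ^ CARD('n)"
      using e by (simp add: c_def power_divide)
    finally show "(LINT x|lborel. ((sqrt (2 * pi) / \<epsilon>) ^ CARD('n) * W ((x - y) /\<^sub>R \<epsilon>)) *\<^sub>R F x y) =
        sqrt (2 * pi) ^ CARD('n) *\<^sub>R (LINT w|lborel. W w *\<^sub>R F (y + \<epsilon> *\<^sub>R w) y)"
      unfolding c_def .
  qed
  finally show ?thesis
    by (simp add: W_def F_def)
qed

text \<open>The limit \<epsilon> \<rightarrow> 0 of the Gaussian version. The hypotheses are
  asymmetric on purpose: \<open>g\<close> will be u times the primitive weight, of which only
  integrability is used, so regularity is asked of \<open>f\<close> alone and integrability in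
  frequency only of the product.\<close>

theorem fourier_parseval:
  fixes f g :: "real^'n::finite \<Rightarrow> complex"
  assumes f: "integrable lborel f" and g: "integrable lborel g"
    and cont: "continuous_on UNIV f" and bound: "\<And>x. norm (f x) \<le> B"
    and fg: "integrable lborel (\<lambda>\<xi>. fourier f \<xi> * cnj (fourier g \<xi>))"
  shows "(LINT \<xi>|lborel. fourier f \<xi> * cnj (fourier g \<xi>)) = (2 * pi) ^ CARD('n) *\<^sub>R (LINT x|lborel. f x * cnj (g x))"
proof -
  have [measurable]: "f \<in> borel_measurable borel" "g \<in> borel_measurable borel"
    using f g by (auto dest: borel_measurable_integrable)
  define e where "e = (\<lambda>m. inverse (real (Suc m)))"
  have e: "e m > 0" for m by (simp add: e_def)
  have e0: "e \<longlonglongrightarrow> 0"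
    unfolding e_def by (rule LIMSEQ_inverse_real_of_nat)
  define W where "W = (\<lambda>w::real^'n. exp (- (norm w)\<^sup>2 / 2))"
  have Wint: "integrable lborel W" and W1: "(LINT w|lborel. W w) = sqrt (2 * pi) ^ CARD('n)"
  proof -
    have "integrable lborel (\<lambda>w. complex_of_real (W w))"
      and "(LINT w|lborel. complex_of_real (W w)) = complex_of_real (sqrt (2 * pi) ^ CARD('n))"
      using integrable_gaussian[of "0::real^'n"] integral_gaussian[of "0::real^'n"] by (simp_all add: W_def)
    from integrable_norm[OF this(1)] this(2)
    show "integrable lborel W" "(LINT w|lborel. W w) = sqrt (2 * pi) ^ CARD('n)"
      by (simp_all add: W_def del: of_real_power)
  qed
  have [measurable]: "W \<in> borel_measurable borel"
    unfolding W_def by measurable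
  have W_nonneg: "W w \<ge> 0" for w by (simp add: W_def)
  have B: "B \<ge> 0" using norm_ge_zero bound by (rule order_trans)
  have "(\<lambda>m. LINT \<xi>|lborel. exp (- (norm (e m *\<^sub>R \<xi>))\<^sup>2 / 2) *\<^sub>R (fourier f \<xi> * cnj (fourier g \<xi>)))
     \<longlonglongrightarrow> (LINT \<xi>|lborel. exp (- (norm (0 *\<^sub>R \<xi>))\<^sup>2 / 2) *\<^sub>R (fourier f \<xi> * cnj (fourier g \<xi>)))"
  proof (rule integral_dominated_convergence[where w = "\<lambda>\<xi>. norm (fourier f \<xi> * cnj (fourier g \<xi>))"])
    show "AE \<xi> in lborel. (\<lambda>m. exp (- (norm (e m *\<^sub>R \<xi>))\<^sup>2 / 2) *\<^sub>R (fourier f \<xi> * cnj (fourier g \<xi>)))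
      \<longlonglongrightarrow> exp (- (norm (0 *\<^sub>R \<xi>))\<^sup>2 / 2) *\<^sub>R (fourier f \<xi> * cnj (fourier g \<xi>))"
      by (intro AE_I2 tendsto_intros e0) auto
    have [measurable]: "(\<lambda>\<xi>. fourier f \<xi> * cnj (fourier g \<xi>)) \<in> borel_measurable borel"
      using borel_measurable_integrable[OF fg] by simp
    have meas: "(\<lambda>\<xi>. exp (- (norm (t *\<^sub>R \<xi>))\<^sup>2 / 2) *\<^sub>R (fourier f \<xi> * cnj (fourier g \<xi>))) \<in> borel_measurable lborel"
      for t by measurable
    show "(\<lambda>\<xi>. exp (- (norm (0 *\<^sub>R \<xi>))\<^sup>2 / 2) *\<^sub>R (fourier f \<xi> * cnj (fourier g \<xi>))) \<in> borel_measurable lborel"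
      and "(\<lambda>\<xi>. exp (- (norm (e m *\<^sub>R \<xi>))\<^sup>2 / 2) *\<^sub>R (fourier f \<xi> * cnj (fourier g \<xi>))) \<in> borel_measurable lborel" for m
      by (rule meas)+
    show "integrable lborel (\<lambda>\<xi>. norm (fourier f \<xi> * cnj (fourier g \<xi>)))"
      using fg by (rule integrable_norm)
    show "AE \<xi> in lborel. norm (exp (- (norm (e m *\<^sub>R \<xi>))\<^sup>2 / 2) *\<^sub>R (fourier f \<xi> * cnj (fourier g \<xi>)))
      \<le> norm (fourier f \<xi> * cnj (fourier g \<xi>))" for m
      by (auto intro!: mult_left_le_one_le)
  qed
  moreover have "(\<lambda>m. LINT \<xi>|lborel. exp (- (norm (e m *\<^sub>R \<xi>))\<^sup>2 / 2) *\<^sub>R (fourier f \<xi> * cnj (fourier g \<xi>)))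
     \<longlonglongrightarrow> (2 * pi) ^ CARD('n) *\<^sub>R (LINT y|lborel. f y * cnj (g y))"
  proof -
    \<comment> \<open>The limit is taken on the product space, where the single majorant B |g(y)|
      W(w) serves for all widths; continuity and boundedness of \<open>f\<close> are used
      here.\<close>
    define Q where "Q = (\<lambda>t p. W (snd p) *\<^sub>R (f (fst p + t *\<^sub>R snd p) * cnj (g (fst p))))"
    have dom: "integrable lborel (\<lambda>p::(real^'n)\<times>(real^'n). (B * norm (g (fst p))) * W (snd p))"
      using integrable_pair_product[of "\<lambda>y. B * norm (g y)" W] g Wint
      by (simp add: lborel_prod split_def)
    have [measurable]: "Q t \<in> borel_measurable lborel" for t
    proof -
      have "Q t \<in> borel_measurable (lborel \<Otimes>\<^sub>M lborel)"
        unfolding Q_def by measurable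
      then show ?thesis by (simp add: lborel_prod)
    qed
    have Qle: "norm (Q t p) \<le> (B * norm (g (fst p))) * W (snd p)" for t p
      using mult_right_mono[OF bound[of "fst p + t *\<^sub>R snd p"], of "norm (g (fst p)) * W (snd p)"]
      by (simp add: Q_def norm_mult W_nonneg mult_ac)
    have Qint: "integrable lborel (Q t)" for t
      by (rule Bochner_Integration.integrable_bound[OF dom]) (use order_trans[OF Qle abs_ge_self] in auto)
    have iter: "(LINT y|lborel. (LINT w|lborel. W w *\<^sub>R (f (y + t *\<^sub>R w) * cnj (g y)))) = (LINT p|lborel. Q t p)" for t
      using lborel_pair.integral_fst'[of "Q t"] Qint[of t] by (simp add: lborel_prod Q_def)
    have "(\<lambda>m. LINT p|lborel. Q (e m) p) \<longlonglongrightarrow> (LINT p|lborel. Q 0 p)"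
    proof (rule integral_dominated_convergence[OF _ _ dom])
      have "(\<lambda>m. f (fst p + e m *\<^sub>R snd p)) \<longlonglongrightarrow> f (fst p + 0 *\<^sub>R snd p)" for p
        by (rule continuous_on_tendsto_compose[OF cont]) (auto intro!: tendsto_eq_intros e0)
      then show "AE p in lborel. (\<lambda>m. Q (e m) p) \<longlonglongrightarrow> Q 0 p"
        unfolding Q_def by (intro AE_I2 tendsto_intros)
    qed (use Qle in auto)
    moreover have "(LINT p|lborel. Q 0 p) = sqrt (2 * pi) ^ CARD('n) *\<^sub>R (LINT y|lborel. f y * cnj (g y))"
      unfolding iter[symmetric] using Wint by (simp add: W1)
    ultimately have "(\<lambda>m. sqrt (2 * pi) ^ CARD('n) *\<^sub>R (LINT p|lborel. Q (e m) p)) \<longlonglongrightarrow>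
        sqrt (2 * pi) ^ CARD('n) *\<^sub>R (sqrt (2 * pi) ^ CARD('n) *\<^sub>R (LINT y|lborel. f y * cnj (g y)))"
      by (intro tendsto_scaleR[OF tendsto_const]) simp
    moreover have "(LINT \<xi>|lborel. exp (- (norm (e m *\<^sub>R \<xi>))\<^sup>2 / 2) *\<^sub>R (fourier f \<xi> * cnj (fourier g \<xi>))) =
        sqrt (2 * pi) ^ CARD('n) *\<^sub>R (LINT p|lborel. Q (e m) p)" for m
      using fourier_parseval_gaussian[OF f g e[of m]] iter[of "e m"] by (simp only: W_def)
    \<comment> \<open>One factor comes from the Gaussian identity, the other is the total mass of
      \<open>W\<close>.\<close>
    moreover have "sqrt (2 * pi) ^ CARD('n) * sqrt (2 * pi) ^ CARD('n) = (2 * pi) ^ CARD('n)"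
      unfolding power_mult_distrib[symmetric] real_sqrt_mult_self by simp
    ultimately show ?thesis
      by (simp only: scaleR_scaleR)
  qed
  ultimately have "(LINT \<xi>|lborel. exp (- (norm (0 *\<^sub>R \<xi>))\<^sup>2 / 2) *\<^sub>R (fourier f \<xi> * cnj (fourier g \<xi>))) =
      (2 * pi) ^ CARD('n) *\<^sub>R (LINT y|lborel. f y * cnj (g y))"
    by (rule LIMSEQ_unique)
  then show ?thesis
    by simp
qed

section \<open>Homogeneous kernels\<close>

lemma emeasure_lborel_open_nonzero:
  fixes S :: "'a::euclidean_space set"
  assumes "open S" "S \<noteq> {}"
  shows "emeasure lborel S \<noteq> 0"
proof
  assume "emeasure lborel S = 0"
  then have "S \<in> null_sets lborel"
    using \<open>open S\<close> by (intro null_setsI) auto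
  then have "negligible S"
    by (simp add: negligible_iff_null_sets null_sets_completionI)
  with open_not_negligible[OF assms] show False ..
qed

text \<open>Uniqueness of Haar measure, with the constant fixed by the unit ball B. The double
  integral of 1_B(y) 1_A(f x + y) is evaluated twice. Translating x by a preimage of y removes y
  from the second factor and leaves |B| times the image measure of A. Translating y by f x and then
  x by a preimage of y leaves |A| times |B|, because f preserves the norm and hence B.\<close>

lemma lborel_distr_orthogonal:
  fixes f :: "'a::euclidean_space \<Rightarrow> 'a"
  assumes "orthogonal_transformation f"
  shows "distr lborel borel f = lborel"
proof -
  have lin: "linear f" and normf: "norm (f x) = norm x" for x
    using assms by (auto simp: orthogonal_transformation)
  have surj: "surj f"
    using assms by (rule orthogonal_transformation_surj)
  have [measurable]: "f \<in> borel_measurable borel"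
    using lin by (intro borel_measurable_continuous_onI linear_continuous_on) (simp add: linear_linear)
  define g where "g = inv f"
  have fg: "f (g y) = y" for y
    unfolding g_def using surj by (rule surj_f_inv_f)
  define B where "B = ball (0::'a) 1"
  have [measurable]: "B \<in> sets borel" by (simp add: B_def)
  have shift: "(\<integral>\<^sup>+x. h (x + c) \<partial>lborel) = (\<integral>\<^sup>+x. h x \<partial>lborel)"
    if [measurable]: "h \<in> borel_measurable borel" for h :: "'a \<Rightarrow> ennreal" and c
    by (subst (2) lborel_distr_shift[of c, symmetric]) (simp add: nn_integral_distr)
  have B: "emeasure lborel B \<noteq> 0" "emeasure lborel B \<noteq> \<infinity>"
    using emeasure_lborel_open_nonzero[of B] emeasure_lborel_ball_finite[of "0::'a" 1] by (auto simp: B_def)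
  show ?thesis
  proof (rule measure_eqI)
    fix A assume "A \<in> sets (distr lborel borel f)"
    then have [measurable]: "A \<in> sets borel" by simp
    have "emeasure lborel B * emeasure (distr lborel borel f) A =
        (\<integral>\<^sup>+y. indicator B y * (\<integral>\<^sup>+x. indicator A (f x) \<partial>lborel) \<partial>lborel)"
    proof -
      have "(\<integral>\<^sup>+x. indicator A (f x) \<partial>lborel) = (\<integral>\<^sup>+x. indicator A x \<partial>distr lborel borel f)"
        by (rule nn_integral_distr[symmetric]) measurable
      then show ?thesis
        by (simp add: nn_integral_multc)
    qed
    also have "\<dots> = (\<integral>\<^sup>+y. indicator B y * (\<integral>\<^sup>+x. indicator A (f x + y) \<partial>lborel) \<partial>lborel)"
    proof (rule nn_integral_cong, rule arg_cong2[where f = "(*)", OF refl])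
      fix y
      show "(\<integral>\<^sup>+x. indicator A (f x) \<partial>lborel) = (\<integral>\<^sup>+x. indicator A (f x + y) \<partial>lborel)"
        using shift[of "\<lambda>x. indicator A (f x)" "g y"] by (simp add: linear_add[OF lin] fg)
    qed
    also have "\<dots> = (\<integral>\<^sup>+y. (\<integral>\<^sup>+x. indicator B y * indicator A (f x + y) \<partial>lborel) \<partial>lborel)"
      by (simp add: nn_integral_cmult)
    also have "\<dots> = (\<integral>\<^sup>+x. (\<integral>\<^sup>+y. indicator B y * indicator A (f x + y) \<partial>lborel) \<partial>lborel)"
      by (rule lborel_pair.Fubini') measurable
    also have "\<dots> = (\<integral>\<^sup>+x. (\<integral>\<^sup>+y. indicator B (y - f x) * indicator A y \<partial>lborel) \<partial>lborel)"
    proof (rule nn_integral_cong)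
      fix x
      show "(\<integral>\<^sup>+y. indicator B y * indicator A (f x + y) \<partial>lborel) = (\<integral>\<^sup>+y. indicator B (y - f x) * indicator A y \<partial>lborel)"
        using shift[of "\<lambda>y. indicator B (y - f x) * indicator A y" "f x"] by (simp add: add.commute)
    qed
    also have "\<dots> = (\<integral>\<^sup>+y. (\<integral>\<^sup>+x. indicator A y * indicator B (y - f x) \<partial>lborel) \<partial>lborel)"
      by (subst lborel_pair.Fubini') (auto simp: mult.commute)
    also have "\<dots> = (\<integral>\<^sup>+y. indicator A y * (\<integral>\<^sup>+x. indicator B (y - f x) \<partial>lborel) \<partial>lborel)"
      by (simp add: nn_integral_cmult)
    also have "\<dots> = (\<integral>\<^sup>+y. indicator A y * emeasure lborel B \<partial>lborel)"
    proof (rule nn_integral_cong, rule arg_cong2[where f = "(*)", OF refl])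
      fix y
      have "indicator B (y - f (x + g y)) = (indicator B x :: ennreal)" for x
        by (simp add: linear_add[OF lin] fg B_def indicator_def normf)
      then show "(\<integral>\<^sup>+x. indicator B (y - f x) \<partial>lborel) = emeasure lborel B"
        using shift[of "\<lambda>x. indicator B (y - f x)" "g y"] by simp
    qed
    also have "\<dots> = emeasure lborel B * emeasure lborel A"
      by (simp add: nn_integral_multc mult.commute)
    finally show "emeasure (distr lborel borel f) A = emeasure lborel A"
      using B by (simp add: ennreal_mult_cancel_left)
  qed simp
qed

section \<open>Integrability of powers of the norm\<close>

lemma nn_integral_norm_powr_annulus:
  fixes p :: real
  defines "f \<equiv> \<lambda>z::'a::euclidean_space. ennreal (norm z powr - p)"
  assumes "r > 0"
  shows "(\<integral>\<^sup>+z. f z * indicator {z. r < norm z \<and> norm z \<le> 2 * r} z \<partial>lborel) =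
    ennreal (r powr (real DIM('a) - p)) * (\<integral>\<^sup>+z. f z * indicator {z. 1 < norm z \<and> norm z \<le> 2} z \<partial>lborel)"
proof -
  have [measurable]: "f \<in> borel_measurable borel"
    unfolding f_def by measurable
  have eq: "f (r *\<^sub>R z) * indicator {z. r < norm z \<and> norm z \<le> 2 * r} (r *\<^sub>R z) =
      ennreal (r powr - p) * (f z * indicator {z. 1 < norm z \<and> norm z \<le> 2} z)" for z
    using \<open>r > 0\<close> by (auto simp: f_def indicator_def powr_mult ennreal_mult)
  have "r ^ DIM('a) * r powr - p = r powr (real DIM('a) - p)"
    using \<open>r > 0\<close> by (simp add: powr_diff powr_minus_divide powr_realpow)
  then have c: "ennreal (r ^ DIM('a)) * ennreal (r powr - p) = ennreal (r powr (real DIM('a) - p))"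
    using \<open>r > 0\<close> by (simp flip: ennreal_mult)
  show ?thesis
    by (subst lborel_nn_integral_scale[OF _ \<open>r > 0\<close>], simp)
       (simp only: eq, subst nn_integral_cmult, simp, simp only: c mult.assoc[symmetric])
qed

text \<open>Dyadic shells take the place of polar coordinates: by scaling, the shell of inner radius
  b^k contributes the k-th power of b^(n - p) times the unit shell. The geometric series converges
  for b = 2 when p > n and for b = 1/2 when p < n.\<close>

lemma
  fixes p :: real
  assumes p: "p \<ge> 0"
  shows nn_integral_norm_powr_outside:
      "p > real DIM('a) \<Longrightarrow> (\<integral>\<^sup>+z. ennreal (norm z powr - p) * indicator {z. 1 < norm z} z \<partial>(lborel :: 'a::euclidean_space measure)) < \<infinity>"
    and nn_integral_norm_powr_inside:
      "p < real DIM('a) \<Longrightarrow> (\<integral>\<^sup>+z. ennreal (norm z powr - p) * indicator {z. norm z \<le> 1} z \<partial>(lborel :: 'a::euclidean_space measure)) < \<infinity>"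
proof -
  define f where "f = (\<lambda>z::'a. ennreal (norm z powr - p))"
  define A where "A = (\<lambda>r. {z::'a. r < norm z \<and> norm z \<le> 2 * r})"
  have [measurable]: "f \<in> borel_measurable borel" "A r \<in> sets borel" for r
    unfolding f_def A_def by measurable
  define J where "J = (\<integral>\<^sup>+z. f z * indicator (A 1) z \<partial>lborel)"
  have "J \<le> (\<integral>\<^sup>+z. indicator (cball (0::'a) 2) z \<partial>lborel)"
    unfolding J_def
  proof (rule nn_integral_mono)
    fix z
    have "f z \<le> 1" if "1 < norm z"
    proof -
      have "norm z powr - p \<le> 1"
        using ge_one_powr_ge_zero[of "norm z" p] that p by (simp add: powr_minus_divide divide_le_eq_1)
      then show ?thesis
        by (simp add: f_def ennreal_le_1)
    qed
    then show "f z * indicator (A 1) z \<le> indicator (cball 0 2) z"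
      by (auto simp: indicator_def A_def)
  qed
  also have "\<dots> < \<infinity>"
    using emeasure_lborel_cball_finite[of "0::'a" 2] by simp
  finally have J: "J < \<infinity>" .
  have sum: "(\<Sum>k. \<integral>\<^sup>+z. f z * indicator (A (b ^ k)) z \<partial>lborel) < \<infinity>"
    if "b > 0" "b powr (real DIM('a) - p) < 1" for b
  proof -
    have "(\<integral>\<^sup>+z. f z * indicator (A (b ^ k)) z \<partial>lborel) = ennreal ((b powr (real DIM('a) - p)) ^ k) * J" for k
    proof -
      have "(b ^ k) powr (real DIM('a) - p) = (b powr (real DIM('a) - p)) ^ k"
        using \<open>b > 0\<close> by (simp add: powr_realpow[symmetric] powr_powr mult.commute)
      then show ?thesis
        using nn_integral_norm_powr_annulus[of "b ^ k" p, where 'a = 'a] \<open>b > 0\<close>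
        unfolding f_def A_def J_def by simp
    qed
    then have "(\<Sum>k. \<integral>\<^sup>+z. f z * indicator (A (b ^ k)) z \<partial>lborel) = (\<Sum>k. ennreal ((b powr (real DIM('a) - p)) ^ k)) * J"
      by simp
    moreover have "(\<Sum>k. ennreal ((b powr (real DIM('a) - p)) ^ k)) < \<infinity>"
    proof -
      have "summable (\<lambda>k. (b powr (real DIM('a) - p)) ^ k)"
        by (rule summable_geometric) (use that in simp)
      then have "(\<Sum>k. ennreal ((b powr (real DIM('a) - p)) ^ k)) = ennreal (\<Sum>k. (b powr (real DIM('a) - p)) ^ k)"
        by (intro suminf_ennreal2) auto
      then show ?thesis
        by (simp only: ennreal_less_top infinity_ennreal_def)
    qed
    ultimately show ?thesis
      using J by (simp only: ennreal_mult_less_top infinity_ennreal_def) simp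
  qed
  have cover: "(\<integral>\<^sup>+z. f z * indicator S z \<partial>lborel) \<le> (\<Sum>k. \<integral>\<^sup>+z. f z * indicator (A (b ^ k)) z \<partial>lborel)"
    if "\<And>z. z \<in> S \<Longrightarrow> f z \<noteq> 0 \<Longrightarrow> \<exists>k. z \<in> A (b ^ k)" for S b
  proof -
    have "f z * indicator S z \<le> (\<Sum>k. f z * indicator (A (b ^ k)) z)" for z
    proof (cases "z \<in> S \<and> f z \<noteq> 0")
      case True
      with that obtain k where "z \<in> A (b ^ k)" by blast
      then have "f z * indicator S z \<le> f z * indicator (A (b ^ k)) z"
        using True by simp
      also have "\<dots> \<le> (\<Sum>k. f z * indicator (A (b ^ k)) z)"
      proof -
        define h where "h = (\<lambda>k. f z * indicator (A (b ^ k)) z)"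
        have "h k \<le> (\<Sum>k. h k)"
          using sum_le_suminf[of h "{k}"] by simp
        then show ?thesis
          by (simp add: h_def)
      qed
      finally show ?thesis .
    qed auto
    then have "(\<integral>\<^sup>+z. f z * indicator S z \<partial>lborel) \<le> (\<integral>\<^sup>+z. (\<Sum>k. f z * indicator (A (b ^ k)) z) \<partial>lborel)"
      by (rule nn_integral_mono)
    also have "\<dots> = (\<Sum>k. \<integral>\<^sup>+z. f z * indicator (A (b ^ k)) z \<partial>lborel)"
      by (rule nn_integral_suminf) measurable
    finally show ?thesis .
  qed
  show "(\<integral>\<^sup>+z. ennreal (norm z powr - p) * indicator {z. 1 < norm z} z \<partial>(lborel :: 'a measure)) < \<infinity>" if "p > real DIM('a)"
  proof -
    have "\<exists>k. z \<in> A (2 ^ k)" if z: "z \<in> {z. 1 < norm z}" for z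
    proof -
      define m where "m = (LEAST m. norm z \<le> 2 ^ m)"
      have "\<exists>m. norm z \<le> 2 ^ m"
        using real_arch_pow[of 2 "norm z"] by (auto intro: less_imp_le)
      then have m: "norm z \<le> 2 ^ m"
        unfolding m_def by (rule LeastI_ex)
      with z have "m \<noteq> 0" by (intro notI) simp
      then obtain k where k: "m = Suc k" by (cases m) auto
      then have "\<not> norm z \<le> 2 ^ k"
        unfolding m_def by (metis lessI not_less_Least)
      then have "z \<in> A (2 ^ k)"
        using m k by (auto simp: A_def not_le)
      then show ?thesis ..
    qed
    then have "(\<integral>\<^sup>+z. f z * indicator {z. 1 < norm z} z \<partial>lborel) \<le> (\<Sum>k. \<integral>\<^sup>+z. f z * indicator (A (2 ^ k)) z \<partial>lborel)"
      by (rule cover)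
    also have "\<dots> < \<infinity>"
      using that by (intro sum) (auto simp: powr_less_one)
    finally show ?thesis
      unfolding f_def .
  qed
  show "(\<integral>\<^sup>+z. ennreal (norm z powr - p) * indicator {z. norm z \<le> 1} z \<partial>(lborel :: 'a measure)) < \<infinity>" if "p < real DIM('a)"
  proof -
    \<comment> \<open>No shell contains the origin. There \<open>0 powr - p\<close> is 0 by
      convention, so the condition \<open>f z \<noteq> 0\<close> excludes just this point.\<close>
    have "\<exists>k. z \<in> A ((1/2) ^ k)" if z: "z \<in> {z. norm z \<le> 1}" and "f z \<noteq> 0" for z
    proof -
      define m where "m = (LEAST m. (1/2) ^ m < norm z)"
      have "norm z > 0"
        using \<open>f z \<noteq> 0\<close> by (auto simp: f_def)
      then have "\<exists>m. (1/2) ^ m < norm z"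
        by (rule real_arch_pow_inv) simp
      then have m: "(1/2) ^ m < norm z"
        unfolding m_def by (rule LeastI_ex)
      with z have "m \<noteq> 0" by (intro notI) simp
      then obtain k where k: "m = Suc k" by (cases m) auto
      then have "\<not> (1/2) ^ k < norm z"
        unfolding m_def by (metis lessI not_less_Least)
      \<comment> \<open>The radii decrease here, so the first one below \<open>norm z\<close> is the
        inner radius of the shell: the index is \<open>m\<close> itself, whereas for the outer
        region it is the predecessor of \<open>m\<close>.\<close>
      then have "z \<in> A ((1/2) ^ m)"
        using m k by (auto simp: A_def)
      then show ?thesis ..
    qed
    then have "(\<integral>\<^sup>+z. f z * indicator {z. norm z \<le> 1} z \<partial>lborel) \<le> (\<Sum>k. \<integral>\<^sup>+z. f z * indicator (A ((1/2) ^ k)) z \<partial>lborel)"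
      by (rule cover)
    also have "\<dots> < \<infinity>"
      using that by (intro sum) (auto simp: powr_divide)
    finally show ?thesis
      unfolding f_def .
  qed
qed

text \<open>The exact power of R matters: R will be proportional to sqrt(1 + s^2), which turns decay
  of the kernel into decay of the weight in s.\<close>

lemma nn_integral_norm_powr_tail:
  fixes q :: real
  assumes q: "q > 0"
  obtains C where "C \<ge> 0"
    "\<And>R. R > 0 \<Longrightarrow> (\<integral>\<^sup>+z. ennreal (norm z powr - (real DIM('a) + q)) * indicator {z. R < norm z} z \<partial>(lborel :: 'a::euclidean_space measure))
      = ennreal (C * R powr - q)"
proof
  define I where "I = (\<lambda>R. \<integral>\<^sup>+z. ennreal (norm z powr - (real DIM('a) + q)) * indicator {z. R < norm z} z \<partial>(lborel :: 'a measure))"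
  define C where "C = enn2real (I 1)"
  show "C \<ge> 0" by (simp add: C_def)
  have C: "I 1 = ennreal C"
    unfolding C_def I_def using nn_integral_norm_powr_outside[of "real DIM('a) + q", where 'a = 'a] q by simp
  fix R :: real assume R: "R > 0"
  have eq: "ennreal (norm (R *\<^sub>R z) powr - (real DIM('a) + q)) * indicator {z. R < norm z} (R *\<^sub>R z) =
     ennreal (R powr - (real DIM('a) + q)) * (ennreal (norm z powr - (real DIM('a) + q)) * indicator {z. 1 < norm z} z)" for z :: 'a
    using R by (auto simp: indicator_def powr_mult ennreal_mult)
  have "R ^ DIM('a) * R powr - (real DIM('a) + q) = R powr - q"
    using R by (simp add: powr_diff powr_minus_divide powr_realpow)
  then have c: "ennreal (R ^ DIM('a)) * ennreal (R powr - (real DIM('a) + q)) = ennreal (R powr - q)"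
    using R by (simp flip: ennreal_mult)
  have "I R = ennreal (R ^ DIM('a)) * (ennreal (R powr - (real DIM('a) + q)) * I 1)"
    unfolding I_def
    by (subst lborel_nn_integral_scale[OF _ R], simp) (simp only: eq, subst nn_integral_cmult, simp_all)
  also have "\<dots> = ennreal (C * R powr - q)"
    using \<open>C \<ge> 0\<close> by (simp only: mult.assoc[symmetric] c C) (simp add: ennreal_mult mult.commute)
  finally show "I R = ennreal (C * R powr - q)" .
qed

text \<open>Common majorant of the kernel integrals: the kernel has size |z|^-(n + a + 1), and it
  always meets a factor that is O(|z|^3) at the origin and O(|z|) at infinity.\<close>

definition riesz_weight :: "real \<Rightarrow> 'a::euclidean_space \<Rightarrow> real" where
  "riesz_weight a z = min 1 ((norm z)\<^sup>2) * norm z powr - (real DIM('a) + a)"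

lemma riesz_weight_nonneg: "riesz_weight a z \<ge> 0"
  by (simp add: riesz_weight_def)

lemma borel_measurable_riesz_weight [measurable]: "riesz_weight a \<in> borel_measurable borel"
  unfolding riesz_weight_def by measurable

lemma integrable_riesz_weight:
  assumes "1 \<le> a" "a < 2"
  shows "integrable lborel (riesz_weight a :: 'a::euclidean_space \<Rightarrow> real)"
proof (rule integrableI_bounded)
  \<comment> \<open>The estimate for powers asks for a nonnegative exponent; in dimension one this
    is where \<open>1 \<le> a\<close> enters.\<close>
  have dim: "real DIM('a) + a - 2 \<ge> 0"
    using DIM_positive[where 'a = 'a] assms by linarith
  have "(\<integral>\<^sup>+z. ennreal (norm (riesz_weight a z)) \<partial>(lborel :: 'a measure)) \<le>
     (\<integral>\<^sup>+z. ennreal (norm z powr - (real DIM('a) + a)) * indicator {z. 1 < norm z} z +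
       ennreal (norm z powr - (real DIM('a) + a - 2)) * indicator {z. norm z \<le> 1} z \<partial>(lborel :: 'a measure))"
  proof (intro nn_integral_mono)
    fix z :: 'a
    show "ennreal (norm (riesz_weight a z)) \<le> ennreal (norm z powr - (real DIM('a) + a)) * indicator {z. 1 < norm z} z +
       ennreal (norm z powr - (real DIM('a) + a - 2)) * indicator {z. norm z \<le> 1} z"
    proof (cases "z = 0")
      case False
      have "(norm z)\<^sup>2 * norm z powr - (real DIM('a) + a) = norm z powr - (real DIM('a) + a - 2)"
      proof -
        have "norm z powr - (real DIM('a) + a - 2) = norm z powr (2 + - (real DIM('a) + a))"
          by (rule arg_cong2[where f = "(powr)"]) auto
        also have "\<dots> = (norm z)\<^sup>2 * norm z powr - (real DIM('a) + a)"
          using False unfolding powr_add by simp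
        finally show ?thesis ..
      qed
      moreover have "min 1 ((norm z)\<^sup>2) * norm z powr - (real DIM('a) + a) \<le> 1 * norm z powr - (real DIM('a) + a)"
          "min 1 ((norm z)\<^sup>2) * norm z powr - (real DIM('a) + a) \<le> (norm z)\<^sup>2 * norm z powr - (real DIM('a) + a)"
        by (rule mult_right_mono; simp)+
      ultimately show ?thesis
        by (auto simp: riesz_weight_def indicator_def intro!: ennreal_leI)
    qed (simp add: riesz_weight_def)
  qed
  also have "\<dots> < \<infinity>"
    using nn_integral_norm_powr_outside[of "real DIM('a) + a", where 'a = 'a]
      nn_integral_norm_powr_inside[of "real DIM('a) + a - 2", where 'a = 'a] assms dim
    by (subst nn_integral_add) auto
  finally show "(\<integral>\<^sup>+z. ennreal (norm (riesz_weight a z)) \<partial>(lborel :: 'a measure)) < \<infinity>" .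
qed measurable

section \<open>The symbol of the kernel\<close>

lemma has_real_derivative_integral:
  fixes f :: "real \<Rightarrow> 'a \<Rightarrow> real"
  assumes int: "\<And>t. integrable M (f t)"
    and deriv: "\<And>t x. ((\<lambda>t. f t x) has_real_derivative f' t x) (at t)"
    and bound: "\<And>t x. \<bar>t\<bar> \<le> 1 \<Longrightarrow> \<bar>f' t x\<bar> \<le> g x"
    and meas: "f' 0 \<in> borel_measurable M"
    and g: "integrable M g"
  shows "((\<lambda>t. LINT x|M. f t x) has_real_derivative (LINT x|M. f' 0 x)) (at 0)"
proof -
  have "((\<lambda>h. ((LINT x|M. f h x) - (LINT x|M. f 0 x)) / h) \<longlongrightarrow> (LINT x|M. f' 0 x)) (at 0)"
    unfolding tendsto_at_iff_sequentially comp_def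
  proof (intro allI impI)
    fix X :: "nat \<Rightarrow> real" assume X0: "\<forall>i. X i \<in> UNIV - {0}" and X: "X \<longlonglongrightarrow> 0"
    \<comment> \<open>The majorant is available only for increments of size at most 1. Since X tends
      to 0, capping finitely many terms does not change the limit and makes the bound valid for
      every n.\<close>
    define Y where "Y = (\<lambda>n. if \<bar>X n\<bar> \<le> 1 then X n else 1)"
    have ev: "eventually (\<lambda>n. \<bar>X n\<bar> \<le> 1) sequentially"
      using X by (auto simp: tendsto_iff dist_real_def dest!: spec[of _ 1] elim!: eventually_mono)
    then have XY: "eventually (\<lambda>n. X n = Y n) sequentially"
      by eventually_elim (simp add: Y_def)
    have Y0: "Y n \<noteq> 0" "\<bar>Y n\<bar> \<le> 1" for n
      using X0 by (auto simp: Y_def)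
    have Y: "Y \<longlonglongrightarrow> 0"
      using tendsto_cong[OF XY] X by simp
    have "(\<lambda>n. LINT x|M. (f (Y n) x - f 0 x) / Y n) \<longlonglongrightarrow> (LINT x|M. f' 0 x)"
    proof (rule integral_dominated_convergence[OF meas _ g])
      show "(\<lambda>x. (f (Y n) x - f 0 x) / Y n) \<in> borel_measurable M" for n
        using int by (auto intro!: borel_measurable_divide borel_measurable_diff dest: borel_measurable_integrable)
      show "AE x in M. (\<lambda>n. (f (Y n) x - f 0 x) / Y n) \<longlonglongrightarrow> f' 0 x"
      proof (rule AE_I2)
        fix x
        have "((\<lambda>h. (f h x - f 0 x) / h) \<longlongrightarrow> f' 0 x) (at 0)"
          using deriv[of x 0] by (simp add: has_field_derivative_iff)
        then show "(\<lambda>n. (f (Y n) x - f 0 x) / Y n) \<longlonglongrightarrow> f' 0 x"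
          using Y Y0(1) unfolding tendsto_at_iff_sequentially comp_def by auto
      qed
      show "AE x in M. norm ((f (Y n) x - f 0 x) / Y n) \<le> g x" for n
      proof (rule AE_I2)
        fix x
        have "norm (f (Y n) x - f 0 x) \<le> g x * norm (Y n - 0)"
        proof (rule field_differentiable_bound[of "{-1..1}" "\<lambda>t. f t x" "\<lambda>t. f' t x"])
          show "((\<lambda>t. f t x) has_field_derivative f' t x) (at t within {- 1..1})" for t
            using deriv by (rule has_field_derivative_at_within)
        qed (use Y0[of n] bound in auto)
        then show "norm ((f (Y n) x - f 0 x) / Y n) \<le> g x"
          using Y0(1)[of n] by (simp add: field_simps)
      qed
    qed
    moreover have "(LINT x|M. (f (Y n) x - f 0 x) / Y n) = ((LINT x|M. f (Y n) x) - (LINT x|M. f 0 x)) / Y n" for n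
      by (simp only: integral_divide_zero Bochner_Integration.integral_diff[OF int int])
    ultimately have "(\<lambda>n. ((LINT x|M. f (Y n) x) - (LINT x|M. f 0 x)) / Y n) \<longlonglongrightarrow> (LINT x|M. f' 0 x)"
      by (simp only:)
    then show "(\<lambda>n. ((LINT x|M. f (X n) x) - (LINT x|M. f 0 x)) / X n) \<longlonglongrightarrow> (LINT x|M. f' 0 x)"
      by (rule Lim_transform_eventually) (use XY in eventually_elim, simp)
  qed
  then show ?thesis
    by (simp add: has_field_derivative_iff)
qed

lemma abs_sin_diff_le:
  fixes t :: real
  shows "\<bar>sin t - t\<bar> \<le> \<bar>t\<bar> ^ 3" "\<bar>sin t - t\<bar> \<le> 2 * \<bar>t\<bar>"
proof -
  have "\<bar>sin t - t\<bar> \<le> inverse (fact 3) * \<bar>t\<bar> ^ 3"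
    using Maclaurin_sin_bound[of t 3] by (simp add: sin_coeff_def numeral_3_eq_3)
  also have "\<dots> \<le> \<bar>t\<bar> ^ 3"
    by (simp add: fact_numeral field_simps)
  finally show "\<bar>sin t - t\<bar> \<le> \<bar>t\<bar> ^ 3" .
  show "\<bar>sin t - t\<bar> \<le> 2 * \<bar>t\<bar>"
    using abs_sin_x_le_abs_x[of t] by linarith
qed

lemma one_minus_cos_le:
  fixes t :: real
  shows "1 - cos t \<le> t\<^sup>2" "1 - cos t \<le> 2" "0 \<le> 1 - cos t"
proof -
  have "\<bar>sin (t / 2)\<bar> \<le> \<bar>t / 2\<bar>"
    by (rule abs_sin_x_le_abs_x)
  then have "(sin (t / 2))\<^sup>2 \<le> (t / 2)\<^sup>2"
    by (simp only: abs_le_square_iff)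
  moreover have "1 - cos t = 2 * (sin (t / 2))\<^sup>2"
    using cos_double_sin[of "t / 2"] by simp
  ultimately show "1 - cos t \<le> t\<^sup>2"
    by (simp add: power_divide) (use zero_le_power2[of t] in linarith)
  show "1 - cos t \<le> 2" "0 \<le> 1 - cos t"
    using cos_ge_minus_one[of t] by auto
qed

text \<open>Only the shape of the kernel of the derivative of |\<nabla>|^a along \<eta> is recorded;
  its constant survives as the implicit \<open>c\<close> of \<open>riesz_symbol_eq\<close>.\<close>

definition riesz_kernel :: "real \<Rightarrow> 'a::euclidean_space \<Rightarrow> 'a \<Rightarrow> real" where
  "riesz_kernel a \<eta> z = (z \<bullet> \<eta>) * norm z powr - (real DIM('a) + a + 2)"

lemma borel_measurable_riesz_kernel [measurable]: "riesz_kernel a \<eta> \<in> borel_measurable borel"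
  unfolding riesz_kernel_def by measurable

lemma riesz_kernel_le: "\<bar>riesz_kernel a \<eta> z\<bar> \<le> norm \<eta> * norm z powr - (real DIM('a) + a + 1)"
  for z :: "'a::euclidean_space"
proof (cases "z = 0")
  case False
  have "\<bar>riesz_kernel a \<eta> z\<bar> \<le> (norm z * norm \<eta>) * norm z powr - (real DIM('a) + a + 2)"
    using Cauchy_Schwarz_ineq2[of z \<eta>] by (auto simp: riesz_kernel_def abs_mult intro!: mult_right_mono)
  also have "norm z powr - (real DIM('a) + a + 1) = norm z powr (1 + - (real DIM('a) + a + 2))"
    by (rule arg_cong2[where f = "(powr)"]) auto
  then have "norm z * norm z powr - (real DIM('a) + a + 2) = norm z powr - (real DIM('a) + a + 1)"
    using False unfolding powr_add by simp
  then have "(norm z * norm \<eta>) * norm z powr - (real DIM('a) + a + 2) = norm \<eta> * norm z powr - (real DIM('a) + a + 1)"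
    by (simp add: mult_ac)
  finally show ?thesis .
qed (simp add: riesz_kernel_def)

lemma norm_powr_riesz_weight:
  fixes z :: "'a::euclidean_space"
  shows "min 1 ((norm z)\<^sup>2) * norm z * norm z powr - (real DIM('a) + a + 1) = riesz_weight a z"
proof (cases "z = 0")
  case False
  have "norm z powr - (real DIM('a) + a) = norm z powr (1 + - (real DIM('a) + a + 1))"
    by (rule arg_cong2[where f = "(powr)"]) auto
  then have "norm z * norm z powr - (real DIM('a) + a + 1) = norm z powr - (real DIM('a) + a)"
    using False unfolding powr_add by simp
  then show ?thesis
    by (simp add: riesz_weight_def mult.assoc)
qed (simp add: riesz_weight_def)

text \<open>A bound which separates the two variables, so that it can serve as integrable majorant on the product.\<close>

lemma riesz_kernel_dominated:
  fixes z :: "'a::euclidean_space"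
  assumes "\<bar>b\<bar> \<le> c * (min 1 ((norm z)\<^sup>2) * norm z)" "c \<ge> 0"
  shows "\<bar>b * riesz_kernel a \<eta> z\<bar> \<le> c * norm \<eta> * riesz_weight a z"
proof -
  have "\<bar>b * riesz_kernel a \<eta> z\<bar> \<le> (c * (min 1 ((norm z)\<^sup>2) * norm z)) * (norm \<eta> * norm z powr - (real DIM('a) + a + 1))"
    unfolding abs_mult using assms by (intro mult_mono riesz_kernel_le) auto
  also have "\<dots> = c * norm \<eta> * riesz_weight a z"
    by (simp add: norm_powr_riesz_weight[symmetric] mult_ac)
  finally show ?thesis .
qed

lemma abs_sin_diff_inner_le:
  fixes z \<xi> :: "'a::euclidean_space"
  shows "\<bar>sin (z \<bullet> \<xi>) - z \<bullet> \<xi>\<bar> \<le> (2 * (1 + norm \<xi>) ^ 3) * (min 1 ((norm z)\<^sup>2) * norm z)"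
proof -
  have zx: "\<bar>z \<bullet> \<xi>\<bar> \<le> norm z * norm \<xi>"
    by (rule Cauchy_Schwarz_ineq2)
  show ?thesis
  proof (cases "norm z \<le> 1")
    case True
    have "\<bar>sin (z \<bullet> \<xi>) - z \<bullet> \<xi>\<bar> \<le> \<bar>z \<bullet> \<xi>\<bar> ^ 3"
      by (rule abs_sin_diff_le)
    also have "\<dots> \<le> (norm z * norm \<xi>) ^ 3"
      using zx by (intro power_mono) auto
    also have "\<dots> \<le> norm z ^ 3 * (2 * (1 + norm \<xi>) ^ 3)"
    proof -
      have "norm \<xi> ^ 3 \<le> (1 + norm \<xi>) ^ 3"
        by (intro power_mono) auto
      then have "norm \<xi> ^ 3 \<le> 2 * (1 + norm \<xi>) ^ 3"
        using zero_le_power[OF norm_ge_zero, of \<xi> 3] by linarith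
      then show ?thesis
        unfolding power_mult_distrib by (intro mult_left_mono) auto
    qed
    also have "norm z ^ 3 = min 1 ((norm z)\<^sup>2) * norm z"
    proof -
      have "(norm z)\<^sup>2 \<le> 1"
        using True by (intro power_le_one) auto
      then show ?thesis
        by (simp add: min_absorb2 power3_eq_cube power2_eq_square)
    qed
    finally show ?thesis by (simp add: mult_ac)
  next
    case False
    then have "1 \<le> (norm z)\<^sup>2" by simp
    have "\<bar>sin (z \<bullet> \<xi>) - z \<bullet> \<xi>\<bar> \<le> 2 * \<bar>z \<bullet> \<xi>\<bar>"
      by (rule abs_sin_diff_le)
    also have "\<dots> \<le> (2 * (1 + norm \<xi>) ^ 3) * norm z"
    proof -
      have "(1 + norm \<xi>) ^ 1 \<le> (1 + norm \<xi>) ^ 3"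
        by (intro power_increasing) auto
      then have "norm \<xi> \<le> (1 + norm \<xi>) ^ 3" by simp
      then have "norm z * norm \<xi> \<le> norm z * (1 + norm \<xi>) ^ 3"
        by (intro mult_left_mono) auto
      with zx show ?thesis by (simp add: mult_ac)
    qed
    finally show ?thesis using \<open>1 \<le> (norm z)\<^sup>2\<close> by (simp add: min_def)
  qed
qed

lemma one_minus_cos_inner_le:
  fixes z \<xi> :: "'a::euclidean_space"
  shows "1 - cos (z \<bullet> \<xi>) \<le> (2 * (1 + norm \<xi>) ^ 2) * min 1 ((norm z)\<^sup>2)"
proof -
  have "1 - cos (z \<bullet> \<xi>) \<le> \<bar>z \<bullet> \<xi>\<bar>\<^sup>2"
    using one_minus_cos_le(1)[of "z \<bullet> \<xi>"] by simp
  also have "\<dots> \<le> (norm z * norm \<xi>)\<^sup>2"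
    by (intro power_mono Cauchy_Schwarz_ineq2) auto
  also have "\<dots> \<le> (norm z)\<^sup>2 * (2 * (1 + norm \<xi>)\<^sup>2)"
  proof -
    have "norm \<xi> ^ 2 \<le> (1 + norm \<xi>) ^ 2"
      by (intro power_mono) auto
    then have "norm \<xi> ^ 2 \<le> 2 * (1 + norm \<xi>) ^ 2"
      using zero_le_power2[of "norm \<xi>"] by linarith
    then show ?thesis
      unfolding power_mult_distrib by (intro mult_left_mono) auto
  qed
  finally have "1 - cos (z \<bullet> \<xi>) \<le> (norm z)\<^sup>2 * (2 * (1 + norm \<xi>)\<^sup>2)" .
  moreover have "1 - cos (z \<bullet> \<xi>) \<le> 1 * (2 * (1 + norm \<xi>)\<^sup>2)"
    proof -
    have "1 \<le> (1 + norm \<xi>)\<^sup>2"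
      by (rule one_le_power) simp
    with one_minus_cos_le(2)[of "z \<bullet> \<xi>"] show ?thesis by linarith
  qed
  ultimately show ?thesis
    by (simp add: min_def mult_ac)
qed

text \<open>Up to the factor \<open>\<i>\<close>, the Fourier transform of the kernel with the
  linear part of the oscillation removed. The cosine does not appear because the kernel is
  odd.\<close>

definition riesz_symbol :: "real \<Rightarrow> 'a::euclidean_space \<Rightarrow> 'a \<Rightarrow> real" where
  "riesz_symbol a \<xi> \<eta> = (LINT z|lborel. (sin (z \<bullet> \<xi>) - z \<bullet> \<xi>) * riesz_kernel a \<eta> z)"

section \<open>Symmetries and evaluation of the symbol\<close>

context
  fixes a :: real
  assumes a: "1 \<le> a" "a < 2"
begin

lemma integrable_riesz_symbol:
  "integrable lborel (\<lambda>z::'a::euclidean_space. (sin (z \<bullet> \<xi>) - z \<bullet> \<xi>) * riesz_kernel a \<eta> z)"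
proof (rule Bochner_Integration.integrable_bound)
  show "integrable lborel (\<lambda>z::'a. (2 * (1 + norm \<xi>) ^ 3) * norm \<eta> * riesz_weight a z)"
    using integrable_riesz_weight[OF a] by (rule integrable_mult_right)
  show "AE z in lborel. norm ((sin (z \<bullet> \<xi>) - z \<bullet> \<xi>) * riesz_kernel a \<eta> z)
    \<le> norm ((2 * (1 + norm \<xi>) ^ 3) * norm \<eta> * riesz_weight a z)"
    using riesz_kernel_dominated[OF abs_sin_diff_inner_le[of _ \<xi>], where a = a and \<eta> = \<eta>]
    by (auto intro!: AE_I2 order_trans[OF _ abs_ge_self])
qed measurable

lemma riesz_symbol_linear:
  fixes \<xi> :: "'a::euclidean_space"
  shows "riesz_symbol a \<xi> (r *\<^sub>R \<eta> + \<zeta>) = r * riesz_symbol a \<xi> \<eta> + riesz_symbol a \<xi> \<zeta>"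
proof -
  have "(sin (z \<bullet> \<xi>) - z \<bullet> \<xi>) * riesz_kernel a (r *\<^sub>R \<eta> + \<zeta>) z =
    r * ((sin (z \<bullet> \<xi>) - z \<bullet> \<xi>) * riesz_kernel a \<eta> z) + (sin (z \<bullet> \<xi>) - z \<bullet> \<xi>) * riesz_kernel a \<zeta> z" for z
    by (simp add: riesz_kernel_def inner_right_distrib algebra_simps)
  then show ?thesis
    using integrable_riesz_symbol[of \<xi>] by (simp add: riesz_symbol_def)
qed

lemma riesz_symbol_orthogonal:
  fixes f :: "'a::euclidean_space \<Rightarrow> 'a"
  assumes f: "orthogonal_transformation f"
  shows "riesz_symbol a (f \<xi>) (f \<eta>) = riesz_symbol a \<xi> \<eta>"
proof -
  have [measurable]: "f \<in> borel_measurable borel"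
    using f by (intro borel_measurable_continuous_onI linear_continuous_on)
      (simp add: linear_linear orthogonal_transformation)
  have "riesz_symbol a (f \<xi>) (f \<eta>) = (LINT z|distr lborel borel f. (sin (z \<bullet> f \<xi>) - z \<bullet> f \<xi>) * riesz_kernel a (f \<eta>) z)"
    by (simp add: riesz_symbol_def lborel_distr_orthogonal[OF f])
  also have "\<dots> = (LINT z|lborel. (sin (f z \<bullet> f \<xi>) - f z \<bullet> f \<xi>) * riesz_kernel a (f \<eta>) (f z))"
    by (rule integral_distr) measurable
  also have "\<dots> = riesz_symbol a \<xi> \<eta>"
    using f by (simp add: riesz_symbol_def riesz_kernel_def orthogonal_transformation_def orthogonal_transformation_norm)
  finally show ?thesis .
qed

lemma riesz_symbol_scale:
  fixes \<xi> :: "'a::euclidean_space"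
  assumes r: "r > 0"
  shows "riesz_symbol a (r *\<^sub>R \<xi>) \<eta> = r powr (a + 1) * riesz_symbol a \<xi> \<eta>"
proof -
  have eq: "(sin ((r *\<^sub>R z) \<bullet> \<xi>) - (r *\<^sub>R z) \<bullet> \<xi>) * riesz_kernel a \<eta> (r *\<^sub>R z) =
      (r * r powr - (real DIM('a) + a + 2)) * ((sin (z \<bullet> (r *\<^sub>R \<xi>)) - z \<bullet> (r *\<^sub>R \<xi>)) * riesz_kernel a \<eta> z)" for z
    using r by (simp add: riesz_kernel_def powr_mult)
  have "riesz_symbol a \<xi> \<eta> = r ^ DIM('a) *\<^sub>R
      (LINT z|lborel. (sin ((r *\<^sub>R z) \<bullet> \<xi>) - (r *\<^sub>R z) \<bullet> \<xi>) * riesz_kernel a \<eta> (r *\<^sub>R z))"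
    unfolding riesz_symbol_def using r by (subst lborel_integral_scale[where c = r and t = 0]) simp_all
  also have "\<dots> = (r ^ DIM('a) * (r * r powr - (real DIM('a) + a + 2))) * riesz_symbol a (r *\<^sub>R \<xi>) \<eta>"
    unfolding eq riesz_symbol_def by simp
  also have "r ^ DIM('a) * (r * r powr - (real DIM('a) + a + 2)) = inverse (r powr (a + 1))"
  proof -
    have "r ^ DIM('a) * (r * r powr - (real DIM('a) + a + 2)) = r powr (real DIM('a) + (1 + - (real DIM('a) + a + 2)))"
      unfolding powr_add using r by (simp add: powr_realpow)
    also have "\<dots> = r powr - (a + 1)"
      by (rule arg_cong2[where f = "(powr)"]) auto
    finally show ?thesis
      by (simp only: powr_minus)
  qed
  finally show ?thesis
    using r by (simp add: field_simps)
qed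

text \<open>The reflection in the hyperplane orthogonal to \<eta> fixes \<xi> and negates \<eta>. By
  invariance and by linearity in the second argument, the value equals its own negative.\<close>

lemma riesz_symbol_orthogonal_arguments:
  fixes \<xi> :: "'a::euclidean_space"
  assumes "\<xi> \<bullet> \<eta> = 0"
  shows "riesz_symbol a \<xi> \<eta> = 0"
proof (cases "\<eta> = 0")
  case False
  define f where "f = (\<lambda>z. z - (2 * (z \<bullet> \<eta>) / (\<eta> \<bullet> \<eta>)) *\<^sub>R \<eta>)"
  have "linear f"
    by (rule linearI) (simp_all add: f_def inner_left_distrib algebra_simps add_divide_distrib)
  moreover have "f v \<bullet> f w = v \<bullet> w" for v w
  proof -
    have "f v \<bullet> f w = v \<bullet> w - 2 * (w \<bullet> \<eta>) / (\<eta> \<bullet> \<eta>) * (v \<bullet> \<eta>) - 2 * (v \<bullet> \<eta>) / (\<eta> \<bullet> \<eta>) * (w \<bullet> \<eta>)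
        + 2 * (v \<bullet> \<eta>) / (\<eta> \<bullet> \<eta>) * (2 * (w \<bullet> \<eta>) / (\<eta> \<bullet> \<eta>) * (\<eta> \<bullet> \<eta>))"
      unfolding f_def inner_diff_left inner_diff_right inner_scaleR_left inner_scaleR_right
      by (simp only: inner_commute[of \<eta> w]) algebra
    also have "\<dots> = v \<bullet> w"
      using False by simp
    finally show ?thesis .
  qed
  ultimately have "orthogonal_transformation f"
    by (simp add: orthogonal_transformation_def)
  then have "riesz_symbol a (f \<xi>) (f \<eta>) = riesz_symbol a \<xi> \<eta>"
    by (rule riesz_symbol_orthogonal)
  moreover have "f \<xi> = \<xi>" "f \<eta> = (-1) *\<^sub>R \<eta> + 0"
    using assms False by (simp_all add: f_def scaleR_2)
  ultimately have "riesz_symbol a \<xi> \<eta> = riesz_symbol a \<xi> ((-1) *\<^sub>R \<eta> + 0)"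
    by simp
  then show ?thesis
    unfolding riesz_symbol_linear by (simp add: riesz_symbol_def riesz_kernel_def)
qed (simp add: riesz_symbol_def riesz_kernel_def)

text \<open>Since sin t - t and t have opposite signs, the integrand never becomes positive. It is
  nonzero on the half space z \<bullet> \<xi> > 0, which is open and nonempty and therefore not a
  null set.\<close>

lemma riesz_symbol_neg:
  fixes \<xi> :: "'a::euclidean_space"
  assumes "\<xi> \<noteq> 0"
  shows "riesz_symbol a \<xi> \<xi> < 0"
proof -
  define h where "h = (\<lambda>z. - ((sin (z \<bullet> \<xi>) - z \<bullet> \<xi>) * riesz_kernel a \<xi> z))"
  have sin_less: "sin t < t" if "t > 0" for t :: real
  proof (cases "t \<le> 1")
    case True
    obtain u where u: "0 < u" "u < t" "sin t - sin 0 = (t - 0) * cos u"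
      using MVT2[of 0 t sin cos] \<open>t > 0\<close> by (auto intro: DERIV_sin)
    have "cos u < cos 0"
      by (rule cos_monotone_0_pi) (use u True pi_gt3 in auto)
    with u \<open>t > 0\<close> show ?thesis by simp
  next
    case False
    then show ?thesis using sin_le_one[of t] by linarith
  qed
  have int: "integrable lborel h"
    unfolding h_def using integrable_riesz_symbol by (intro integrable_minus)
  have nonneg: "h z \<ge> 0" for z
  proof -
    have "(sin t - t) * t \<le> 0" for t :: real
      using sin_x_le_x[of t] sin_x_le_x[of "-t"] by (cases "t \<ge> 0") (auto simp: mult_le_0_iff)
    from mult_right_mono[OF this[of "z \<bullet> \<xi>"], of "norm z powr - (real DIM('a) + a + 2)"]
    show ?thesis
      by (simp add: h_def riesz_kernel_def mult_ac)
  qed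
  have "\<not> (AE z in lborel. h z = 0)"
  proof
    assume "AE z in lborel. h z = 0"
    moreover have "h z \<noteq> 0" if "z \<bullet> \<xi> > 0" for z
      using that sin_less[OF that] by (auto simp: h_def riesz_kernel_def)
    ultimately have "AE z in lborel. z \<notin> {z. 0 < z \<bullet> \<xi>}"
      by (auto elim!: eventually_mono)
    moreover have op: "open {z. 0 < z \<bullet> \<xi>}"
      by (intro open_Collect_less continuous_intros)
    ultimately have "emeasure lborel {z. 0 < z \<bullet> \<xi>} = 0"
      by (subst (asm) AE_iff_measurable[OF _ refl]) auto
    moreover have "\<xi> \<in> {z. 0 < z \<bullet> \<xi>}"
      using assms by simp
    ultimately show False
      using emeasure_lborel_open_nonzero[OF op] by blast
  qed
  then have "(LINT z|lborel. h z) \<noteq> 0"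
    using integral_nonneg_eq_0_iff_AE[OF int] nonneg by auto
  moreover have "(LINT z|lborel. h z) \<ge> 0"
    using nonneg by (intro integral_nonneg_AE) auto
  moreover have "(LINT z|lborel. h z) = - riesz_symbol a \<xi> \<xi>"
    unfolding h_def riesz_symbol_def by simp
  ultimately show ?thesis by simp
qed

text \<open>A rotation carries |\<xi>| e to \<xi>, homogeneity extracts the power of |\<xi>|, and
  the component of \<eta> orthogonal to \<xi> contributes nothing. So a single number, the value at
  a unit vector, determines the whole symbol, and only its sign is needed.\<close>

lemma riesz_symbol_eq:
  obtains c where "c > 0" "\<And>\<xi> \<eta> :: real^'n::finite. riesz_symbol a \<xi> \<eta> = - c * (norm \<xi> powr a * (\<xi> \<bullet> \<eta>))"
proof
  \<comment> \<open>Any unit vector serves; \<open>undefined\<close> is merely some index of the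
    coordinate type.\<close>
  define e :: "real^'n" where "e = axis undefined 1"
  have e: "norm e = 1" "e \<noteq> 0"
    by (simp_all add: e_def norm_axis_1 axis_eq_0_iff)
  define c where "c = - riesz_symbol a e e"
  show "c > 0"
    using riesz_symbol_neg[OF e(2)] by (simp add: c_def)
  fix \<xi> \<eta> :: "real^'n"
  show "riesz_symbol a \<xi> \<eta> = - c * (norm \<xi> powr a * (\<xi> \<bullet> \<eta>))"
  proof (cases "\<xi> = 0")
    case False
    obtain f where f: "orthogonal_transformation f" "f (norm \<xi> *\<^sub>R e) = \<xi>"
      by (rule orthogonal_transformation_exists[of "norm \<xi> *\<^sub>R e" \<xi>]) (auto simp: e)
    have "riesz_symbol a \<xi> \<xi> = riesz_symbol a (norm \<xi> *\<^sub>R e) (norm \<xi> *\<^sub>R e)"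
      using riesz_symbol_orthogonal[OF f(1), of "norm \<xi> *\<^sub>R e" "norm \<xi> *\<^sub>R e"] by (simp add: f)
    also have "\<dots> = norm \<xi> powr (a + 1) * (norm \<xi> * riesz_symbol a e e)"
      using False riesz_symbol_linear[of e "norm \<xi>" e 0]
      by (simp add: riesz_symbol_scale) (simp add: riesz_symbol_def riesz_kernel_def)
    also have "\<dots> = - c * norm \<xi> powr (a + 2)"
    proof -
      have "norm \<xi> powr (a + 2) = norm \<xi> powr ((a + 1) + 1)"
        by (rule arg_cong2[where f = "(powr)"]) auto
      also have "\<dots> = norm \<xi> powr (a + 1) * norm \<xi>"
        using False by (subst powr_add) simp
      finally show ?thesis by (simp add: c_def)
    qed
    finally have diag: "riesz_symbol a \<xi> \<xi> = - c * norm \<xi> powr (a + 2)" .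
    define r where "r = (\<xi> \<bullet> \<eta>) / (norm \<xi>)\<^sup>2"
    have "\<xi> \<bullet> (\<eta> - r *\<^sub>R \<xi>) = 0"
      using False by (simp add: r_def inner_diff_right power2_norm_eq_inner)
    then have "riesz_symbol a \<xi> (r *\<^sub>R \<xi> + (\<eta> - r *\<^sub>R \<xi>)) = r * riesz_symbol a \<xi> \<xi>"
      unfolding riesz_symbol_linear by (simp add: riesz_symbol_orthogonal_arguments)
    then have "riesz_symbol a \<xi> \<eta> = - c * ((norm \<xi> powr (a + 2) / (norm \<xi>)\<^sup>2) * (\<xi> \<bullet> \<eta>))"
      by (simp add: diag r_def)
    also have "norm \<xi> powr (a + 2) / (norm \<xi>)\<^sup>2 = norm \<xi> powr a"
      using False by (simp add: powr_add)
    finally show ?thesis .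
  qed (simp add: riesz_symbol_def)
qed

text \<open>Obtained by differentiating the preceding identity in \<open>\<xi>\<close> along \<open>\<sigma>\<close>.\<close>

lemma riesz_commutator_symbol:
  fixes \<xi> \<eta> \<sigma> :: "real^'n::finite"
  assumes c: "\<And>\<xi> \<eta> :: real^'n. riesz_symbol a \<xi> \<eta> = - c * (norm \<xi> powr a * (\<xi> \<bullet> \<eta>))"
    and "\<xi> \<noteq> 0"
  shows "(LINT z|lborel. (1 - cos (z \<bullet> \<xi>)) * (\<sigma> \<bullet> z) * riesz_kernel a \<eta> z) =
    c * (norm \<xi> powr a * (\<sigma> \<bullet> \<eta>) + a * norm \<xi> powr (a - 2) * (\<xi> \<bullet> \<sigma>) * (\<xi> \<bullet> \<eta>))"
proof -
  define f where "f = (\<lambda>t z. (sin (z \<bullet> (\<xi> + t *\<^sub>R \<sigma>)) - z \<bullet> (\<xi> + t *\<^sub>R \<sigma>)) * riesz_kernel a \<eta> z)"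
  define f' where "f' = (\<lambda>t z. - ((1 - cos (z \<bullet> (\<xi> + t *\<^sub>R \<sigma>))) * (\<sigma> \<bullet> z) * riesz_kernel a \<eta> z))"
  \<comment> \<open>For |t| \<le> 1 the frequency \<xi> + t \<sigma> has norm at most |\<xi>| +
    |\<sigma>|, which makes the majorant independent of t.\<close>
  define K where "K = 2 * (1 + (norm \<xi> + norm \<sigma>)) ^ 2 * norm \<sigma>"
  have "((\<lambda>t. LINT z|lborel. f t z) has_real_derivative (LINT z|lborel. f' 0 z)) (at 0)"
  proof (rule has_real_derivative_integral)
    show "integrable lborel (f t)" for t
      unfolding f_def by (rule integrable_riesz_symbol)
    show "((\<lambda>t. f t z) has_real_derivative f' t z) (at t)" for t z
      unfolding f_def f'_def
      by (auto intro!: derivative_eq_intros simp: inner_add_right inner_commute algebra_simps)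
    show "integrable lborel (\<lambda>z. K * norm \<eta> * riesz_weight a z)"
      using integrable_riesz_weight[OF a] by (rule integrable_mult_right)
    show "\<bar>f' t z\<bar> \<le> K * norm \<eta> * riesz_weight a z" if "\<bar>t\<bar> \<le> 1" for t z
    proof -
      define \<zeta> where "\<zeta> = \<xi> + t *\<^sub>R \<sigma>"
      have "norm \<zeta> \<le> norm \<xi> + norm \<sigma>"
        unfolding \<zeta>_def using that
        by (intro order_trans[OF norm_triangle_ineq] add_left_mono) (simp add: mult_left_le_one_le)
      then have "(1 + norm \<zeta>) ^ 2 \<le> (1 + (norm \<xi> + norm \<sigma>)) ^ 2"
        by (intro power_mono) auto
      then have "2 * (1 + norm \<zeta>) ^ 2 * min 1 ((norm z)\<^sup>2) \<le> 2 * (1 + (norm \<xi> + norm \<sigma>)) ^ 2 * min 1 ((norm z)\<^sup>2)"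
        by (intro mult_right_mono mult_left_mono) auto
      with one_minus_cos_inner_le[of z \<zeta>]
      have "1 - cos (z \<bullet> \<zeta>) \<le> 2 * (1 + (norm \<xi> + norm \<sigma>)) ^ 2 * min 1 ((norm z)\<^sup>2)"
        by linarith
      then have "(1 - cos (z \<bullet> \<zeta>)) * \<bar>\<sigma> \<bullet> z\<bar> \<le> (2 * (1 + (norm \<xi> + norm \<sigma>)) ^ 2 * min 1 ((norm z)\<^sup>2)) * (norm \<sigma> * norm z)"
        by (intro mult_mono Cauchy_Schwarz_ineq2) auto
      then have "\<bar>- ((1 - cos (z \<bullet> \<zeta>)) * (\<sigma> \<bullet> z))\<bar> \<le> K * (min 1 ((norm z)\<^sup>2) * norm z)"
        by (simp add: abs_mult K_def mult_ac)
      from riesz_kernel_dominated[OF this, where a = a and \<eta> = \<eta>] show ?thesis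
        by (simp add: f'_def \<zeta>_def K_def)
    qed
    show "f' 0 \<in> borel_measurable lborel"
      unfolding f'_def by measurable
  qed
  \<comment> \<open>The norm is written as a power of the inner product, which is polynomial in t.
    Its power is differentiable at t = 0 because \<xi> \<noteq> 0.\<close>
  moreover have "(\<lambda>t. LINT z|lborel. f t z) =
      (\<lambda>t. - c * (((\<xi> + t *\<^sub>R \<sigma>) \<bullet> (\<xi> + t *\<^sub>R \<sigma>)) powr (a / 2) * ((\<xi> + t *\<^sub>R \<sigma>) \<bullet> \<eta>)))"
  proof
    fix t
    have "norm \<zeta> powr a = (\<zeta> \<bullet> \<zeta>) powr (a / 2)" for \<zeta> :: "real^'n"
      by (simp add: norm_eq_sqrt_inner powr_half_sqrt[symmetric] powr_powr)
    then show "(LINT z|lborel. f t z) = - c * (((\<xi> + t *\<^sub>R \<sigma>) \<bullet> (\<xi> + t *\<^sub>R \<sigma>)) powr (a / 2) * ((\<xi> + t *\<^sub>R \<sigma>) \<bullet> \<eta>))"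
      unfolding f_def riesz_symbol_def[symmetric] c by simp
  qed
  moreover have "((\<lambda>t. - c * (((\<xi> + t *\<^sub>R \<sigma>) \<bullet> (\<xi> + t *\<^sub>R \<sigma>)) powr (a / 2) * ((\<xi> + t *\<^sub>R \<sigma>) \<bullet> \<eta>)))
      has_real_derivative
      - c * ((\<xi> \<bullet> \<xi>) powr (a / 2) * (\<sigma> \<bullet> \<eta>) + a * (\<xi> \<bullet> \<xi>) powr (a / 2 - 1) * (\<xi> \<bullet> \<sigma>) * (\<xi> \<bullet> \<eta>))) (at 0)"
  proof -
    have "((\<lambda>t. (\<xi> + t *\<^sub>R \<sigma>) \<bullet> (\<xi> + t *\<^sub>R \<sigma>)) has_real_derivative 2 * (\<xi> \<bullet> \<sigma>)) (at 0)"
      unfolding inner_add_left inner_add_right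
      by (auto intro!: derivative_eq_intros simp: inner_commute)
    moreover have "((\<lambda>t. (\<xi> + t *\<^sub>R \<sigma>) \<bullet> \<eta>) has_real_derivative (\<sigma> \<bullet> \<eta>)) (at 0)"
      unfolding inner_add_left by (auto intro!: derivative_eq_intros)
    moreover have "\<xi> \<bullet> \<xi> > 0"
      using \<open>\<xi> \<noteq> 0\<close> by simp
    ultimately show ?thesis
      by (auto intro!: derivative_eq_intros simp: algebra_simps inner_commute[of \<sigma> \<xi>])
  qed
  ultimately have "(LINT z|lborel. f' 0 z) =
      - c * ((\<xi> \<bullet> \<xi>) powr (a / 2) * (\<sigma> \<bullet> \<eta>) + a * (\<xi> \<bullet> \<xi>) powr (a / 2 - 1) * (\<xi> \<bullet> \<sigma>) * (\<xi> \<bullet> \<eta>))"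
    using DERIV_unique by fastforce
  moreover have "(\<xi> \<bullet> \<xi>) powr (a / 2) = norm \<xi> powr a" "(\<xi> \<bullet> \<xi>) powr (a / 2 - 1) = norm \<xi> powr (a - 2)"
    by (simp_all add: norm_eq_sqrt_inner powr_half_sqrt[symmetric] powr_powr diff_divide_distrib)
  ultimately show ?thesis
    by (simp add: f'_def)
qed

end

section \<open>Schwartz functions and their Fourier transforms\<close>

lemma integrable_inverse_power_norm:
  "integrable lborel (\<lambda>x::'a::euclidean_space. inverse ((1 + norm x) ^ Suc DIM('a)))"
proof (rule integrableI_bounded)
  have "(\<integral>\<^sup>+x. ennreal (norm (inverse ((1 + norm x) ^ Suc DIM('a)))) \<partial>(lborel :: 'a measure)) \<le>
    (\<integral>\<^sup>+x. indicator (cball 0 1) x + ennreal (norm x powr - (real DIM('a) + 1)) * indicator {x. 1 < norm x} x \<partial>(lborel :: 'a measure))"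
  proof (rule nn_integral_mono)
    fix x :: 'a
    show "ennreal (norm (inverse ((1 + norm x) ^ Suc DIM('a)))) \<le>
      indicator (cball 0 1) x + ennreal (norm x powr - (real DIM('a) + 1)) * indicator {x. 1 < norm x} x"
    proof (cases "norm x \<le> 1")
      case True
      have "1 \<le> (1 + norm x) ^ Suc DIM('a)"
        by (rule one_le_power) simp
      then have "inverse ((1 + norm x) ^ Suc DIM('a)) \<le> 1"
        by (rule inverse_le_1_iff[THEN iffD2, OF disjI2])
      then show ?thesis
        using True by (simp add: ennreal_le_1)
    next
      case False
      have "norm x powr - (real DIM('a) + 1) = inverse (norm x powr (real (Suc DIM('a))))"
        by (simp only: powr_minus of_nat_Suc add.commute)
      also have "\<dots> = inverse (norm x ^ Suc DIM('a))"
        using False by (subst powr_realpow) auto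
      finally have "norm x powr - (real DIM('a) + 1) = inverse (norm x ^ Suc DIM('a))" .
      moreover have "norm x ^ Suc DIM('a) \<le> (1 + norm x) ^ Suc DIM('a)"
        by (intro power_mono) auto
      then have "inverse ((1 + norm x) ^ Suc DIM('a)) \<le> inverse (norm x ^ Suc DIM('a))"
        by (rule le_imp_inverse_le) (use False in \<open>auto intro!: zero_less_power simp del: power_Suc\<close>)
      ultimately show ?thesis
        using False by (simp del: power_Suc add: ennreal_leI)
    qed
  qed
  also have "\<dots> < \<infinity>"
    using nn_integral_norm_powr_outside[of "real DIM('a) + 1", where 'a = 'a] emeasure_lborel_cball_finite[of "0::'a" 1]
    by (subst nn_integral_add) (auto intro!: borel_measurable_indicator borel_closed)
  finally show "(\<integral>\<^sup>+x. ennreal (norm (inverse ((1 + norm x) ^ Suc DIM('a)))) \<partial>(lborel :: 'a measure)) < \<infinity>" .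
qed measurable

lemma integrable_rapid_decay:
  fixes f :: "'a::euclidean_space \<Rightarrow> 'b::{banach, second_countable_topology}"
  assumes "f \<in> borel_measurable borel" "\<And>x :: 'a. (1 + norm x) ^ Suc DIM('a) * norm (f x) \<le> C"
  shows "integrable lborel f"
proof (rule Bochner_Integration.integrable_bound)
  show "integrable lborel (\<lambda>x::'a. C * inverse ((1 + norm x) ^ Suc DIM('a)))"
    using integrable_inverse_power_norm by (rule integrable_mult_right)
  show "AE x in lborel. norm (f x) \<le> norm (C * inverse ((1 + norm x) ^ Suc DIM('a)))"
  proof (rule AE_I2)
    fix x :: 'a
    have "(1 + norm x) ^ Suc DIM('a) > 0"
      by (intro zero_less_power) (smt (verit) norm_ge_zero)
    with assms(2)[of x] have "norm (f x) \<le> C * inverse ((1 + norm x) ^ Suc DIM('a))"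
      by (simp add: field_simps del: power_Suc)
    then show "norm (f x) \<le> norm (C * inverse ((1 + norm x) ^ Suc DIM('a)))"
      by simp
  qed
qed (use assms in simp)

lemma one_plus_power_le:
  fixes r :: real
  assumes "r \<ge> 0"
  shows "(1 + r) ^ m \<le> 2 ^ m * (1 + r ^ m)"
proof -
  have "(1 + r) ^ m \<le> (2 * max 1 r) ^ m"
    using assms by (intro power_mono) auto
  also have "\<dots> = 2 ^ m * max 1 r ^ m"
    by (rule power_mult_distrib)
  also have "\<dots> \<le> 2 ^ m * (1 + r ^ m)"
    using assms by (intro mult_left_mono) (auto simp: max_def)
  finally show ?thesis .
qed

section \<open>Derivatives and decay of Schwartz functions\<close>

lemma iterated_partial_append:
  "iterated_partial (is @ js) f = iterated_partial is (iterated_partial js f)"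
  by (induction "is") auto

context
  fixes f :: "real^'n::finite \<Rightarrow> real"
  assumes f: "schwartz f"
begin

lemma schwartz_iterated_partial: "schwartz (iterated_partial is f)"
  using f by (auto simp: schwartz_def simp flip: iterated_partial_append)

lemma schwartz_partial_deriv: "schwartz (partial_deriv i f)"
  using schwartz_iterated_partial[of "[i]"] by simp

lemma schwartz_differentiable: "f differentiable (at x)"
  using f unfolding schwartz_def by (metis iterated_partial.simps(1))

lemma schwartz_continuous: "continuous_on UNIV f"
  by (intro continuous_at_imp_continuous_on ballI differentiable_imp_continuous_within schwartz_differentiable)

lemma schwartz_measurable: "f \<in> borel_measurable borel"
  using schwartz_continuous by (rule borel_measurable_continuous_onI)

lemma schwartz_decay: "\<exists>C. \<forall>x. (1 + norm x) ^ m * \<bar>f x\<bar> \<le> C"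
proof -
  have ex: "\<exists>C. \<forall>x. norm x ^ m * \<bar>f x\<bar> \<le> C" for m
    using f unfolding schwartz_def by (metis iterated_partial.simps(1))
  obtain C0 where C0: "\<And>x. norm x ^ 0 * \<bar>f x\<bar> \<le> C0" using ex by blast
  obtain C1 where C1: "\<And>x. norm x ^ m * \<bar>f x\<bar> \<le> C1" using ex by blast
  have "(1 + norm x) ^ m * \<bar>f x\<bar> \<le> 2 ^ m * (C0 + C1)" for x
  proof -
    have "(1 + norm x) ^ m * \<bar>f x\<bar> \<le> 2 ^ m * (1 + norm x ^ m) * \<bar>f x\<bar>"
      by (intro mult_right_mono one_plus_power_le) auto
    also have "\<dots> = 2 ^ m * (norm x ^ 0 * \<bar>f x\<bar> + norm x ^ m * \<bar>f x\<bar>)"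
      by (simp add: algebra_simps)
    also have "\<dots> \<le> 2 ^ m * (C0 + C1)"
      by (intro mult_left_mono add_mono C0 C1) auto
    finally show ?thesis .
  qed
  then show ?thesis by blast
qed

lemma schwartz_bounded: "\<exists>C. \<forall>x. \<bar>f x\<bar> \<le> C"
  using schwartz_decay[of 0] by simp

lemma schwartz_integrable: "integrable lborel f"
  using schwartz_decay[of "Suc DIM(real^'n)"] schwartz_measurable by (auto intro!: integrable_rapid_decay)

lemma schwartz_has_derivative:
  "(f has_derivative (\<lambda>h. \<Sum>j\<in>UNIV. h $ j * partial_deriv j f x)) (at x)"
proof -
  obtain f' where f': "(f has_derivative f') (at x)"
    using schwartz_differentiable[of x] by (auto simp: differentiable_def)
  interpret f': bounded_linear f'
    using f' by (rule has_derivative_bounded_linear)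
  have pd: "partial_deriv j f x = f' (axis j 1)" for j
  proof -
    have "((\<lambda>t. x + t *\<^sub>R axis j 1) has_derivative (\<lambda>t. t *\<^sub>R axis j 1)) (at 0)"
      by (auto intro!: derivative_eq_intros)
    moreover have "(f has_derivative f') (at (x + 0 *\<^sub>R axis j 1))"
      using f' by simp
    ultimately have "((\<lambda>t. f (x + t *\<^sub>R axis j 1)) has_derivative (\<lambda>t. f' (t *\<^sub>R axis j 1))) (at 0)"
      by (rule has_derivative_compose)
    moreover have "(\<lambda>t. f' (t *\<^sub>R axis j 1)) = (*) (f' (axis j 1))"
      by (simp add: fun_eq_iff f'.scaleR mult.commute)
    ultimately have "((\<lambda>t. f (x + t *\<^sub>R axis j 1)) has_real_derivative f' (axis j 1)) (at 0)"
      by (simp only: has_field_derivative_def)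
    then show ?thesis
      unfolding partial_deriv_def by (rule DERIV_imp_deriv)
  qed
  have "f' = (\<lambda>h. \<Sum>j\<in>UNIV. h $ j * partial_deriv j f x)"
  proof
    fix h :: "real^'n"
    have "f' h = f' (\<Sum>j\<in>UNIV. (h $ j) *\<^sub>R axis j 1)"
      by (simp add: basis_expansion flip: scalar_mult_eq_scaleR)
    then show "f' h = (\<Sum>j\<in>UNIV. h $ j * partial_deriv j f x)"
      by (simp add: f'.sum f'.scaleR pd)
  qed
  with f' show ?thesis by simp
qed

lemma schwartz_has_line_derivative:
  "((\<lambda>t. f (x + t *\<^sub>R h)) has_real_derivative (\<Sum>j\<in>UNIV. h $ j * partial_deriv j f (x + t *\<^sub>R h))) (at t)"
proof -
  have "((\<lambda>t. f (x + t *\<^sub>R h)) has_derivative (\<lambda>s. \<Sum>j\<in>UNIV. (s *\<^sub>R h) $ j * partial_deriv j f (x + t *\<^sub>R h))) (at t)"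
    by (rule has_derivative_compose[OF _ schwartz_has_derivative]) (auto intro!: derivative_eq_intros)
  moreover have "(\<lambda>s. \<Sum>j\<in>UNIV. (s *\<^sub>R h) $ j * partial_deriv j f (x + t *\<^sub>R h)) =
      (*) (\<Sum>j\<in>UNIV. h $ j * partial_deriv j f (x + t *\<^sub>R h))"
    by (simp add: fun_eq_iff sum_distrib_left mult_ac)
  ultimately show ?thesis
    by (simp only: has_field_derivative_def)
qed

lemma schwartz_has_partial_deriv:
  "((\<lambda>t. f (x + t *\<^sub>R axis i 1)) has_real_derivative partial_deriv i f (x + t *\<^sub>R axis i 1)) (at t)"
proof -
  have "(\<Sum>j\<in>UNIV. axis i 1 $ j * partial_deriv j f y) = partial_deriv i f y" for y
    by (simp add: axis_def if_distrib[of "\<lambda>c. c * _"] cong: if_cong)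
  with schwartz_has_line_derivative[of x "axis i 1" t] show ?thesis by simp
qed

end

text \<open>Integration by parts without boundary terms. The average of g over the segment from x to
  x + e has the same integral as g, by translation invariance, and equals h(x + e) - h(x) pointwise,
  whose integral vanishes. Thus integrability of h replaces any decay at infinity.\<close>

lemma integral_line_derivative_eq_0:
  fixes h g :: "'a::euclidean_space \<Rightarrow> 'b::euclidean_space"
  assumes deriv: "\<And>x t. ((\<lambda>t. h (x + t *\<^sub>R e)) has_vector_derivative g (x + t *\<^sub>R e)) (at t)"
    and h: "integrable lborel h" and g: "integrable lborel g" and cont: "continuous_on UNIV g"
  shows "(LINT x|lborel. g x) = 0"
proof -
  have [measurable]: "g \<in> borel_measurable borel" "h \<in> borel_measurable borel"
    using g h by (auto dest: borel_measurable_integrable)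
  define G where "G = (\<lambda>t x. indicator {0..1::real} t *\<^sub>R g (x + t *\<^sub>R e))"
  have inner: "(LINT x|lborel. G t x) = indicator {0..1} t *\<^sub>R (LINT x|lborel. g x)" for t
    unfolding G_def by (simp add: lborel_integral_shift)
  have "integrable (lborel \<Otimes>\<^sub>M lborel) (case_prod G)"
  proof (rule lborel_pair.Fubini_integrable)
    show "case_prod G \<in> borel_measurable (lborel \<Otimes>\<^sub>M lborel)"
      unfolding G_def by measurable
    have "(LINT x|lborel. norm (G t x)) = indicator {0..1} t *\<^sub>R (LINT x|lborel. norm (g x))" for t
      unfolding G_def by (simp add: lborel_integral_shift[of "\<lambda>x. norm (g x)"])
    then show "integrable lborel (\<lambda>t. LINT x|lborel. norm (case_prod G (t, x)))"
      by (simp add: integrable_indicator_iff emeasure_lborel_Icc_eq)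
    show "AE t in lborel. integrable lborel (\<lambda>x. case_prod G (t, x))"
      using g by (simp add: G_def lborel_integrable_shift)
  qed
  from lborel_pair.Fubini_integral[OF this]
  have "(LINT x|lborel. (LINT t|lborel. G t x)) = (LINT x|lborel. g x)"
    unfolding inner by simp
  moreover have "(LINT t|lborel. G t x) = h (x + e) - h x" for x
  proof -
    have "(LINT t|lborel. G t x) = h (x + 1 *\<^sub>R e) - h (x + 0 *\<^sub>R e)"
      unfolding G_def
    proof (rule integral_FTC_Icc)
      show "continuous_on {0..1} (\<lambda>t. g (x + t *\<^sub>R e))"
        by (rule continuous_on_compose2[OF cont]) (auto intro!: continuous_intros)
    qed (auto intro: has_vector_derivative_at_within deriv)
    then show ?thesis by simp
  qed
  moreover have "(LINT x|lborel. h (x + e) - h x) = 0"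
    using h by (simp add: lborel_integral_shift lborel_integrable_shift)
  ultimately show ?thesis by simp
qed

section \<open>Continuity and decay of Fourier transforms\<close>

lemma norm_fourier_le:
  "norm (fourier f \<xi>) \<le> (LINT x|lborel. norm (f x))"
  unfolding fourier_def by (rule order_trans[OF integral_norm_bound]) (simp add: norm_mult)

lemma borel_measurable_fourier [measurable]:
  assumes [measurable]: "f \<in> borel_measurable borel"
  shows "fourier f \<in> borel_measurable borel"
  unfolding fourier_def by measurable

lemma continuous_fourier:
  assumes f: "integrable lborel f"
  shows "continuous_on UNIV (fourier f)"
proof -
  have [measurable]: "f \<in> borel_measurable borel"
    using f by (auto dest: borel_measurable_integrable)
  have "(\<lambda>n. fourier f (X n)) \<longlonglongrightarrow> fourier f \<xi>" if "X \<longlonglongrightarrow> \<xi>" for X \<xi>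
    unfolding fourier_def
  proof (rule integral_dominated_convergence)
    show "AE x in lborel. (\<lambda>n. cis (- (x \<bullet> X n)) * f x) \<longlonglongrightarrow> cis (- (x \<bullet> \<xi>)) * f x"
      unfolding cis_conv_exp by (intro AE_I2 tendsto_intros that)
    show "integrable lborel (\<lambda>x. norm (f x))"
      using f by (rule integrable_norm)
  qed (auto simp: norm_mult)
  then show ?thesis
    by (auto simp: continuous_on_sequentially comp_def)
qed

lemma fourier_partial_deriv:
  fixes f :: "real^'n::finite \<Rightarrow> real"
  assumes f: "schwartz f"
  shows "fourier (\<lambda>x. of_real (partial_deriv i f x)) \<xi> = \<i> * of_real (\<xi> $ i) * fourier (\<lambda>x. of_real (f x)) \<xi>"
proof -
  note [measurable] = schwartz_measurable[OF f] schwartz_measurable[OF schwartz_partial_deriv[OF f]]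
  define h where "h = (\<lambda>x. cis (- (x \<bullet> \<xi>)) * complex_of_real (f x))"
  define g1 g2 where "g1 = (\<lambda>x. cis (- (x \<bullet> \<xi>)) * complex_of_real (partial_deriv i f x))"
    and "g2 = (\<lambda>x. - (\<i> * of_real (\<xi> $ i)) * h x)"
  have hi: "integrable lborel h"
    unfolding h_def by (rule Bochner_Integration.integrable_bound[OF schwartz_integrable[OF f]]) (auto simp: norm_mult)
  have g1i: "integrable lborel g1"
    unfolding g1_def by (rule Bochner_Integration.integrable_bound[OF schwartz_integrable[OF schwartz_partial_deriv[OF f]]])
      (auto simp: norm_mult)
  have g2i: "integrable lborel g2"
    unfolding g2_def using hi by (rule integrable_mult_right)
  have "(LINT x|lborel. g1 x + g2 x) = 0"
  proof (rule integral_line_derivative_eq_0[OF _ hi])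
    show "((\<lambda>t. h (x + t *\<^sub>R axis i 1)) has_vector_derivative g1 (x + t *\<^sub>R axis i 1) + g2 (x + t *\<^sub>R axis i 1)) (at t)" for x t
    proof -
      have df: "((\<lambda>t. complex_of_real (f (x + t *\<^sub>R axis i 1))) has_vector_derivative
          of_real (partial_deriv i f (x + t *\<^sub>R axis i 1))) (at t)"
        using schwartz_has_partial_deriv[OF f] by (rule has_vector_derivative_of_real)
      have dcis: "((\<lambda>t. cis (- ((x + t *\<^sub>R axis i 1) \<bullet> \<xi>))) has_vector_derivative
          - (\<i> * of_real (\<xi> $ i)) * cis (- ((x + t *\<^sub>R axis i 1) \<bullet> \<xi>))) (at t)"
      proof -
        have "((\<lambda>t. - ((x + t *\<^sub>R axis i 1) \<bullet> \<xi>)) has_vector_derivative - (\<xi> $ i)) (at t)"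
          unfolding inner_add_left inner_scaleR_left inner_axis'
          by (auto intro!: derivative_eq_intros simp flip: has_real_derivative_iff_has_vector_derivative)
        moreover have "(cis has_vector_derivative \<i> * cis s) (at s)" for s
          unfolding cis_conv_exp[abs_def]
          by (rule has_vector_derivative_real_field) (auto intro!: derivative_eq_intros)
        ultimately have "((cis \<circ> (\<lambda>t. - ((x + t *\<^sub>R axis i 1) \<bullet> \<xi>))) has_vector_derivative
            - (\<xi> $ i) *\<^sub>R (\<i> * cis (- ((x + t *\<^sub>R axis i 1) \<bullet> \<xi>)))) (at t)"
          by (rule vector_diff_chain_at)
        then show ?thesis
          by (simp add: comp_def scaleR_conv_of_real mult_ac)
      qed
      from has_vector_derivative_mult[OF dcis df] show ?thesis
        by (simp add: h_def g1_def g2_def mult_ac)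
    qed
    show "integrable lborel (\<lambda>x. g1 x + g2 x)"
      using g1i g2i by (rule Bochner_Integration.integrable_add)
    show "continuous_on UNIV (\<lambda>x. g1 x + g2 x)"
      unfolding g1_def g2_def h_def cis_conv_exp
      by (intro continuous_intros schwartz_continuous f schwartz_partial_deriv)
  qed
  then have "(LINT x|lborel. g1 x) = - (LINT x|lborel. g2 x)"
    using g1i g2i by (simp add: eq_neg_iff_add_eq_0)
  then show ?thesis
    by (simp add: fourier_def g1_def g2_def h_def)
qed

text \<open>Pure derivatives of order m suffice: they control the m-th power of each coordinate of
  \<xi>, and the largest coordinate controls the norm up to the factor n.\<close>

lemma fourier_rapid_decay:
  fixes f :: "real^'n::finite \<Rightarrow> real"
  assumes f: "schwartz f"
  shows "\<exists>C. \<forall>\<xi>. (1 + norm \<xi>) ^ m * norm (fourier (\<lambda>x. of_real (f x)) \<xi>) \<le> C"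
proof -
  let ?F = "\<lambda>f. fourier (\<lambda>x. complex_of_real (f x))"
  have pow: "?F (iterated_partial (replicate m i) f) \<xi> = (\<i> * of_real (\<xi> $ i)) ^ m * ?F f \<xi>" for m i \<xi>
  proof (induction m)
    case (Suc m)
    then show ?case
      by (simp add: fourier_partial_deriv[OF schwartz_iterated_partial[OF f]] mult_ac)
  qed simp
  define C where "C = (\<lambda>m i. LINT x|lborel. \<bar>iterated_partial (replicate m i) f x\<bar>)"
  have C: "\<bar>\<xi> $ i\<bar> ^ m * norm (?F f \<xi>) \<le> C m i" for m i \<xi>
    using norm_fourier_le[of "\<lambda>x. complex_of_real (iterated_partial (replicate m i) f x)" \<xi>]
    unfolding pow by (simp add: norm_mult norm_power C_def)
  have le: "norm \<xi> ^ m \<le> real CARD('n) ^ m * (\<Sum>i\<in>UNIV. \<bar>\<xi> $ i\<bar> ^ m)" for \<xi> :: "real^'n"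
  proof -
    define M where "M = Max (range (\<lambda>i. \<bar>\<xi> $ i\<bar>))"
    have "M \<in> range (\<lambda>i. \<bar>\<xi> $ i\<bar>)"
      unfolding M_def by (rule Max_in) auto
    then obtain i where i: "M = \<bar>\<xi> $ i\<bar>" by auto
    have "norm \<xi> \<le> (\<Sum>i\<in>UNIV. \<bar>\<xi> $ i\<bar>)"
      by (rule norm_le_l1_cart)
    also have "\<dots> \<le> (\<Sum>i::'n\<in>UNIV. M)"
      by (intro sum_mono) (simp add: M_def)
    finally have "norm \<xi> ^ m \<le> (real CARD('n) * M) ^ m"
      by (intro power_mono) auto
    also have "\<dots> = real CARD('n) ^ m * \<bar>\<xi> $ i\<bar> ^ m"
      by (simp add: i power_mult_distrib)
    also have "\<dots> \<le> real CARD('n) ^ m * (\<Sum>i\<in>UNIV. \<bar>\<xi> $ i\<bar> ^ m)"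
      by (intro mult_left_mono member_le_sum) auto
    finally show ?thesis .
  qed
  \<comment> \<open>At order 0 the bound \<open>C 0 i\<close> is the same for every index, so an
    arbitrary one stands for the summand 1.\<close>
  have "(1 + norm \<xi>) ^ m * norm (?F f \<xi>) \<le>
      2 ^ m * (C 0 undefined + real CARD('n) ^ m * (\<Sum>i\<in>UNIV. C m i))" for \<xi>
  proof -
    have "(1 + norm \<xi>) ^ m * norm (?F f \<xi>) \<le>
        2 ^ m * (1 + real CARD('n) ^ m * (\<Sum>i\<in>UNIV. \<bar>\<xi> $ i\<bar> ^ m)) * norm (?F f \<xi>)"
      using le[of \<xi>] by (intro mult_right_mono order_trans[OF one_plus_power_le] mult_left_mono) auto
    also have "\<dots> = 2 ^ m * (\<bar>\<xi> $ undefined\<bar> ^ 0 * norm (?F f \<xi>) +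
        real CARD('n) ^ m * (\<Sum>i\<in>UNIV. \<bar>\<xi> $ i\<bar> ^ m * norm (?F f \<xi>)))"
      by (simp add: algebra_simps sum_distrib_left sum_distrib_right)
    also have "\<dots> \<le> 2 ^ m * (C 0 undefined + real CARD('n) ^ m * (\<Sum>i\<in>UNIV. C m i))"
      by (intro mult_left_mono add_mono sum_mono C) auto
    finally show ?thesis .
  qed
  then show ?thesis by blast
qed

lemma integrable_fourier_schwartz:
  fixes f :: "real^'n::finite \<Rightarrow> real"
  assumes f: "schwartz f"
  shows "integrable lborel (\<lambda>\<xi>. (1 + norm \<xi>) ^ m * norm (fourier (\<lambda>x. of_real (f x)) \<xi>))"
proof -
  note [measurable] = schwartz_measurable[OF f]
  obtain C where C: "\<And>\<xi>. (1 + norm \<xi>) ^ (Suc DIM(real^'n) + m) * norm (fourier (\<lambda>x. of_real (f x)) \<xi>) \<le> C"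
    using fourier_rapid_decay[OF f] by blast
  show ?thesis
  proof (rule integrable_rapid_decay)
    fix \<xi> :: "real^'n"
    have "1 + norm \<xi> \<ge> 0"
      by (rule add_nonneg_nonneg) auto
    moreover have "(1 + norm \<xi>) ^ (Suc DIM(real^'n) + m) = (1 + norm \<xi>) ^ Suc DIM(real^'n) * (1 + norm \<xi>) ^ m"
      by (rule power_add)
    ultimately show "(1 + norm \<xi>) ^ Suc DIM(real^'n) * norm ((1 + norm \<xi>) ^ m * norm (fourier (\<lambda>x. of_real (f x)) \<xi>)) \<le> C"
      using C[of \<xi>] by (simp add: abs_mult mult_ac del: power_Suc)
  qed measurable
qed

section \<open>The one-dimensional weights\<close>

text \<open>The power -p of the Japanese bracket. With 1 + s^2 as base the chain rule applies at
  every point without a root.\<close>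

definition jweight :: "real \<Rightarrow> real \<Rightarrow> real" where
  "jweight p s = (1 + s\<^sup>2) powr (- p / 2)"

lemma one_plus_square_pos: "1 + (s::real)\<^sup>2 > 0"
  by (rule add_pos_nonneg) auto

lemma jweight_pos: "jweight p s > 0"
  using one_plus_square_pos[of s] by (simp add: jweight_def)

lemma jweight_nonneg: "jweight p s \<ge> 0"
  by (rule less_imp_le[OF jweight_pos])

lemma borel_measurable_jweight [measurable]: "jweight p \<in> borel_measurable borel"
  unfolding jweight_def by measurable

lemma jweight_add: "jweight (p + q) s = jweight p s * jweight q s"
  unfolding jweight_def powr_add[symmetric] by (rule arg_cong2[where f = "(powr)"]) (auto simp: add_divide_distrib)

lemma jweight_antimono: "p \<le> q \<Longrightarrow> jweight q s \<le> jweight p s"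
  unfolding jweight_def by (rule powr_mono) auto

lemma jweight_le_1: "p \<ge> 0 \<Longrightarrow> jweight p s \<le> 1"
  using jweight_antimono[of 0 p s] one_plus_square_pos[of s] by (simp add: jweight_def)

lemma abs_power_mult_jweight_le: "\<bar>s ^ k * jweight (p + real k) s\<bar> \<le> jweight p s"
proof -
  have "\<bar>s\<bar> ^ k * jweight (real k) s \<le> 1"
  proof -
    have "\<bar>s\<bar> \<le> sqrt (1 + s\<^sup>2)"
      using real_sqrt_le_mono[of "s\<^sup>2" "1 + s\<^sup>2"] by simp
    then have "\<bar>s\<bar> ^ k \<le> sqrt (1 + s\<^sup>2) ^ k"
      by (intro power_mono) auto
    also have "\<dots> = (1 + s\<^sup>2) powr (real k / 2)"
      using one_plus_square_pos[of s] by (simp add: powr_half_sqrt[symmetric] powr_power)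
    finally have "\<bar>s\<bar> ^ k * jweight (real k) s \<le> (1 + s\<^sup>2) powr (real k / 2) * jweight (real k) s"
      by (intro mult_right_mono jweight_nonneg)
    also have "\<dots> = 1"
      using one_plus_square_pos[of s] unfolding jweight_def powr_add[symmetric] by simp
    finally show ?thesis .
  qed
  from mult_left_mono[OF this jweight_nonneg[of p s]] show ?thesis
    by (simp add: abs_mult power_abs jweight_add jweight_nonneg mult_ac)
qed

lemma abs_power_mult_jweight_le':
  assumes "real k \<le> q"
  shows "\<bar>s ^ k * jweight q s\<bar> \<le> jweight (q - real k) s"
  using abs_power_mult_jweight_le[of s k "q - real k"] by simp

lemma has_real_derivative_jweight:
  "(jweight p has_real_derivative - p * s * jweight (p + 2) s) (at s)"
proof -
  have "((\<lambda>s. 1 + s\<^sup>2) has_real_derivative 2 * s) (at s)"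
    by (auto intro!: derivative_eq_intros)
  from DERIV_fun_powr[OF this one_plus_square_pos, of "- p / 2"]
  have "(jweight p has_real_derivative (- p / 2) * (1 + s\<^sup>2) powr (- p / 2 - 1) * (2 * s)) (at s)"
    unfolding jweight_def[abs_def] by simp
  moreover have "- p * s * jweight (p + 2) s = (- p / 2) * (1 + s\<^sup>2) powr (- p / 2 - 1) * (2 * s)"
  proof -
    have "- (p + 2) / 2 = - p / 2 - 1"
      by (simp add: field_simps)
    then show ?thesis
      unfolding jweight_def by (simp only:) simp
  qed
  ultimately show ?thesis
    by (simp only:)
qed

lemmas has_real_derivative_jweight' [derivative_intros] = DERIV_chain2[OF has_real_derivative_jweight]

text \<open>The second derivative of \<open>jweight p\<close>.\<close>

definition jweight2 :: "real \<Rightarrow> real \<Rightarrow> real" where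
  "jweight2 p s = - p * jweight (p + 2) s + p * (p + 2) * (s\<^sup>2 * jweight (p + 4) s)"

lemma has_real_derivative_jweight1:
  "((\<lambda>s. - p * s * jweight (p + 2) s) has_real_derivative jweight2 p s) (at s)"
  by (auto intro!: derivative_eq_intros simp: jweight2_def algebra_simps power2_eq_square)

lemma jweight_derivatives_le:
  assumes "p \<ge> 0"
  shows "\<bar>- p * s * jweight (p + 2) s\<bar> \<le> p * jweight p s"
    and "\<bar>jweight2 p s\<bar> \<le> (p + p * (p + 2)) * jweight p s"
proof -
  have "\<bar>s ^ 1 * jweight (p + 2) s\<bar> \<le> jweight (p + 2 - real 1) s"
    by (rule abs_power_mult_jweight_le') (use assms in simp)
  also have "\<dots> \<le> jweight p s"
    by (rule jweight_antimono) simp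
  finally have "\<bar>s * jweight (p + 2) s\<bar> \<le> jweight p s" by simp
  from mult_left_mono[OF this assms] show "\<bar>- p * s * jweight (p + 2) s\<bar> \<le> p * jweight p s"
    using assms by (simp add: abs_mult mult_ac)
  have "\<bar>s ^ 2 * jweight (p + 4) s\<bar> \<le> jweight (p + 4 - real 2) s"
    by (rule abs_power_mult_jweight_le') (use assms in simp)
  also have "\<dots> \<le> jweight p s"
    by (rule jweight_antimono) simp
  finally have "p * (p + 2) * \<bar>s\<^sup>2 * jweight (p + 4) s\<bar> \<le> p * (p + 2) * jweight p s"
    using assms by (intro mult_left_mono) auto
  moreover have "p * jweight (p + 2) s \<le> p * jweight p s"
    using assms by (intro mult_left_mono jweight_antimono) auto
  moreover have "\<bar>jweight2 p s\<bar> \<le> \<bar>- p * jweight (p + 2) s\<bar> + \<bar>p * (p + 2) * (s\<^sup>2 * jweight (p + 4) s)\<bar>"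
    unfolding jweight2_def by (rule abs_triangle_ineq)
  moreover have "\<bar>- p * jweight (p + 2) s\<bar> = p * jweight (p + 2) s"
    using assms by (simp add: abs_mult jweight_nonneg)
  moreover have "\<bar>p * (p + 2) * (s\<^sup>2 * jweight (p + 4) s)\<bar> = p * (p + 2) * \<bar>s\<^sup>2 * jweight (p + 4) s\<bar>"
    using assms by (simp add: abs_mult)
  ultimately show "\<bar>jweight2 p s\<bar> \<le> (p + p * (p + 2)) * jweight p s"
    by (simp add: distrib_right)
qed

lemma jweight_le_jweight:
  assumes "(1 + s\<^sup>2) powr (p / 2) \<le> c * (1 + r\<^sup>2) powr (p / 2)"
  shows "jweight p r \<le> c * jweight p s"
proof -
  have "jweight p r = inverse ((1 + r\<^sup>2) powr (p / 2))" for r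
    by (simp add: jweight_def powr_minus)
  moreover have "(1 + r\<^sup>2) powr (p / 2) > 0" for r :: real
    using one_plus_square_pos[of r] by simp
  moreover have "X \<le> c * Y \<Longrightarrow> inverse Y \<le> c * inverse X" if "X > 0" "Y > 0" for X Y :: real
    using that by (simp add: field_simps)
  ultimately show ?thesis
    using assms by metis
qed

text \<open>Peetre's inequality, a consequence of s^2 \<le> 2 (s + t)^2 + 2 t^2.\<close>

lemma jweight_shift_le:
  assumes "p \<ge> 0" "\<bar>t\<bar> \<le> T"
  shows "jweight p (s + t) \<le> (2 * (1 + T\<^sup>2)) powr (p / 2) * jweight p s"
proof -
  have "t\<^sup>2 \<le> T\<^sup>2"
    using assms(2) by (intro abs_le_square_iff[THEN iffD1]) auto
  have "s\<^sup>2 \<le> 2 * (s + t)\<^sup>2 + 2 * t\<^sup>2"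
    using zero_le_power2[of "s + 2 * t"] by (simp add: power2_eq_square algebra_simps)
  have "1 + s\<^sup>2 \<le> 2 * (1 + T\<^sup>2) * (1 + (s + t)\<^sup>2)"
  proof -
    have "2 * (1 + T\<^sup>2) * (1 + (s + t)\<^sup>2) = 2 + 2 * T\<^sup>2 + 2 * (s + t)\<^sup>2 + 2 * (T\<^sup>2 * (s + t)\<^sup>2)"
      by (simp add: distrib_left distrib_right)
    moreover have "0 \<le> T\<^sup>2 * (s + t)\<^sup>2"
      by simp
    ultimately show ?thesis
      using \<open>s\<^sup>2 \<le> 2 * (s + t)\<^sup>2 + 2 * t\<^sup>2\<close> \<open>t\<^sup>2 \<le> T\<^sup>2\<close> by linarith
  qed
  then have "(1 + s\<^sup>2) powr (p / 2) \<le> (2 * (1 + T\<^sup>2) * (1 + (s + t)\<^sup>2)) powr (p / 2)"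
    by (rule powr_mono2[rotated 2]) (use assms in auto)
  also have "\<dots> = (2 * (1 + T\<^sup>2)) powr (p / 2) * (1 + (s + t)\<^sup>2) powr (p / 2)"
    by (simp add: powr_mult)
  finally have "(1 + s\<^sup>2) powr (p / 2) \<le> (2 * (1 + T\<^sup>2)) powr (p / 2) * (1 + (s + t)\<^sup>2) powr (p / 2)" .
  then show ?thesis
    by (rule jweight_le_jweight)
qed

text \<open>Here the shift may grow with s, up to half the bracket of s, and the constant still does
  not depend on s. This is what the tail estimate requires.\<close>

lemma jweight_near_le:
  assumes "p \<ge> 0" "\<bar>t\<bar> \<le> sqrt (1 + s\<^sup>2) / 2"
  shows "jweight p (s + t) \<le> 4 powr (p / 2) * jweight p s"
proof -
  have "t\<^sup>2 \<le> (sqrt (1 + s\<^sup>2) / 2)\<^sup>2"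
    using assms(2) by (intro abs_le_square_iff[THEN iffD1]) auto
  then have t: "t\<^sup>2 \<le> (1 + s\<^sup>2) / 4"
    by (simp add: power_divide)
  have "s\<^sup>2 \<le> 2 * (s + t)\<^sup>2 + 2 * t\<^sup>2"
    using zero_le_power2[of "s + 2 * t"] by (simp add: power2_eq_square algebra_simps)
  then have "1 + s\<^sup>2 \<le> 4 * (1 + (s + t)\<^sup>2)"
    using t by simp
  then have "(1 + s\<^sup>2) powr (p / 2) \<le> (4 * (1 + (s + t)\<^sup>2)) powr (p / 2)"
    using assms by (intro powr_mono2) auto
  also have "\<dots> = 4 powr (p / 2) * (1 + (s + t)\<^sup>2) powr (p / 2)"
    by (rule powr_mult)
  finally have "(1 + s\<^sup>2) powr (p / 2) \<le> 4 powr (p / 2) * (1 + (s + t)\<^sup>2) powr (p / 2)" .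
  then show ?thesis
    by (rule jweight_le_jweight)
qed

text \<open>A class that contains u \<phi> and is closed under partial derivatives, so that the
  Schwartz property follows by induction on the order. Differentiating the weight either lowers
  \<open>k\<close> by one or raises \<open>k\<close> by one and \<open>p\<close> by two; both
  preserve \<open>real k \<le> p\<close>, which bounds the weight factor by |c|.\<close>

inductive schwartz_weighted :: "real^'n::finite \<Rightarrow> real \<Rightarrow> (real^'n \<Rightarrow> real) \<Rightarrow> bool" for \<sigma> \<omega> where
  base: "schwartz f \<Longrightarrow> real k \<le> p \<Longrightarrow>
    schwartz_weighted \<sigma> \<omega> (\<lambda>x. f x * (c * ((\<sigma> \<bullet> x + \<omega>) ^ k * jweight p (\<sigma> \<bullet> x + \<omega>))))"
| add: "schwartz_weighted \<sigma> \<omega> g \<Longrightarrow> schwartz_weighted \<sigma> \<omega> h \<Longrightarrow> schwartz_weighted \<sigma> \<omega> (\<lambda>x. g x + h x)"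

lemma differentiable_weight: "(\<lambda>x. c * ((\<sigma> \<bullet> x + \<omega>) ^ k * jweight p (\<sigma> \<bullet> x + \<omega>))) differentiable (at x)"
proof -
  have "(\<lambda>r. c * (r ^ k * jweight p r)) differentiable (at r)" for r
    unfolding real_differentiable_def by (rule exI) (auto intro!: derivative_eq_intros)
  then have "((\<lambda>r. c * (r ^ k * jweight p r)) \<circ> (\<lambda>x. \<sigma> \<bullet> x + \<omega>)) differentiable (at x)"
    by (intro differentiable_chain_at differentiableI[of _ "\<lambda>h. \<sigma> \<bullet> h"]) (auto intro!: derivative_eq_intros)
  then show ?thesis
    by (simp add: comp_def)
qed

lemma schwartz_weighted_differentiable:
  "schwartz_weighted \<sigma> \<omega> g \<Longrightarrow> g differentiable (at x)"
proof (induction rule: schwartz_weighted.induct)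
  case (base f k p c)
  then show ?case
    by (intro differentiable_mult schwartz_differentiable differentiable_weight)
qed (intro differentiable_add)

lemma differentiable_has_partial_deriv:
  assumes "g differentiable (at x)"
  shows "((\<lambda>t. g (x + t *\<^sub>R axis i 1)) has_real_derivative partial_deriv i g x) (at 0)"
proof -
  have "(g \<circ> (\<lambda>t. x + t *\<^sub>R axis i 1)) differentiable (at (0::real))"
    by (rule differentiable_chain_at) (auto intro!: derivative_intros simp: assms)
  then have "\<exists>D. ((\<lambda>t. g (x + t *\<^sub>R axis i 1)) has_real_derivative D) (at 0)"
    by (simp add: comp_def real_differentiable_def[symmetric])
  then show ?thesis
    unfolding partial_deriv_def by (metis DERIV_imp_deriv)
qed

lemma schwartz_weighted_partial_deriv:
  "schwartz_weighted \<sigma> \<omega> g \<Longrightarrow> schwartz_weighted \<sigma> \<omega> (partial_deriv i g)"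
proof (induction rule: schwartz_weighted.induct)
  case (base f k p c)
  define s where "s = (\<lambda>x. \<sigma> \<bullet> x + \<omega>)"
  \<comment> \<open>For \<open>k = 0\<close> the truncated \<open>k - 1\<close> does no harm, since
    its term carries the factor \<open>real k\<close>.\<close>
  have "partial_deriv i (\<lambda>x. f x * (c * (s x ^ k * jweight p (s x)))) =
    (\<lambda>x. (partial_deriv i f x * (c * (s x ^ k * jweight p (s x))) +
        f x * ((c * \<sigma> $ i * real k) * (s x ^ (k - 1) * jweight p (s x)))) +
        f x * ((- c * \<sigma> $ i * p) * (s x ^ (k + 1) * jweight (p + 2) (s x))))" (is "_ = ?R")
  proof
    fix x
    have "((\<lambda>t. s (x + t *\<^sub>R axis i 1)) has_real_derivative \<sigma> $ i) (at 0)"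
      unfolding s_def inner_add_right inner_scaleR_right inner_axis
      by (auto intro!: derivative_eq_intros)
    moreover have "((\<lambda>t. f (x + t *\<^sub>R axis i 1)) has_real_derivative partial_deriv i f x) (at 0)"
      using schwartz_has_partial_deriv[OF base(1), of x i 0] by simp
    ultimately have "((\<lambda>t. f (x + t *\<^sub>R axis i 1) * (c * (s (x + t *\<^sub>R axis i 1) ^ k * jweight p (s (x + t *\<^sub>R axis i 1)))))
        has_real_derivative ?R x) (at 0)"
      by (auto intro!: derivative_eq_intros simp: algebra_simps)
    then show "partial_deriv i (\<lambda>x. f x * (c * (s x ^ k * jweight p (s x)))) x = ?R x"
      unfolding partial_deriv_def by (rule DERIV_imp_deriv)
  qed
  moreover have "schwartz_weighted \<sigma> \<omega> ?R"
    unfolding s_def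
    by (intro schwartz_weighted.intros schwartz_partial_deriv base(1)) (use base(2) in auto)
  ultimately show ?case
    by (simp add: s_def)
next
  case (add g h)
  have "partial_deriv i (\<lambda>x. g x + h x) = (\<lambda>x. partial_deriv i g x + partial_deriv i h x)"
  proof
    fix x
    have "((\<lambda>t. g (x + t *\<^sub>R axis i 1) + h (x + t *\<^sub>R axis i 1)) has_real_derivative partial_deriv i g x + partial_deriv i h x) (at 0)"
      using add by (intro DERIV_add differentiable_has_partial_deriv schwartz_weighted_differentiable)
    then show "partial_deriv i (\<lambda>x. g x + h x) x = partial_deriv i g x + partial_deriv i h x"
      unfolding partial_deriv_def by (rule DERIV_imp_deriv)
  qed
  with add show ?case
    by (simp add: schwartz_weighted.add)
qed

lemma schwartz_weighted_decay:
  "schwartz_weighted \<sigma> \<omega> g \<Longrightarrow> \<exists>C. \<forall>x. norm x ^ m * \<bar>g x\<bar> \<le> C"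
proof (induction rule: schwartz_weighted.induct)
  case (base f k p c)
  obtain C where C: "\<And>x. norm x ^ m * \<bar>f x\<bar> \<le> C"
    using base(1) unfolding schwartz_def by (metis iterated_partial.simps(1))
  have "norm x ^ m * \<bar>f x * (c * ((\<sigma> \<bullet> x + \<omega>) ^ k * jweight p (\<sigma> \<bullet> x + \<omega>)))\<bar> \<le> C * \<bar>c\<bar>" for x
  proof -
    define s where "s = \<sigma> \<bullet> x + \<omega>"
    have "\<bar>s ^ k * jweight p s\<bar> \<le> 1"
      using abs_power_mult_jweight_le'[OF base(2), of s] jweight_le_1[of "p - real k" s] base(2) by simp
    then have "norm x ^ m * \<bar>f x\<bar> * \<bar>c * (s ^ k * jweight p s)\<bar> \<le> C * \<bar>c\<bar>"
      unfolding abs_mult[of c]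
      by (intro mult_mono C mult_left_le order_trans[OF _ C[of x]]) auto
    then show ?thesis
      by (simp add: abs_mult s_def mult_ac)
  qed
  then show ?case by blast
next
  case (add g h)
  then obtain C D where "\<And>x. norm x ^ m * \<bar>g x\<bar> \<le> C" "\<And>x. norm x ^ m * \<bar>h x\<bar> \<le> D"
    by blast
  then have "norm x ^ m * \<bar>g x + h x\<bar> \<le> C + D" for x
    using mult_left_mono[OF abs_triangle_ineq[of "g x" "h x"], of "norm x ^ m"]
    by (smt (verit) distrib_left norm_ge_zero zero_le_power)
  then show ?case by blast
qed

lemma schwartz_mult_jweight:
  assumes "schwartz f" "p \<ge> 0"
  shows "schwartz (\<lambda>x. f x * jweight p (\<sigma> \<bullet> x + \<omega>))"
proof -
  have "schwartz_weighted \<sigma> \<omega> (\<lambda>x. f x * jweight p (\<sigma> \<bullet> x + \<omega>))"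
    using schwartz_weighted.base[OF assms(1), of 0 p \<sigma> \<omega> 1] assms(2) by simp
  then have "schwartz_weighted \<sigma> \<omega> (iterated_partial is (\<lambda>x. f x * jweight p (\<sigma> \<bullet> x + \<omega>)))" for "is"
    by (induction "is") (auto intro: schwartz_weighted_partial_deriv)
  then show ?thesis
    unfolding schwartz_def using schwartz_weighted_differentiable schwartz_weighted_decay by blast
qed

section \<open>The weights of the theorem as functions of one variable\<close>

lemma inverse_japanese_bracket_powr: "1 / japanese_bracket s powr q = jweight q s" for s :: real
proof -
  have "japanese_bracket s powr q = (1 + s\<^sup>2) powr (q / 2)"
    using one_plus_square_pos[of s] by (simp add: japanese_bracket_def powr_half_sqrt[symmetric] powr_powr)
  then show ?thesis
    by (simp add: jweight_def powr_minus_divide)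
qed

lemma weight_phi_eq: "weight_phi \<gamma> \<omega> \<sigma> x = jweight \<gamma> (\<sigma> \<bullet> x + \<omega>)"
  by (simp add: weight_phi_def inverse_japanese_bracket_powr)

lemma integrable_jweight:
  assumes "p > 1"
  shows "integrable lborel (jweight p)"
proof (rule integrableI_bounded)
  have "(\<integral>\<^sup>+r. ennreal (norm (jweight p r)) \<partial>lborel) \<le>
    (\<integral>\<^sup>+r. indicator {-1..1} r + ennreal (norm r powr - p) * indicator {r. 1 < norm r} r \<partial>(lborel :: real measure))"
  proof (rule nn_integral_mono)
    fix r :: real
    show "ennreal (norm (jweight p r)) \<le> indicator {-1..1} r + ennreal (norm r powr - p) * indicator {r. 1 < norm r} r"
    proof (cases "\<bar>r\<bar> \<le> 1")
      case True
      then show ?thesis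
        using jweight_le_1[of p r] assms by (auto simp: indicator_def jweight_nonneg ennreal_le_1)
    next
      case False
      have "jweight p r \<le> (r\<^sup>2) powr (- p / 2)"
        unfolding jweight_def using False assms by (intro powr_mono2') auto
      also have "\<dots> = \<bar>r\<bar> powr - p"
      proof -
        have "(r\<^sup>2) powr (- p / 2) = (\<bar>r\<bar> powr 2) powr (- p / 2)"
          using False by simp
        also have "\<dots> = \<bar>r\<bar> powr - p"
          unfolding powr_powr by simp
        finally show ?thesis .
      qed
      finally show ?thesis
        using False by (auto simp: indicator_def jweight_nonneg intro!: ennreal_leI)
    qed
  qed
  also have "\<dots> < \<infinity>"
    using nn_integral_norm_powr_outside[of p, where 'a = real] assms
    by (subst nn_integral_add) (auto simp: emeasure_lborel_Icc_eq)
  finally show "(\<integral>\<^sup>+r. ennreal (norm (jweight p r)) \<partial>lborel) < \<infinity>" .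
qed measurable

text \<open>The weight \<Phi> as a function of \<sigma> \<bullet> x + \<omega> alone. The
  substitution in \<open>weight_varphi_eq\<close> absorbs \<omega>, so bounds that are uniform in s
  are uniform in \<omega>.\<close>

definition jprim :: "real \<Rightarrow> real \<Rightarrow> real" where
  "jprim \<gamma> s = (LINT r:{..s}|lborel. jweight (2 * \<gamma>) r)"

lemma weight_varphi_eq: "weight_varphi \<gamma> \<omega> \<sigma> x = jprim \<gamma> (\<sigma> \<bullet> x + \<omega>)"
proof -
  define h where "h = (\<lambda>r. indicator {..\<sigma> \<bullet> x + \<omega>} r *\<^sub>R jweight (2 * \<gamma>) r)"
  have "weight_varphi \<gamma> \<omega> \<sigma> x = (LINT s|lborel. h (s + \<omega>))"
    unfolding weight_varphi_def set_lebesgue_integral_def h_def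
    by (intro Bochner_Integration.integral_cong refl) (auto simp: inverse_japanese_bracket_powr indicator_def)
  also have "\<dots> = (LINT s|lborel. h s)"
    by (rule lborel_integral_shift) (simp add: h_def)
  finally show ?thesis
    by (simp add: h_def jprim_def set_lebesgue_integral_def)
qed

section \<open>Local and tail estimates for the primitive\<close>

lemma abs_diff_le_of_deriv:
  fixes h :: "real \<Rightarrow> real"
  assumes "\<And>r. \<bar>r\<bar> \<le> \<bar>t\<bar> \<Longrightarrow> (h has_real_derivative h' r) (at r)"
    and "\<And>r. \<bar>r\<bar> \<le> \<bar>t\<bar> \<Longrightarrow> \<bar>h' r\<bar> \<le> B"
  shows "\<bar>h t - h 0\<bar> \<le> B * \<bar>t\<bar>"
proof -
  have "norm (h t - h 0) \<le> B * norm (t - 0)"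
  proof (rule field_differentiable_bound[of "{-\<bar>t\<bar>..\<bar>t\<bar>}" h h'])
    show "(h has_field_derivative h' r) (at r within {- \<bar>t\<bar>..\<bar>t\<bar>})" if "r \<in> {- \<bar>t\<bar>..\<bar>t\<bar>}" for r
      by (rule has_field_derivative_at_within, rule assms(1)) (use that in auto)
    show "norm (h' r) \<le> B" if "r \<in> {- \<bar>t\<bar>..\<bar>t\<bar>}" for r
      unfolding real_norm_def by (rule assms(2)) (use that in auto)
  qed auto
  then show ?thesis by simp
qed

lemma
  fixes G :: "real \<Rightarrow> real"
  assumes "\<And>r. (G has_real_derivative G' r) (at r)"
  shows DERIV_shift_plus: "((\<lambda>r. G (s + r)) has_real_derivative G' (s + r)) (at r)"
    and DERIV_shift_minus: "((\<lambda>r. G (s - r)) has_real_derivative - G' (s - r)) (at r)"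
proof -
  have "((\<lambda>r. s + r) has_real_derivative 1) (at r)" "((\<lambda>r. s - r) has_real_derivative - 1) (at r)"
    by (auto intro!: derivative_eq_intros)
  from DERIV_chain2[OF assms this(1)] DERIV_chain2[OF assms this(2)]
  show "((\<lambda>r. G (s + r)) has_real_derivative G' (s + r)) (at r)"
    "((\<lambda>r. G (s - r)) has_real_derivative - G' (s - r)) (at r)"
    by simp_all
qed

lemma taylor_le:
  fixes G :: "real \<Rightarrow> real"
  assumes G: "\<And>r. (G has_real_derivative G' r) (at r)" "\<And>r. (G' has_real_derivative G'' r) (at r)"
    and K: "\<And>r. \<bar>r\<bar> \<le> \<bar>t\<bar> \<Longrightarrow> \<bar>G'' (s + r)\<bar> \<le> K"
  shows "\<bar>G (s + t) - G s - t * G' s\<bar> \<le> K * t\<^sup>2"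
proof -
  have K0: "K \<ge> 0"
    using K[of 0] by simp
  have G': "\<bar>G' (s + r) - G' s\<bar> \<le> K * \<bar>r\<bar>" if "\<bar>r\<bar> \<le> \<bar>t\<bar>" for r
    using abs_diff_le_of_deriv[of r "\<lambda>r. G' (s + r)" "\<lambda>r. G'' (s + r)" K] K that
      DERIV_shift_plus[OF G(2)] by auto
  have "\<bar>(G (s + t) - t * G' s) - (G (s + 0) - 0 * G' s)\<bar> \<le> (K * \<bar>t\<bar>) * \<bar>t\<bar>"
  proof (rule abs_diff_le_of_deriv)
    fix r :: real assume r: "\<bar>r\<bar> \<le> \<bar>t\<bar>"
    show "((\<lambda>t. G (s + t) - t * G' s) has_real_derivative G' (s + r) - G' s) (at r)"
      by (auto intro!: derivative_eq_intros DERIV_shift_plus[OF G(1)])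
    show "\<bar>G' (s + r) - G' s\<bar> \<le> K * \<bar>t\<bar>"
      using G'[OF r] mult_left_mono[OF r K0] by linarith
  qed
  then show ?thesis
    by (simp add: power2_eq_square mult.assoc algebra_simps)
qed

context
  fixes \<gamma> :: real
  assumes \<gamma>: "\<gamma> > 1 / 2"
begin

lemma set_integrable_jweight: "A \<in> sets borel \<Longrightarrow> set_integrable lborel A (jweight (2 * \<gamma>))"
  unfolding set_integrable_def
  by (rule integrable_mult_indicator) (use integrable_jweight[of "2 * \<gamma>"] \<gamma> in auto)

lemma jprim_nonneg: "jprim \<gamma> s \<ge> 0"
  unfolding jprim_def set_lebesgue_integral_def
  by (intro integral_nonneg_AE) (auto simp: jweight_nonneg)

lemma jprim_le: "jprim \<gamma> s \<le> (LINT r|lborel. jweight (2 * \<gamma>) r)"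
  unfolding jprim_def set_lebesgue_integral_def
  using integrable_jweight[of "2 * \<gamma>"] set_integrable_jweight[of "{..s}"] \<gamma>
  by (intro integral_mono) (auto simp: set_integrable_def jweight_nonneg indicator_def)

lemma jprim_diff_le: "\<bar>jprim \<gamma> s - jprim \<gamma> r\<bar> \<le> (LINT r|lborel. jweight (2 * \<gamma>) r)"
  using jprim_nonneg[of s] jprim_nonneg[of r] jprim_le[of s] jprim_le[of r] by linarith

lemma has_real_derivative_jprim: "(jprim \<gamma> has_real_derivative jweight (2 * \<gamma>) s) (at s)"
proof -
  \<comment> \<open>The half line is cut to the left of s: the part below \<open>a\<close> is
    constant near s, and the fundamental theorem is applied on a compact interval that has s in its
    interior.\<close>
  define a where "a = s - 1"
  have eq: "jprim \<gamma> r = (LINT r:{..<a}|lborel. jweight (2 * \<gamma>) r) + integral {a..r} (jweight (2 * \<gamma>))"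
    if "r \<in> {a..s + 1}" for r
  proof -
    have "jprim \<gamma> r = (LINT r:{..<a} \<union> {a..r}|lborel. jweight (2 * \<gamma>) r)"
      unfolding jprim_def using that by (intro arg_cong2[where f = "\<lambda>A f. set_lebesgue_integral lborel A f"]) auto
    also have "\<dots> = (LINT r:{..<a}|lborel. jweight (2 * \<gamma>) r) + (LINT r:{a..r}|lborel. jweight (2 * \<gamma>) r)"
      by (rule set_integral_Un) (auto intro: set_integrable_jweight)
    also have "(LINT r:{a..r}|lborel. jweight (2 * \<gamma>) r) = integral {a..r} (jweight (2 * \<gamma>))"
      by (rule set_borel_integral_eq_integral) (auto intro: set_integrable_jweight)
    finally show ?thesis .
  qed
  have cont: "continuous_on {a..s + 1} (jweight (2 * \<gamma>))"
    by (intro continuous_at_imp_continuous_on ballI DERIV_isCont[OF has_real_derivative_jweight])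
  have "((\<lambda>r. integral {a..r} (jweight (2 * \<gamma>))) has_real_derivative jweight (2 * \<gamma>) s) (at s within {a..s + 1})"
    by (rule integral_has_real_derivative[OF cont]) (simp add: a_def)
  then have "((\<lambda>r. (LINT r:{..<a}|lborel. jweight (2 * \<gamma>) r) + integral {a..r} (jweight (2 * \<gamma>)))
      has_real_derivative jweight (2 * \<gamma>) s) (at s within {a..s + 1})"
    by (auto intro!: derivative_eq_intros)
  then have "(jprim \<gamma> has_real_derivative jweight (2 * \<gamma>) s) (at s within {a..s + 1})"
    by (rule has_field_derivative_transform_within[where d = 1]) (auto simp: a_def eq[unfolded a_def])
  moreover have "at s within {a..s + 1} = at s"
    by (rule at_within_Icc_at) (auto simp: a_def)
  ultimately show ?thesis by simp
qed

lemma borel_measurable_jprim: "jprim \<gamma> \<in> borel_measurable borel"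
  by (intro borel_measurable_continuous_onI continuous_at_imp_continuous_on ballI
      DERIV_isCont[OF has_real_derivative_jprim])

text \<open>Derivatives of \<open>jweight p\<close> are bounded by multiples of
  \<open>jweight p\<close> itself, and bounded shifts change it by a bounded factor; hence all
  errors are relative to the weight at s. In the first estimate the symmetric difference removes the
  even orders. The second is the trapezoidal rule with the arithmetic mean of the squares of w(s)
  and w(s + t) replaced by w(s) w(s + t), where w is \<open>jweight \<gamma>\<close>: the
  replacement costs t (w(s + t) - w(s))^2 / 2, again of third order.\<close>

lemma jprim_local_estimates:
  fixes T :: real
  obtains C where "C \<ge> 0"
    "\<And>s t. \<bar>t\<bar> \<le> T \<Longrightarrow>
      \<bar>(jprim \<gamma> (s + t) - jprim \<gamma> (s - t)) / 2 - t * jweight (2 * \<gamma>) s\<bar> \<le> C * \<bar>t\<bar> ^ 3 * jweight (2 * \<gamma>) s"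
    "\<And>s t. \<bar>t\<bar> \<le> T \<Longrightarrow>
      \<bar>jprim \<gamma> (s + t) - jprim \<gamma> s - t * (jweight \<gamma> s * jweight \<gamma> (s + t))\<bar> \<le> C * \<bar>t\<bar> ^ 3 * jweight (2 * \<gamma>) s"
    "\<And>s t. \<bar>t\<bar> \<le> T \<Longrightarrow>
      \<bar>2 * jweight \<gamma> s - jweight \<gamma> (s + t) - jweight \<gamma> (s - t)\<bar> \<le> C * t\<^sup>2 * jweight \<gamma> s"
    "\<And>s t. \<bar>t\<bar> \<le> T \<Longrightarrow> jweight (2 * \<gamma>) s \<le> C * jweight (2 * \<gamma>) (s + t)"
proof
  \<comment> \<open>The range is 2 T because an expansion about s + t with increment at most |t|
    reaches that far from s.\<close>
  define P where "P = (\<lambda>p. (2 * (1 + (2 * T)\<^sup>2)) powr (p / 2))"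
  define K where "K = (\<lambda>p. (p + p * (p + 2)) * P p)"
  have P: "jweight p (s + r) \<le> P p * jweight p s" if "p \<ge> 0" "\<bar>r\<bar> \<le> 2 * T" for p s r
    unfolding P_def using that by (rule jweight_shift_le)
  have P0: "P p \<ge> 0" for p by (simp add: P_def)
  have K0: "K p \<ge> 0" if "p \<ge> 0" for p
    using that P0[of p] by (simp add: K_def)
  have J2: "\<bar>jweight2 p (s + r)\<bar> \<le> K p * jweight p s" if "p \<ge> 0" "\<bar>r\<bar> \<le> 2 * T" for p s r
  proof -
    have "\<bar>jweight2 p (s + r)\<bar> \<le> (p + p * (p + 2)) * jweight p (s + r)"
      using jweight_derivatives_le(2)[of p "s + r"] that by simp
    also have "\<dots> \<le> (p + p * (p + 2)) * (P p * jweight p s)"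
      using that by (intro mult_left_mono P) auto
    finally show ?thesis by (simp add: K_def mult.assoc)
  qed
  let ?J = "\<lambda>p s. - p * s * jweight (p + 2) s"
  have taylor: "\<bar>jweight p (s + t) - jweight p s - t * ?J p s\<bar> \<le> K p * jweight p s * t\<^sup>2"
    if "p \<ge> 0" "\<bar>t\<bar> \<le> T" for p s t
    by (rule taylor_le[OF has_real_derivative_jweight has_real_derivative_jweight1])
       (use that in \<open>auto intro!: J2\<close>)
  \<comment> \<open>Expansion about the far end point, still measured by the weight at s. The
    derivative of the trapezoidal error contains the slope at s + t.\<close>
  have taylor': "\<bar>jweight p s - jweight p (s + t) + t * ?J p (s + t)\<bar> \<le> K p * jweight p s * t\<^sup>2"
    if "p \<ge> 0" "\<bar>t\<bar> \<le> T" for p s t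
  proof -
    have "\<bar>jweight p ((s + t) + - t) - jweight p (s + t) - (- t) * ?J p (s + t)\<bar> \<le> K p * jweight p s * (- t)\<^sup>2"
    proof (rule taylor_le[OF has_real_derivative_jweight has_real_derivative_jweight1])
      fix r assume "\<bar>r\<bar> \<le> \<bar>- t\<bar>"
      then have "\<bar>t + r\<bar> \<le> 2 * T" using that by linarith
      from J2[OF \<open>p \<ge> 0\<close> this, of s] show "\<bar>jweight2 p (s + t + r)\<bar> \<le> K p * jweight p s"
        by (simp add: add.assoc)
    qed
    then show ?thesis by simp
  qed
  define q where "q = 2 * \<gamma>"
  have q: "q \<ge> 0" "\<gamma> \<ge> 0" using \<gamma> by (auto simp: q_def)
  define C where "C = K q + (\<gamma> * P \<gamma>)\<^sup>2 + 2 * K \<gamma> + P q"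
  have C: "K q \<le> C" "K q / 2 + (\<gamma> * P \<gamma>)\<^sup>2 / 2 \<le> C" "2 * K \<gamma> \<le> C" "P q \<le> C" and "C \<ge> 0"
    using K0[OF q(1)] K0[OF q(2)] P0[of q] zero_le_power2[of "\<gamma> * P \<gamma>"] unfolding C_def by linarith+
  then show "C \<ge> 0" by simp
  note F = has_real_derivative_jprim[folded q_def]
  fix s t :: real assume t: "\<bar>t\<bar> \<le> T"
  have ps: "jweight q s \<ge> 0" "jweight \<gamma> s \<ge> 0" by (simp_all add: jweight_nonneg)
  have rT: "\<bar>r\<bar> \<le> T" "r\<^sup>2 \<le> t\<^sup>2" if "\<bar>r\<bar> \<le> \<bar>t\<bar>" for r
  proof -
    show "\<bar>r\<bar> \<le> T" using that t by linarith
    show "r\<^sup>2 \<le> t\<^sup>2" using that by (simp only: abs_le_square_iff)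
  qed
  have mono: "A * jweight q s * r\<^sup>2 \<le> A * jweight q s * t\<^sup>2" if "\<bar>r\<bar> \<le> \<bar>t\<bar>" "A \<ge> 0" for A r
    using that ps rT(2)[OF that(1)] by (intro mult_left_mono mult_nonneg_nonneg)
  have cube: "A * jweight q s * t\<^sup>2 * \<bar>t\<bar> = A * \<bar>t\<bar> ^ 3 * jweight q s" for A
  proof -
    have "\<bar>t\<bar> ^ 3 = t\<^sup>2 * \<bar>t\<bar>"
      by (simp add: power3_eq_cube power2_eq_square)
    then show ?thesis by (simp only: mult_ac)
  qed
  \<comment> \<open>The linear terms of the expansions with increments r and -r cancel in the
    mean.\<close>
  have average: "\<bar>(x + y) / 2 - w\<bar> \<le> m"
    if "\<bar>x - w - r * d\<bar> \<le> k" "\<bar>y - w - (- r) * d\<bar> \<le> k" "k \<le> m" for x y w r d k m :: real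
  proof -
    have "x - w - r * d \<le> k" "- (x - w - r * d) \<le> k" "y - w + r * d \<le> k" "- (y - w + r * d) \<le> k"
      using that(1,2) by (simp_all add: abs_le_iff)
    then have "(x + y) / 2 - w \<le> m \<and> - ((x + y) / 2 - w) \<le> m"
      using that(3) by (simp add: field_simps)
    then show ?thesis
      by (simp add: abs_le_iff)
  qed
  show "\<bar>(jprim \<gamma> (s + t) - jprim \<gamma> (s - t)) / 2 - t * jweight (2 * \<gamma>) s\<bar> \<le> C * \<bar>t\<bar> ^ 3 * jweight (2 * \<gamma>) s"
    unfolding q_def[symmetric]
  proof -
    have "\<bar>((jprim \<gamma> (s + t) - jprim \<gamma> (s - t)) / 2 - t * jweight q s) - ((jprim \<gamma> (s + 0) - jprim \<gamma> (s - 0)) / 2 - 0 * jweight q s)\<bar>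
        \<le> (K q * jweight q s * t\<^sup>2) * \<bar>t\<bar>"
    proof (rule abs_diff_le_of_deriv)
      fix r :: real assume r: "\<bar>r\<bar> \<le> \<bar>t\<bar>"
      show "((\<lambda>t. (jprim \<gamma> (s + t) - jprim \<gamma> (s - t)) / 2 - t * jweight q s) has_real_derivative
          (jweight q (s + r) + jweight q (s - r)) / 2 - jweight q s) (at r)"
      proof -
        have "((\<lambda>t. (jprim \<gamma> (s + t) - jprim \<gamma> (s - t)) / 2 - t * jweight q s) has_real_derivative
            (jweight q (s + r) - (- jweight q (s - r))) / 2 - 1 * jweight q s) (at r)"
          by (intro DERIV_diff DERIV_cdivide DERIV_cmult_right DERIV_ident DERIV_shift_plus[OF F] DERIV_shift_minus[OF F])
        then show ?thesis by simp
      qed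
      show "\<bar>(jweight q (s + r) + jweight q (s - r)) / 2 - jweight q s\<bar> \<le> K q * jweight q s * t\<^sup>2"
      proof (rule average)
        show "\<bar>jweight q (s + r) - jweight q s - r * ?J q s\<bar> \<le> K q * jweight q s * r\<^sup>2"
          by (rule taylor[OF q(1) rT(1)[OF r]])
        show "\<bar>jweight q (s - r) - jweight q s - (- r) * ?J q s\<bar> \<le> K q * jweight q s * r\<^sup>2"
          using taylor[OF q(1), of "- r" s] rT(1)[OF r] by simp
      qed (rule mono[OF r K0[OF q(1)]])
    qed
    then have "\<bar>(jprim \<gamma> (s + t) - jprim \<gamma> (s - t)) / 2 - t * jweight q s\<bar> \<le> K q * \<bar>t\<bar> ^ 3 * jweight q s"
      unfolding cube by simp
    also have "\<dots> \<le> C * \<bar>t\<bar> ^ 3 * jweight q s"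
      using C(1) ps by (intro mult_right_mono) auto
    finally show "\<bar>(jprim \<gamma> (s + t) - jprim \<gamma> (s - t)) / 2 - t * jweight q s\<bar> \<le> C * \<bar>t\<bar> ^ 3 * jweight q s" .
  qed
  show "\<bar>2 * jweight \<gamma> s - jweight \<gamma> (s + t) - jweight \<gamma> (s - t)\<bar> \<le> C * t\<^sup>2 * jweight \<gamma> s"
  proof -
    have "\<bar>(jweight \<gamma> (s + t) + jweight \<gamma> (s - t)) / 2 - jweight \<gamma> s\<bar> \<le> K \<gamma> * t\<^sup>2 * jweight \<gamma> s"
    proof (rule average)
      show "\<bar>jweight \<gamma> (s + t) - jweight \<gamma> s - t * ?J \<gamma> s\<bar> \<le> K \<gamma> * jweight \<gamma> s * t\<^sup>2"
        by (rule taylor[OF q(2) t])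
      show "\<bar>jweight \<gamma> (s - t) - jweight \<gamma> s - (- t) * ?J \<gamma> s\<bar> \<le> K \<gamma> * jweight \<gamma> s * t\<^sup>2"
        using taylor[OF q(2), of "- t" s] t by simp
    qed (simp add: mult_ac)
    note avg = this
    have "\<bar>2 * jweight \<gamma> s - jweight \<gamma> (s + t) - jweight \<gamma> (s - t)\<bar> \<le> 2 * K \<gamma> * t\<^sup>2 * jweight \<gamma> s"
    proof -
      have "\<bar>(x + y) / 2 - w\<bar> \<le> m \<Longrightarrow> \<bar>2 * w - x - y\<bar> \<le> 2 * m" for x y w m :: real
        by (simp add: abs_le_iff field_simps)
      from this[OF avg] show ?thesis by (simp only: mult.assoc)
    qed
    also have "\<dots> \<le> C * t\<^sup>2 * jweight \<gamma> s"
      using C(3) ps by (intro mult_right_mono) auto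
    finally show ?thesis .
  qed
  show "jweight (2 * \<gamma>) s \<le> C * jweight (2 * \<gamma>) (s + t)"
  proof -
    have "jweight q ((s + t) + - t) \<le> P q * jweight q (s + t)"
      using t by (intro P q) auto
    also have "\<dots> \<le> C * jweight q (s + t)"
      using C(4) by (intro mult_right_mono jweight_nonneg)
    finally show ?thesis by (simp add: q_def)
  qed
  show "\<bar>jprim \<gamma> (s + t) - jprim \<gamma> s - t * (jweight \<gamma> s * jweight \<gamma> (s + t))\<bar> \<le> C * \<bar>t\<bar> ^ 3 * jweight (2 * \<gamma>) s"
    unfolding q_def[symmetric]
  proof -
    have "\<bar>(jprim \<gamma> (s + t) - jprim \<gamma> s - t * (jweight q s + jweight q (s + t)) / 2) -
        (jprim \<gamma> (s + 0) - jprim \<gamma> s - 0 * (jweight q s + jweight q (s + 0)) / 2)\<bar> \<le> (K q / 2 * jweight q s * t\<^sup>2) * \<bar>t\<bar>"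
    proof (rule abs_diff_le_of_deriv)
      fix r :: real assume r: "\<bar>r\<bar> \<le> \<bar>t\<bar>"
      show "((\<lambda>t. jprim \<gamma> (s + t) - jprim \<gamma> s - t * (jweight q s + jweight q (s + t)) / 2) has_real_derivative
          - (jweight q s - jweight q (s + r) + r * ?J q (s + r)) / 2) (at r)"
      proof -
        have "((\<lambda>t. jprim \<gamma> (s + t) - jprim \<gamma> s - t * (jweight q s + jweight q (s + t)) / 2) has_real_derivative
            jweight q (s + r) - 0 - (1 * (jweight q s + jweight q (s + r)) + (0 + ?J q (s + r)) * r) / 2) (at r)"
          by (intro DERIV_diff DERIV_const DERIV_cdivide DERIV_mult DERIV_add DERIV_ident DERIV_shift_plus[OF F]
              DERIV_shift_plus[OF has_real_derivative_jweight])
        moreover have "jweight q (s + r) - 0 - (1 * (jweight q s + jweight q (s + r)) + (0 + d) * r) / 2 =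
            - (jweight q s - jweight q (s + r) + r * d) / 2" for d
          by (simp add: field_simps)
        ultimately show ?thesis by (simp only:)
      qed
      show "\<bar>- (jweight q s - jweight q (s + r) + r * ?J q (s + r)) / 2\<bar> \<le> K q / 2 * jweight q s * t\<^sup>2"
        using taylor'[OF q(1) rT(1)[OF r], of s] mono[OF r K0[OF q(1)]] by simp
    qed
    then have trap: "\<bar>jprim \<gamma> (s + t) - jprim \<gamma> s - t * (jweight q s + jweight q (s + t)) / 2\<bar> \<le> K q / 2 * \<bar>t\<bar> ^ 3 * jweight q s"
      unfolding cube by simp
    have square: "jweight q r = (jweight \<gamma> r)\<^sup>2" for r
      by (simp only: q_def mult_2 jweight_add power2_eq_square)
    have "\<bar>jweight \<gamma> (s + t) - jweight \<gamma> (s + 0)\<bar> \<le> (\<gamma> * P \<gamma> * jweight \<gamma> s) * \<bar>t\<bar>"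
    proof (rule abs_diff_le_of_deriv)
      fix r :: real assume r: "\<bar>r\<bar> \<le> \<bar>t\<bar>"
      show "((\<lambda>t. jweight \<gamma> (s + t)) has_real_derivative ?J \<gamma> (s + r)) (at r)"
        by (auto intro!: derivative_eq_intros)
      have "\<bar>?J \<gamma> (s + r)\<bar> \<le> \<gamma> * jweight \<gamma> (s + r)"
        using q by (intro jweight_derivatives_le)
      also have "\<dots> \<le> \<gamma> * (P \<gamma> * jweight \<gamma> s)"
        using q rT(1)[OF r] by (intro mult_left_mono P) auto
      finally show "\<bar>?J \<gamma> (s + r)\<bar> \<le> \<gamma> * P \<gamma> * jweight \<gamma> s" by (simp add: mult.assoc)
    qed
    then have "(jweight \<gamma> (s + t) - jweight \<gamma> s)\<^sup>2 \<le> (\<gamma> * P \<gamma> * jweight \<gamma> s * \<bar>t\<bar>)\<^sup>2"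
      by (intro power2_le_iff_abs_le[THEN iffD2]) auto
    also have "\<dots> = (\<gamma> * P \<gamma>)\<^sup>2 * jweight q s * t\<^sup>2"
      by (simp add: square power_mult_distrib)
    finally have sq: "(jweight \<gamma> (s + t) - jweight \<gamma> s)\<^sup>2 \<le> (\<gamma> * P \<gamma>)\<^sup>2 * jweight q s * t\<^sup>2" .
    have "\<bar>t * (jweight \<gamma> (s + t) - jweight \<gamma> s)\<^sup>2 / 2\<bar> \<le> (\<gamma> * P \<gamma>)\<^sup>2 / 2 * \<bar>t\<bar> ^ 3 * jweight q s"
    proof -
      have "\<bar>t * (jweight \<gamma> (s + t) - jweight \<gamma> s)\<^sup>2 / 2\<bar> = (jweight \<gamma> (s + t) - jweight \<gamma> s)\<^sup>2 * \<bar>t\<bar> / 2"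
        by (simp add: abs_mult)
      also have "\<dots> \<le> ((\<gamma> * P \<gamma>)\<^sup>2 * \<bar>t\<bar> ^ 3 * jweight q s) / 2"
        using mult_right_mono[OF sq abs_ge_zero, of t] unfolding cube by (rule divide_right_mono) simp
      finally show ?thesis by simp
    qed
    moreover have "t * (jweight \<gamma> s * jweight \<gamma> (s + t)) =
        t * (jweight q s + jweight q (s + t)) / 2 - t * (jweight \<gamma> (s + t) - jweight \<gamma> s)\<^sup>2 / 2"
    proof -
      have "t * (x * y) = t * (x\<^sup>2 + y\<^sup>2) / 2 - t * (y - x)\<^sup>2 / 2" for x y
        by (simp add: power2_eq_square field_simps)
      then show ?thesis unfolding square .
    qed
    ultimately have "\<bar>jprim \<gamma> (s + t) - jprim \<gamma> s - t * (jweight \<gamma> s * jweight \<gamma> (s + t))\<bar> \<le>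
        K q / 2 * \<bar>t\<bar> ^ 3 * jweight q s + (\<gamma> * P \<gamma>)\<^sup>2 / 2 * \<bar>t\<bar> ^ 3 * jweight q s"
      using trap by linarith
    also have "\<dots> = (K q / 2 + (\<gamma> * P \<gamma>)\<^sup>2 / 2) * \<bar>t\<bar> ^ 3 * jweight q s"
      by (simp add: distrib_right)
    also have "\<dots> \<le> C * \<bar>t\<bar> ^ 3 * jweight q s"
      using C(2) ps by (intro mult_right_mono) auto
    finally show "\<bar>jprim \<gamma> (s + t) - jprim \<gamma> s - t * (jweight \<gamma> s * jweight \<gamma> (s + t))\<bar> \<le> C * \<bar>t\<bar> ^ 3 * jweight q s" .
  qed
qed

text \<open>The hypothesis \<open>2 * \<gamma> \<le> a + 1\<close> enters here only: the far part of the
  integral is of size \<open>jweight (a + 1) s\<close>.\<close>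

lemma jprim_tail_estimate:
  fixes \<sigma> :: "'a::euclidean_space"
  assumes a: "a > 0" "2 * \<gamma> \<le> a + 1"
  obtains C where "C \<ge> 0"
    "\<And>s. (\<integral>\<^sup>+z. ennreal (norm z powr - (real DIM('a) + a + 1) * \<bar>jprim \<gamma> (s + \<sigma> \<bullet> z) - jprim \<gamma> s\<bar>) * indicator {z. 1 < norm z} z \<partial>lborel)
      \<le> ennreal (C * jweight (2 * \<gamma>) s)"
proof -
  obtain C1 where C1: "C1 \<ge> 0" "\<And>R. R > 0 \<Longrightarrow>
      (\<integral>\<^sup>+z. ennreal (norm z powr - (real DIM('a) + a)) * indicator {z. R < norm z} z \<partial>(lborel :: 'a measure)) = ennreal (C1 * R powr - a)"
    using nn_integral_norm_powr_tail[OF a(1), where 'a = 'a] by blast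
  have a1: "a + 1 > 0" using a by simp
  obtain C2 where C2: "C2 \<ge> 0" "\<And>R. R > 0 \<Longrightarrow>
      (\<integral>\<^sup>+z. ennreal (norm z powr - (real DIM('a) + (a + 1))) * indicator {z. R < norm z} z \<partial>(lborel :: 'a measure)) = ennreal (C2 * R powr - (a + 1))"
    using nn_integral_norm_powr_tail[OF a1, where 'a = 'a] by blast
  define M where "M = (LINT r|lborel. jweight (2 * \<gamma>) r)"
  have M: "M \<ge> 0"
    unfolding M_def by (intro integral_nonneg_AE) (auto simp: jweight_nonneg)
  \<comment> \<open>Chosen so that |\<sigma> \<bullet> z| > B / 2 forces |z| > R = B / S; the added
    1 keeps S positive when \<sigma> = 0.\<close>
  define S where "S = 2 * (norm \<sigma> + 1)"
  have S: "S > 0" unfolding S_def by (smt (verit) norm_ge_zero)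
  define E where "E = 4 powr \<gamma> * norm \<sigma>"
  have E: "E \<ge> 0" by (simp add: E_def)
  show thesis
  proof
    show "E * C1 + M * C2 * S powr (a + 1) \<ge> 0"
      using E C1 C2 M by simp
    fix s
    define B where "B = sqrt (1 + s\<^sup>2)"
    have B: "B > 0" using one_plus_square_pos[of s] by (simp add: B_def)
    define R where "R = B / S"
    have R: "R > 0" using B S by (simp add: R_def)
    \<comment> \<open>If |\<sigma> \<bullet> z| is at most half the bracket of s, the weight is
      comparable to its value at s along the whole segment, and the mean value theorem gives a
      factor |z|. Otherwise the increment is bounded by the total mass M, but then |z| > R, and
      integrating this tail gives the power R^-(a + 1).\<close>
    have pt: "norm z powr - (real DIM('a) + a + 1) * \<bar>jprim \<gamma> (s + \<sigma> \<bullet> z) - jprim \<gamma> s\<bar> * indicator {z. 1 < norm z} z \<le>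
      E * jweight (2 * \<gamma>) s * (norm z powr - (real DIM('a) + a) * indicator {z. 1 < norm z} z) +
      M * (norm z powr - (real DIM('a) + (a + 1)) * indicator {z. R < norm z} z)" for z
    proof (cases "\<bar>\<sigma> \<bullet> z\<bar> \<le> B / 2 \<and> z \<noteq> 0")
      case True
      have "\<bar>jprim \<gamma> (s + \<sigma> \<bullet> z) - jprim \<gamma> (s + 0)\<bar> \<le> (4 powr \<gamma> * jweight (2 * \<gamma>) s) * \<bar>\<sigma> \<bullet> z\<bar>"
      proof (rule abs_diff_le_of_deriv)
        fix r assume "\<bar>r\<bar> \<le> \<bar>\<sigma> \<bullet> z\<bar>"
        then have "\<bar>r\<bar> \<le> sqrt (1 + s\<^sup>2) / 2" using True by (simp add: B_def)
        then show "\<bar>jweight (2 * \<gamma>) (s + r)\<bar> \<le> 4 powr \<gamma> * jweight (2 * \<gamma>) s"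
          using jweight_near_le[of "2 * \<gamma>" r s] \<gamma> by (simp add: jweight_nonneg)
        show "((\<lambda>r. jprim \<gamma> (s + r)) has_real_derivative jweight (2 * \<gamma>) (s + r)) (at r)"
          by (rule DERIV_shift_plus[OF has_real_derivative_jprim])
      qed
      also have "\<dots> \<le> (4 powr \<gamma> * jweight (2 * \<gamma>) s) * (norm \<sigma> * norm z)"
        by (intro mult_left_mono Cauchy_Schwarz_ineq2) (simp add: jweight_nonneg)
      finally have "norm z powr - (real DIM('a) + a + 1) * \<bar>jprim \<gamma> (s + \<sigma> \<bullet> z) - jprim \<gamma> s\<bar> \<le>
          norm z powr - (real DIM('a) + a + 1) * ((4 powr \<gamma> * jweight (2 * \<gamma>) s) * (norm \<sigma> * norm z))"
        by (intro mult_left_mono) auto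
      also have "\<dots> = E * jweight (2 * \<gamma>) s * (norm z powr (1 + - (real DIM('a) + a + 1)))"
        using True unfolding powr_add by (simp add: E_def mult_ac)
      also have "1 + - (real DIM('a) + a + 1) = - (real DIM('a) + a)" by simp
      finally show ?thesis
        using mult_nonneg_nonneg[OF M powr_ge_zero[of "norm z" "- (real DIM('a) + (a + 1))"]]
        by (auto simp: indicator_def)
    next
      case False
      have "R < norm z" if "z \<noteq> 0"
      proof -
        have "B / 2 < norm \<sigma> * norm z"
          using False that Cauchy_Schwarz_ineq2[of \<sigma> z] by linarith
        also have "\<dots> \<le> (norm \<sigma> + 1) * norm z"
          by (intro mult_right_mono) auto
        finally show ?thesis
          using S by (simp add: R_def S_def field_simps)
      qed
      moreover have "norm z powr - (real DIM('a) + a + 1) * \<bar>jprim \<gamma> (s + \<sigma> \<bullet> z) - jprim \<gamma> s\<bar> \<le> norm z powr - (real DIM('a) + a + 1) * M"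
        unfolding M_def by (intro mult_left_mono jprim_diff_le) auto
      moreover have "norm z powr - (real DIM('a) + a + 1) * M = M * norm z powr - (real DIM('a) + (a + 1))"
        by (simp only: add.assoc mult.commute)
      moreover have nonneg: "0 \<le> E * jweight (2 * \<gamma>) s * norm z powr - (real DIM('a) + a)"
          "0 \<le> M * norm z powr - (real DIM('a) + (a + 1))"
        using E M jweight_nonneg[of "2 * \<gamma>" s] by (intro mult_nonneg_nonneg; simp)+
      ultimately have "1 < norm z \<Longrightarrow> R < norm z" and
          "norm z powr - (real DIM('a) + a + 1) * \<bar>jprim \<gamma> (s + \<sigma> \<bullet> z) - jprim \<gamma> s\<bar> \<le>
            E * jweight (2 * \<gamma>) s * norm z powr - (real DIM('a) + a) + M * norm z powr - (real DIM('a) + (a + 1))"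
        by (fastforce, linarith)
      then show ?thesis
        using nonneg by (auto simp: indicator_def)
    qed
    have "(\<integral>\<^sup>+z. ennreal (norm z powr - (real DIM('a) + a + 1) * \<bar>jprim \<gamma> (s + \<sigma> \<bullet> z) - jprim \<gamma> s\<bar>) * indicator {z. 1 < norm z} z \<partial>lborel)
      \<le> (\<integral>\<^sup>+z. ennreal (E * jweight (2 * \<gamma>) s) * (ennreal (norm z powr - (real DIM('a) + a)) * indicator {z. 1 < norm z} z) +
        ennreal M * (ennreal (norm z powr - (real DIM('a) + (a + 1))) * indicator {z. R < norm z} z) \<partial>(lborel :: 'a measure))"
    proof (rule nn_integral_mono)
      fix z :: 'a
      show "ennreal (norm z powr - (real DIM('a) + a + 1) * \<bar>jprim \<gamma> (s + \<sigma> \<bullet> z) - jprim \<gamma> s\<bar>) * indicator {z. 1 < norm z} z \<le>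
        ennreal (E * jweight (2 * \<gamma>) s) * (ennreal (norm z powr - (real DIM('a) + a)) * indicator {z. 1 < norm z} z) +
        ennreal M * (ennreal (norm z powr - (real DIM('a) + (a + 1))) * indicator {z. R < norm z} z)"
        using ennreal_leI[OF pt[of z]] E M jweight_nonneg[of "2 * \<gamma>" s]
        by (simp add: ennreal_mult ennreal_plus ennreal_indicator)
    qed
    also have "\<dots> = ennreal (E * jweight (2 * \<gamma>) s) * ennreal (C1 * 1 powr - a) + ennreal M * ennreal (C2 * R powr - (a + 1))"
      by (subst nn_integral_add, simp, simp, subst nn_integral_cmult, simp, subst nn_integral_cmult, simp)
         (simp only: C1(2)[OF zero_less_one] C2(2)[OF R])
    also have "\<dots> = ennreal (E * jweight (2 * \<gamma>) s * C1 + M * (C2 * R powr - (a + 1)))"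
      using E M C1(1) C2(1) jweight_nonneg[of "2 * \<gamma>" s] by (simp add: ennreal_mult ennreal_plus)
    also have "\<dots> \<le> ennreal ((E * C1 + M * C2 * S powr (a + 1)) * jweight (2 * \<gamma>) s)"
    proof (rule ennreal_leI)
      have "R powr - (a + 1) = S powr (a + 1) * B powr - (a + 1)"
        using B S by (simp only: R_def powr_minus) (simp add: powr_divide, simp add: divide_inverse)
      also have "B powr - (a + 1) = jweight (a + 1) s"
      proof -
        have "B = (1 + s\<^sup>2) powr (1 / 2)"
          by (simp add: B_def powr_half_sqrt)
        then show ?thesis
          unfolding jweight_def by (simp only: powr_powr) simp
      qed
      finally have "R powr - (a + 1) = S powr (a + 1) * jweight (a + 1) s" .
      then have "R powr - (a + 1) \<le> S powr (a + 1) * jweight (2 * \<gamma>) s"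
        using jweight_antimono[OF a(2), of s] by (simp add: mult_left_mono)
      then have "M * C2 * R powr - (a + 1) \<le> M * C2 * (S powr (a + 1) * jweight (2 * \<gamma>) s)"
        using M C2(1) by (intro mult_left_mono) auto
      then show "E * jweight (2 * \<gamma>) s * C1 + M * (C2 * R powr - (a + 1)) \<le> (E * C1 + M * C2 * S powr (a + 1)) * jweight (2 * \<gamma>) s"
        by (simp add: algebra_simps)
    qed
    finally show "(\<integral>\<^sup>+z. ennreal (norm z powr - (real DIM('a) + a + 1) * \<bar>jprim \<gamma> (s + \<sigma> \<bullet> z) - jprim \<gamma> s\<bar>) * indicator {z. 1 < norm z} z \<partial>lborel)
      \<le> ennreal ((E * C1 + M * C2 * S powr (a + 1)) * jweight (2 * \<gamma>) s)" .
  qed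
qed

end

section \<open>Localisation of the bilinear form\<close>

lemma integrable_schwartz_product:
  fixes f g h :: "real^'n::finite \<Rightarrow> real"
  assumes f: "schwartz f" and g: "schwartz g" and h: "h \<in> borel_measurable borel" "\<And>x. \<bar>h x\<bar> \<le> M"
  shows "integrable lborel (\<lambda>x. f (x + a) * g (x + b) * h x)"
proof -
  note [measurable] = schwartz_measurable[OF f] schwartz_measurable[OF g] h(1)
  obtain C where C: "\<And>x. \<bar>f x\<bar> \<le> C"
    using schwartz_bounded[OF f] by blast
  have C0: "C \<ge> 0" using C[of 0] by linarith
  show ?thesis
  proof (rule Bochner_Integration.integrable_bound)
    show "integrable lborel (\<lambda>x. C * M * \<bar>g (x + b)\<bar>)"
      using schwartz_integrable[OF g] by (intro integrable_mult_right integrable_abs) (simp add: lborel_integrable_shift)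
    show "AE x in lborel. norm (f (x + a) * g (x + b) * h x) \<le> norm (C * M * \<bar>g (x + b)\<bar>)"
    proof (rule AE_I2)
      fix x
      have "\<bar>f (x + a)\<bar> * \<bar>h x\<bar> * \<bar>g (x + b)\<bar> \<le> C * M * \<bar>g (x + b)\<bar>"
        using C C0 h(2) by (intro mult_right_mono mult_mono) auto
      then have "norm (f (x + a) * g (x + b) * h x) \<le> C * M * \<bar>g (x + b)\<bar>"
        by (simp add: abs_mult mult_ac)
      then show "norm (f (x + a) * g (x + b) * h x) \<le> norm (C * M * \<bar>g (x + b)\<bar>)"
        unfolding real_norm_def by (rule order_trans[OF _ abs_ge_self])
    qed
  qed measurable
qed

locale weighted_schwartz =
  fixes \<gamma> \<omega> :: real and \<sigma> :: "real^'n::finite" and u :: "real^'n \<Rightarrow> real"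
  assumes \<gamma>: "\<gamma> > 1 / 2" and u: "schwartz u"
begin

abbreviation F where "F \<equiv> jprim \<gamma>"
abbreviation w where "w \<equiv> jweight \<gamma>"
abbreviation s where "s x \<equiv> \<sigma> \<bullet> x + \<omega>"
abbreviation M where "M \<equiv> LINT r|lborel. jweight (2 * \<gamma>) r"

definition v where "v x = u x * w (s x)"
definition grad where "grad z x = (\<Sum>j\<in>UNIV. z $ j * partial_deriv j u x)"
definition Y where "Y = (LINT x|lborel. (v x)\<^sup>2)"
definition B where "B z = (LINT x|lborel. (v (x + z) - v x)\<^sup>2)"
text \<open>The z-density of the pairing: the odd part of the translation of u minus its linear
  part, tested against u \<Phi>. On the Fourier side the bracket becomes multiplication by
  \<open>\<i> * (sin (z \<bullet> \<xi>) - z \<bullet> \<xi>)\<close>.\<close>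

definition g where "g z = (LINT x|lborel. ((u (x + z) - u (x - z)) / 2 - grad z x) * (u x * F (s x)))"
text \<open>Used with \<tau> = \<sigma> and \<tau> = -\<sigma>: a translation by z moves the square
  at x + z back to x and reverses the increment of \<Phi>.\<close>

definition H :: "real^'n \<Rightarrow> real^'n \<Rightarrow> real" where
  "H \<tau> z = (LINT x|lborel. (u x)\<^sup>2 * \<bar>F (s x + \<tau> \<bullet> z) - F (s x)\<bar>)"

lemma schwartz_v: "schwartz v"
proof -
  have "v = (\<lambda>x. u x * w (s x))"
    by (simp add: fun_eq_iff v_def)
  then show ?thesis
    using schwartz_mult_jweight[OF u, of \<gamma> \<sigma> \<omega>] \<gamma> by simp
qed

lemma measurable_facts [measurable]:
  "u \<in> borel_measurable borel" "v \<in> borel_measurable borel" "F \<in> borel_measurable borel"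
  "partial_deriv j u \<in> borel_measurable borel" "grad z \<in> borel_measurable borel"
  unfolding grad_def[abs_def]
  using schwartz_measurable[OF u] schwartz_measurable[OF schwartz_v] borel_measurable_jprim[OF \<gamma>]
    schwartz_measurable[OF schwartz_partial_deriv[OF u]]
  by measurable

lemma w_bounded: "\<bar>w r\<bar> \<le> 1"
  using \<gamma> jweight_le_1[of \<gamma> r] by (simp add: jweight_nonneg)

lemma F_bounded: "\<bar>F r\<bar> \<le> M"
  using jprim_nonneg[OF \<gamma>] jprim_le[OF \<gamma>] by simp

lemma jweight_2\<gamma>: "jweight (2 * \<gamma>) r = w r * w r"
  by (simp only: mult_2 jweight_add)

lemma v_square: "(v x)\<^sup>2 = u x * u x * jweight (2 * \<gamma>) (s x)"
  unfolding v_def jweight_2\<gamma> power2_eq_square by (simp add: mult_ac)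

lemma int_uu:
  assumes "h \<in> borel_measurable borel" "\<And>x. \<bar>h x\<bar> \<le> K"
  shows "integrable lborel (\<lambda>x. u (x + a) * u (x + b) * h x)"
  by (rule integrable_schwartz_product[OF u u assms])

lemma integrable_v_square: "integrable lborel (\<lambda>x. (v x)\<^sup>2)"
  using integrable_schwartz_product[OF schwartz_v schwartz_v, of "\<lambda>_. 1" 1 0 0]
  by (simp add: power2_eq_square)

lemma Y_nonneg: "Y \<ge> 0"
  unfolding Y_def by (intro integral_nonneg_AE) auto

text \<open>The derivative of u^2 \<Phi> / 2 along z is the integrand plus (\<sigma> \<bullet> z /
  2) v^2, and its integral vanishes. Removing the linear part from the kernel therefore costs only a
  term in the integral of v^2.\<close>

lemma integral_grad: "(LINT x|lborel. grad z x * (u x * F (s x))) = - (\<sigma> \<bullet> z / 2) * Y"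
  and integrable_grad: "integrable lborel (\<lambda>x. grad z x * (u x * F (s x)))"
proof -
  let ?h = "\<lambda>x. u x * u x * F (s x) / 2"
  have hi: "integrable lborel ?h"
    using int_uu[of "\<lambda>x. F (s x)" M 0 0] F_bounded by simp
  have "integrable lborel (\<lambda>x. \<Sum>j\<in>UNIV. z $ j * (partial_deriv j u x * u x * F (s x)))"
    using integrable_schwartz_product[OF schwartz_partial_deriv[OF u] u, where h = "\<lambda>x. F (s x)" and M = M and a = 0 and b = 0] F_bounded
    by (intro Bochner_Integration.integrable_sum integrable_mult_right) auto
  then show gi: "integrable lborel (\<lambda>x. grad z x * (u x * F (s x)))"
    by (simp add: grad_def sum_distrib_left sum_distrib_right mult_ac)
  have vi: "integrable lborel (\<lambda>x. \<sigma> \<bullet> z / 2 * (v x)\<^sup>2)"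
    using integrable_v_square by (rule integrable_mult_right)
  have "(LINT x|lborel. grad z x * (u x * F (s x)) + \<sigma> \<bullet> z / 2 * (v x)\<^sup>2) = 0"
  proof (rule integral_line_derivative_eq_0[OF _ hi])
    fix x and t :: real
    have "((\<lambda>t. u (x + t *\<^sub>R z)) has_real_derivative grad z (x + t *\<^sub>R z)) (at t)"
      using schwartz_has_line_derivative[OF u] by (simp add: grad_def)
    moreover have "((\<lambda>t. F (s (x + t *\<^sub>R z))) has_real_derivative jweight (2 * \<gamma>) (s (x + t *\<^sub>R z)) * (\<sigma> \<bullet> z)) (at t)"
      by (rule DERIV_chain2[OF has_real_derivative_jprim[OF \<gamma>]])
         (auto intro!: derivative_eq_intros simp: inner_add_right)
    ultimately have "((\<lambda>t. u (x + t *\<^sub>R z) * u (x + t *\<^sub>R z) * F (s (x + t *\<^sub>R z)) / 2) has_real_derivative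
        ((grad z (x + t *\<^sub>R z) * u (x + t *\<^sub>R z) + grad z (x + t *\<^sub>R z) * u (x + t *\<^sub>R z)) * F (s (x + t *\<^sub>R z)) +
          (jweight (2 * \<gamma>) (s (x + t *\<^sub>R z)) * (\<sigma> \<bullet> z)) * (u (x + t *\<^sub>R z) * u (x + t *\<^sub>R z))) / 2) (at t)"
      by (intro DERIV_cdivide DERIV_mult)
    then show "((\<lambda>t. ?h (x + t *\<^sub>R z)) has_vector_derivative
        grad z (x + t *\<^sub>R z) * (u (x + t *\<^sub>R z) * F (s (x + t *\<^sub>R z))) + \<sigma> \<bullet> z / 2 * (v (x + t *\<^sub>R z))\<^sup>2) (at t)"
      unfolding has_real_derivative_iff_has_vector_derivative[symmetric] v_square
      by (rule DERIV_cong) (simp add: field_simps)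
  next
    show "integrable lborel (\<lambda>x. grad z x * (u x * F (s x)) + \<sigma> \<bullet> z / 2 * (v x)\<^sup>2)"
      using gi vi by (rule Bochner_Integration.integrable_add)
    have "continuous_on UNIV F"
      by (intro continuous_at_imp_continuous_on ballI DERIV_isCont[OF has_real_derivative_jprim[OF \<gamma>]])
    then have cont: "continuous_on UNIV (\<lambda>x. F (s x))"
      by (rule continuous_on_compose2) (auto intro!: continuous_intros)
    show "continuous_on UNIV (\<lambda>x. grad z x * (u x * F (s x)) + \<sigma> \<bullet> z / 2 * (v x)\<^sup>2)"
      unfolding grad_def
      by (intro continuous_intros cont schwartz_continuous[OF u] schwartz_continuous[OF schwartz_v]
          schwartz_continuous[OF schwartz_partial_deriv[OF u]])
  qed
  then show "(LINT x|lborel. grad z x * (u x * F (s x))) = - (\<sigma> \<bullet> z / 2) * Y"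
    using gi vi by (simp add: Y_def)
qed

text \<open>Translating the term with u(x - z) by z makes both terms carry u(x) u(x + z), so that
  only an increment of \<Phi> is left.\<close>

lemma g_eq:
  "g z = (LINT x|lborel. u x * u (x + z) * (F (s x) - F (s x + \<sigma> \<bullet> z))) / 2 + \<sigma> \<bullet> z / 2 * Y"
proof -
  have i1: "integrable lborel (\<lambda>x. u (x + z) * u x * F (s x))"
    using int_uu[of "\<lambda>x. F (s x)" M z 0] F_bounded by simp
  have i2: "integrable lborel (\<lambda>x. u (x - z) * u x * F (s x))"
    using int_uu[of "\<lambda>x. F (s x)" M "- z" 0] F_bounded by simp
  have i3: "integrable lborel (\<lambda>x. u x * u (x + z) * F (s x + \<sigma> \<bullet> z))"
    using int_uu[of "\<lambda>x. F (s x + \<sigma> \<bullet> z)" M 0 z] F_bounded by simp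
  have shift: "(LINT x|lborel. u (x - z) * u x * F (s x)) = (LINT x|lborel. u x * u (x + z) * F (s x + \<sigma> \<bullet> z))"
    using lborel_integral_shift[of "\<lambda>x. u (x - z) * u x * F (s x)" z]
    by (simp add: inner_add_right add_ac)
  have "g z = (LINT x|lborel. u (x + z) * u x * F (s x) / 2 - u (x - z) * u x * F (s x) / 2 - grad z x * (u x * F (s x)))"
    unfolding g_def by (intro Bochner_Integration.integral_cong refl) (simp add: field_simps)
  also have "\<dots> = (LINT x|lborel. u (x + z) * u x * F (s x)) / 2 - (LINT x|lborel. u (x - z) * u x * F (s x)) / 2
      - (LINT x|lborel. grad z x * (u x * F (s x)))"
    using i1 i2 integrable_grad[of z] by simp
  also have "\<dots> = ((LINT x|lborel. u (x + z) * u x * F (s x)) - (LINT x|lborel. u x * u (x + z) * F (s x + \<sigma> \<bullet> z))) / 2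
      + \<sigma> \<bullet> z / 2 * Y"
    unfolding shift integral_grad by (simp add: field_simps)
  also have "(LINT x|lborel. u (x + z) * u x * F (s x)) - (LINT x|lborel. u x * u (x + z) * F (s x + \<sigma> \<bullet> z)) =
      (LINT x|lborel. u x * u (x + z) * (F (s x) - F (s x + \<sigma> \<bullet> z)))"
    using i1 i3 by (subst Bochner_Integration.integral_diff[symmetric]) (simp_all add: algebra_simps)
  finally show ?thesis .
qed

lemma F_diff_bounded: "\<bar>F r - F r'\<bar> \<le> M"
  by (rule jprim_diff_le[OF \<gamma>])

lemma integrable_H: "integrable lborel (\<lambda>x. (u x)\<^sup>2 * \<bar>F (s x + r) - F (s x)\<bar>)"
  using int_uu[of "\<lambda>x. \<bar>F (s x + r) - F (s x)\<bar>" M 0 0] F_diff_bounded by (simp add: power2_eq_square)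

lemma integrable_v_shift: "integrable lborel (\<lambda>x. (v (x + z))\<^sup>2)"
  and integral_v_shift: "(LINT x|lborel. (v (x + z))\<^sup>2) = Y"
  using integrable_v_square
  by (simp_all add: lborel_integrable_shift[of "\<lambda>x. (v x)\<^sup>2"] lborel_integral_shift[of "\<lambda>x. (v x)\<^sup>2"] Y_def)

lemma integrable_v_diff: "integrable lborel (\<lambda>x. (v (x + z) - v x)\<^sup>2)"
proof (rule Bochner_Integration.integrable_bound)
  show "integrable lborel (\<lambda>x. 2 * (v (x + z))\<^sup>2 + 2 * (v x)\<^sup>2)"
    using integrable_v_shift integrable_v_square by auto
  have "(a - b)\<^sup>2 \<le> 2 * a\<^sup>2 + 2 * b\<^sup>2" for a b :: real
    using zero_le_power2[of "a + b"] by (simp add: power2_eq_square algebra_simps)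
  then show "AE x in lborel. norm ((v (x + z) - v x)\<^sup>2) \<le> norm (2 * (v (x + z))\<^sup>2 + 2 * (v x)\<^sup>2)"
    by auto
qed measurable

lemma B_nonneg: "B z \<ge> 0"
  unfolding B_def by (intro integral_nonneg_AE) auto

lemma B_le: "B z \<le> 4 * Y"
proof -
  have "(a - b)\<^sup>2 \<le> 2 * a\<^sup>2 + 2 * b\<^sup>2" for a b :: real
    using zero_le_power2[of "a + b"] by (simp add: power2_eq_square algebra_simps)
  then have "B z \<le> (LINT x|lborel. 2 * (v (x + z))\<^sup>2 + 2 * (v x)\<^sup>2)"
    unfolding B_def using integrable_v_diff integrable_v_shift integrable_v_square
    by (intro integral_mono) auto
  also have "\<dots> = 4 * Y"
    using integrable_v_shift integrable_v_square integral_v_shift by (simp add: Y_def)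
  finally show ?thesis .
qed

lemma H_shift: "(LINT x|lborel. (u (x + z))\<^sup>2 * \<bar>F (s x) - F (s x + \<sigma> \<bullet> z)\<bar>) = H (- \<sigma>) z"
proof -
  have "H (- \<sigma>) z = (LINT x|lborel. (\<lambda>x. (u x)\<^sup>2 * \<bar>F (s x + (- \<sigma>) \<bullet> z) - F (s x)\<bar>) (x + z))"
    unfolding H_def by (rule lborel_integral_shift[symmetric]) measurable
  then show ?thesis
    by (simp add: inner_add_right add_ac)
qed

lemma integrable_H_shift: "integrable lborel (\<lambda>x. (u (x + z))\<^sup>2 * \<bar>F (s x) - F (s x + \<sigma> \<bullet> z)\<bar>)"
  using int_uu[of "\<lambda>x. \<bar>F (s x) - F (s x + \<sigma> \<bullet> z)\<bar>" M z z] F_diff_bounded by (simp add: power2_eq_square)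

text \<open>Meant for |z| > 1, where no cancellation between \<open>g\<close> and the leading form
  is exploited. The product u(x) u(x + z) is bounded by half the sum of squares; the factor 3/2
  collects 1/2 from the local term in \<open>g_eq\<close> and 1 from B \<le> 4 Y.\<close>

lemma far_estimate: "\<bar>g z - \<sigma> \<bullet> z / 4 * B z\<bar> \<le> (H \<sigma> z + H (- \<sigma>) z) / 4 + 3 / 2 * \<bar>\<sigma> \<bullet> z\<bar> * Y"
proof -
  let ?D = "\<lambda>x. F (s x) - F (s x + \<sigma> \<bullet> z)"
  have "\<bar>LINT x|lborel. u x * u (x + z) * ?D x\<bar> \<le> (LINT x|lborel. \<bar>u x * u (x + z) * ?D x\<bar>)"
    by (rule integral_abs_bound)
  also have "\<dots> \<le> (LINT x|lborel. ((u x)\<^sup>2 * \<bar>F (s x + \<sigma> \<bullet> z) - F (s x)\<bar> + (u (x + z))\<^sup>2 * \<bar>?D x\<bar>) / 2)"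
  proof (rule integral_mono)
    show "integrable lborel (\<lambda>x. \<bar>u x * u (x + z) * ?D x\<bar>)"
      using int_uu[of ?D M 0 z] F_diff_bounded by (intro integrable_abs) simp
    show "integrable lborel (\<lambda>x. ((u x)\<^sup>2 * \<bar>F (s x + \<sigma> \<bullet> z) - F (s x)\<bar> + (u (x + z))\<^sup>2 * \<bar>?D x\<bar>) / 2)"
      using integrable_H integrable_H_shift by simp
    fix x
    have "\<bar>a * b\<bar> \<le> (a\<^sup>2 + b\<^sup>2) / 2" for a b :: real
      using zero_le_power2[of "\<bar>a\<bar> - \<bar>b\<bar>"] by (simp add: power2_diff abs_mult)
    from mult_right_mono[OF this abs_ge_zero, of "u x" "u (x + z)" "?D x"]
    show "\<bar>u x * u (x + z) * ?D x\<bar> \<le> ((u x)\<^sup>2 * \<bar>F (s x + \<sigma> \<bullet> z) - F (s x)\<bar> + (u (x + z))\<^sup>2 * \<bar>?D x\<bar>) / 2"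
      unfolding abs_minus_commute[of "F (s x + \<sigma> \<bullet> z)"] abs_mult[of _ "?D x"] by (simp add: field_simps)
  qed
  also have "\<dots> = (H \<sigma> z + H (- \<sigma>) z) / 2"
    using integrable_H integrable_H_shift H_shift by (simp add: H_def[of \<sigma>])
  finally have 1: "\<bar>LINT x|lborel. u x * u (x + z) * ?D x\<bar> \<le> (H \<sigma> z + H (- \<sigma>) z) / 2" .
  have 2: "\<bar>\<sigma> \<bullet> z / 2 * Y\<bar> = 1 / 2 * \<bar>\<sigma> \<bullet> z\<bar> * Y"
    using Y_nonneg by (simp add: abs_mult)
  have "\<bar>\<sigma> \<bullet> z / 4 * B z\<bar> = \<bar>\<sigma> \<bullet> z\<bar> / 4 * B z"
    using B_nonneg by (simp add: abs_mult)
  also have "\<dots> \<le> \<bar>\<sigma> \<bullet> z\<bar> / 4 * (4 * Y)"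
    by (intro mult_left_mono B_le) auto
  finally have 3: "\<bar>\<sigma> \<bullet> z / 4 * B z\<bar> \<le> \<bar>\<sigma> \<bullet> z\<bar> * Y" by simp
  have "\<bar>a / 2 + b - c\<bar> \<le> h / 4 + 3 / 2 * y" if "\<bar>a\<bar> \<le> h / 2" "\<bar>b\<bar> = 1 / 2 * y" "\<bar>c\<bar> \<le> y" for a b c h y :: real
    using that by (auto simp: abs_le_iff abs_if split: if_splits)
  from this[OF 1 2[unfolded mult.assoc] 3] show ?thesis
    by (simp add: g_eq mult.assoc)
qed

text \<open>An algebraic identity after adding multiples of S(x + z) - S(x), whose integrals vanish.
  These additions turn squares at x + z into squares at x and combine the increments so that each
  summand contains one of the errors of \<open>jprim_local_estimates\<close>; with the prefactor
  \<sigma> \<bullet> z of the second summand, all three are of third order.\<close>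

lemma near_identity:
  "g z - \<sigma> \<bullet> z / 4 * B z = (LINT x|lborel.
      (u (x + z) - u x)\<^sup>2 * (F (s x + \<sigma> \<bullet> z) - F (s x) - \<sigma> \<bullet> z * (w (s x) * w (s x + \<sigma> \<bullet> z))) / 4
    - \<sigma> \<bullet> z * (u x)\<^sup>2 * w (s x) * (2 * w (s x) - w (s x + \<sigma> \<bullet> z) - w (s x - \<sigma> \<bullet> z)) / 4
    - (u x)\<^sup>2 * ((F (s x + \<sigma> \<bullet> z) - F (s x - \<sigma> \<bullet> z)) / 2 - \<sigma> \<bullet> z * jweight (2 * \<gamma>) (s x)) / 2)"
    (is "_ = (LINT x|lborel. ?P x)")
proof -
  define t where "t = \<sigma> \<bullet> z"
  have bw: "\<bar>w a * w b\<bar> \<le> 1" for a b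
    using mult_mono[OF w_bounded[of a] w_bounded[of b]] by (simp add: abs_mult)
  have w0: "\<bar>c * w a\<bar> \<le> \<bar>c\<bar>" for a c
    using mult_left_mono[OF w_bounded[of a] abs_ge_zero[of c]] by (simp add: abs_mult)
  note [measurable] = borel_measurable_jweight[of \<gamma>]
  \<comment> \<open>the two integrands that a translation by \<open>z\<close> turns into expressions at \<open>x\<close>\<close>
  define S1 where "S1 = (\<lambda>x. u x * u x * (F (s x - t) - F (s x)))"
  define S2 where "S2 = (\<lambda>x. u x * u x * (w (s x) * (w (s x) - w (s x - t))))"
  have [measurable]: "S1 \<in> borel_measurable borel" "S2 \<in> borel_measurable borel"
    unfolding S1_def S2_def by measurable
  have S1i: "integrable lborel S1"
    unfolding S1_def using int_uu[of "\<lambda>x. F (s x - t) - F (s x)" M 0 0] F_diff_bounded by simp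
  have b2: "\<bar>w a * (w a - w b)\<bar> \<le> 2" for a b
    using bw[of a a] bw[of a b] abs_triangle_ineq4[of "w a * w a" "w a * w b"] by (simp add: right_diff_distrib)
  have S2i: "integrable lborel S2"
    unfolding S2_def using int_uu[of "\<lambda>x. w (s x) * (w (s x) - w (s x - t))" 2 0 0] b2 by simp
  have shifts: "integrable lborel (\<lambda>x. S1 (x + z) - S1 x)" "(LINT x|lborel. S1 (x + z) - S1 x) = 0"
    "integrable lborel (\<lambda>x. S2 (x + z) - S2 x)" "(LINT x|lborel. S2 (x + z) - S2 x) = 0"
    using S1i S2i by (simp_all add: lborel_integrable_shift lborel_integral_shift)
  have i1: "integrable lborel (\<lambda>x. u x * u (x + z) * (F (s x) - F (s x + t)))"
    using int_uu[of "\<lambda>x. F (s x) - F (s x + t)" M 0 z] F_diff_bounded by simp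
  have "(LINT x|lborel. u x * u (x + z) * (F (s x) - F (s x + t)) / 2 + t / 2 * (v x)\<^sup>2 - t / 4 * (v (x + z) - v x)\<^sup>2
      - (S1 (x + z) - S1 x) / 4 + t / 4 * (S2 (x + z) - S2 x)) =
      (LINT x|lborel. u x * u (x + z) * (F (s x) - F (s x + t))) / 2 + t / 2 * Y - t / 4 * B z"
    using i1 shifts integrable_v_square integrable_v_diff[of z] by (simp add: Y_def B_def)
  also have "\<dots> = g z - t / 4 * B z"
    by (simp add: g_eq t_def)
  finally have "g z - t / 4 * B z = (LINT x|lborel. u x * u (x + z) * (F (s x) - F (s x + t)) / 2 + t / 2 * (v x)\<^sup>2
      - t / 4 * (v (x + z) - v x)\<^sup>2 - (S1 (x + z) - S1 x) / 4 + t / 4 * (S2 (x + z) - S2 x))" ..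
  also have "\<dots> = (LINT x|lborel. ?P x)"
  proof (intro Bochner_Integration.integral_cong refl)
    fix x
    have "S1 (x + z) = u (x + z) * u (x + z) * (F (s x) - F (s x + t))"
      "S2 (x + z) = u (x + z) * u (x + z) * (w (s x + t) * (w (s x + t) - w (s x)))"
      "v (x + z) = u (x + z) * w (s x + t)"
      by (simp_all add: S1_def S2_def v_def t_def inner_add_right add_ac)
    then show "u x * u (x + z) * (F (s x) - F (s x + t)) / 2 + t / 2 * (v x)\<^sup>2
      - t / 4 * (v (x + z) - v x)\<^sup>2 - (S1 (x + z) - S1 x) / 4 + t / 4 * (S2 (x + z) - S2 x) = ?P x"
      unfolding t_def[symmetric] S1_def S2_def v_def jweight_2\<gamma> power2_eq_square
      by (simp only:) (simp add: field_simps)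
  qed
  finally show ?thesis by (simp add: t_def)
qed

text \<open>The three summands of \<open>near_identity\<close> are bounded by the weight at x. The
  only square at x + z comes from (u(x + z) - u(x))^2, and comparing the weights at the two points
  supplies the further factor C, whence C^2.\<close>

lemma near_estimate:
  assumes t: "\<bar>\<sigma> \<bullet> z\<bar> \<le> T" and C: "C \<ge> 0"
    "\<And>s t. \<bar>t\<bar> \<le> T \<Longrightarrow>
      \<bar>(jprim \<gamma> (s + t) - jprim \<gamma> (s - t)) / 2 - t * jweight (2 * \<gamma>) s\<bar> \<le> C * \<bar>t\<bar> ^ 3 * jweight (2 * \<gamma>) s"
    "\<And>s t. \<bar>t\<bar> \<le> T \<Longrightarrow>
      \<bar>jprim \<gamma> (s + t) - jprim \<gamma> s - t * (jweight \<gamma> s * jweight \<gamma> (s + t))\<bar> \<le> C * \<bar>t\<bar> ^ 3 * jweight (2 * \<gamma>) s"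
    "\<And>s t. \<bar>t\<bar> \<le> T \<Longrightarrow>
      \<bar>2 * jweight \<gamma> s - jweight \<gamma> (s + t) - jweight \<gamma> (s - t)\<bar> \<le> C * t\<^sup>2 * jweight \<gamma> s"
    "\<And>s t. \<bar>t\<bar> \<le> T \<Longrightarrow> jweight (2 * \<gamma>) s \<le> C * jweight (2 * \<gamma>) (s + t)"
  shows "\<bar>g z - \<sigma> \<bullet> z / 4 * B z\<bar> \<le> (2 * C + C\<^sup>2) * \<bar>\<sigma> \<bullet> z\<bar> ^ 3 * Y"
proof -
  define t where "t = \<sigma> \<bullet> z"
  define K where "K = C * \<bar>t\<bar> ^ 3"
  have K: "K \<ge> 0" using C(1) by (simp add: K_def)
  have tT: "\<bar>t\<bar> \<le> T" using t by (simp add: t_def)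
  note near = near_identity[of z, folded t_def]
  let ?P1 = "\<lambda>x. (u (x + z) - u x)\<^sup>2 * (F (s x + t) - F (s x) - t * (w (s x) * w (s x + t))) / 4"
  let ?P2 = "\<lambda>x. t * (u x)\<^sup>2 * w (s x) * (2 * w (s x) - w (s x + t) - w (s x - t)) / 4"
  let ?P3 = "\<lambda>x. (u x)\<^sup>2 * ((F (s x + t) - F (s x - t)) / 2 - t * jweight (2 * \<gamma>) (s x)) / 2"
  have bound: "\<bar>?P1 x - ?P2 x - ?P3 x\<bar> \<le> (2 * K) * (v x)\<^sup>2 + (C * K) * (v (x + z))\<^sup>2" for x
  proof -
    have v2: "(v x)\<^sup>2 = (u x)\<^sup>2 * jweight (2 * \<gamma>) (s x)" "(v (x + z))\<^sup>2 = (u (x + z))\<^sup>2 * jweight (2 * \<gamma>) (s x + t)"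
      unfolding v_square by (simp_all add: power2_eq_square inner_add_right t_def add_ac)
    have j0: "jweight (2 * \<gamma>) (s x) \<ge> 0" by (rule jweight_nonneg)
    have "(a - b)\<^sup>2 \<le> 2 * a\<^sup>2 + 2 * b\<^sup>2" for a b :: real
      using zero_le_power2[of "a + b"] by (simp add: power2_eq_square algebra_simps)
    then have sq: "(u (x + z) - u x)\<^sup>2 \<le> 2 * (u (x + z))\<^sup>2 + 2 * (u x)\<^sup>2" .
    have "\<bar>?P1 x\<bar> = (u (x + z) - u x)\<^sup>2 * \<bar>F (s x + t) - F (s x) - t * (w (s x) * w (s x + t))\<bar> / 4"
      by (simp only: abs_mult abs_divide abs_power2 abs_numeral)
    also have "\<dots> \<le> (2 * (u (x + z))\<^sup>2 + 2 * (u x)\<^sup>2) * (K * jweight (2 * \<gamma>) (s x)) / 4"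
      unfolding K_def by (rule divide_right_mono[OF mult_mono[OF sq C(3)[OF tT]]]) auto
    also have "\<dots> = K / 2 * ((u (x + z))\<^sup>2 * jweight (2 * \<gamma>) (s x)) + K / 2 * (v x)\<^sup>2"
      by (simp add: v2 field_simps)
    also have "\<dots> \<le> K / 2 * (C * (v (x + z))\<^sup>2) + K / 2 * (v x)\<^sup>2"
    proof (intro add_right_mono mult_left_mono)
      show "(u (x + z))\<^sup>2 * jweight (2 * \<gamma>) (s x) \<le> C * (v (x + z))\<^sup>2"
        using mult_left_mono[OF C(5)[OF tT, of "s x"], of "(u (x + z))\<^sup>2"] by (simp add: v2 mult_ac)
    qed (use K in simp)
    finally have P1: "\<bar>?P1 x\<bar> \<le> K / 2 * (C * (v (x + z))\<^sup>2) + K / 2 * (v x)\<^sup>2" .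
    have "\<bar>?P2 x\<bar> = \<bar>t\<bar> * (u x)\<^sup>2 * w (s x) * \<bar>2 * w (s x) - w (s x + t) - w (s x - t)\<bar> / 4"
      by (simp add: abs_mult jweight_nonneg)
    also have "\<dots> \<le> \<bar>t\<bar> * (u x)\<^sup>2 * w (s x) * (C * t\<^sup>2 * w (s x)) / 4"
      using C(4)[OF tT, of "s x"] by (intro divide_right_mono mult_left_mono) (auto simp: jweight_nonneg)
    also have "\<dots> = K / 4 * (v x)\<^sup>2"
    proof -
      have "\<bar>t\<bar> ^ 3 = t\<^sup>2 * \<bar>t\<bar>"
        by (simp add: power3_eq_cube power2_eq_square)
      then show ?thesis
        unfolding K_def v2 jweight_2\<gamma> by (simp add: mult_ac)
    qed
    finally have P2: "\<bar>?P2 x\<bar> \<le> K / 4 * (v x)\<^sup>2" .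
    have "\<bar>?P3 x\<bar> = (u x)\<^sup>2 * \<bar>(F (s x + t) - F (s x - t)) / 2 - t * jweight (2 * \<gamma>) (s x)\<bar> / 2"
      by (simp add: abs_mult)
    also have "\<dots> \<le> (u x)\<^sup>2 * (K * jweight (2 * \<gamma>) (s x)) / 2"
      using C(2)[OF tT, of "s x"] unfolding K_def by (intro divide_right_mono mult_left_mono) auto
    also have "\<dots> = K / 2 * (v x)\<^sup>2"
      by (simp add: v2)
    finally have P3: "\<bar>?P3 x\<bar> \<le> K / 2 * (v x)\<^sup>2" .
    have nn: "0 \<le> K * (v x)\<^sup>2" "0 \<le> C * K * (v (x + z))\<^sup>2"
      using K C(1) by auto
    have "\<bar>?P1 x - ?P2 x - ?P3 x\<bar> \<le> \<bar>?P1 x\<bar> + \<bar>?P2 x\<bar> + \<bar>?P3 x\<bar>"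
      by linarith
    also have "\<dots> \<le> (K / 2 * (C * (v (x + z))\<^sup>2) + K / 2 * (v x)\<^sup>2) + K / 4 * (v x)\<^sup>2 + K / 2 * (v x)\<^sup>2"
      by (intro add_mono P1 P2 P3)
    also have "\<dots> \<le> (2 * K) * (v x)\<^sup>2 + (C * K) * (v (x + z))\<^sup>2"
      using nn by (simp add: field_simps)
    finally show ?thesis .
  qed
  have int: "integrable lborel (\<lambda>x. (2 * K) * (v x)\<^sup>2 + (C * K) * (v (x + z))\<^sup>2)"
    using integrable_v_square integrable_v_shift by auto
  have "\<bar>g z - t / 4 * B z\<bar> \<le> (LINT x|lborel. (2 * K) * (v x)\<^sup>2 + (C * K) * (v (x + z))\<^sup>2)"
    unfolding near real_norm_def[symmetric]
  proof (rule order_trans[OF integral_norm_bound], rule integral_mono[OF _ int])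
    show "integrable lborel (\<lambda>x. norm (?P1 x - ?P2 x - ?P3 x))"
    proof (rule Bochner_Integration.integrable_bound[OF int])
      show "AE x in lborel. norm (norm (?P1 x - ?P2 x - ?P3 x)) \<le> norm ((2 * K) * (v x)\<^sup>2 + (C * K) * (v (x + z))\<^sup>2)"
        unfolding real_norm_def abs_abs by (intro AE_I2 order_trans[OF bound abs_ge_self])
    qed measurable
    show "norm (?P1 x - ?P2 x - ?P3 x) \<le> (2 * K) * (v x)\<^sup>2 + (C * K) * (v (x + z))\<^sup>2" for x
      unfolding real_norm_def by (rule bound)
  qed
  also have "\<dots> = (2 * K) * Y + (C * K) * Y"
    using integrable_v_square integrable_v_shift integral_v_shift by (simp add: Y_def)
  also have "\<dots> = (2 * C + C\<^sup>2) * \<bar>t\<bar> ^ 3 * Y"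
    by (simp add: K_def power2_eq_square algebra_simps)
  finally show ?thesis by (simp add: t_def)
qed

end

section \<open>Rules for the Fourier transform and the L2 bound for its inverse\<close>

lemma fourier_shift:
  fixes f :: "real^'n::finite \<Rightarrow> complex"
  assumes [measurable]: "f \<in> borel_measurable borel"
  shows "fourier (\<lambda>x. f (x + z)) \<xi> = cis (z \<bullet> \<xi>) * fourier f \<xi>"
proof -
  have "fourier f \<xi> = (LINT x|lborel. (\<lambda>x. cis (- (x \<bullet> \<xi>)) * f x) (x + z))"
    unfolding fourier_def by (rule lborel_integral_shift[symmetric]) measurable
  also have "\<dots> = (LINT x|lborel. cis (- (z \<bullet> \<xi>)) * (cis (- (x \<bullet> \<xi>)) * f (x + z)))"
  proof (intro Bochner_Integration.integral_cong refl)
    fix x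
    have "cis (- ((x + z) \<bullet> \<xi>)) = cis (- (z \<bullet> \<xi>)) * cis (- (x \<bullet> \<xi>))"
      by (simp add: inner_add_left cis_mult algebra_simps)
    then show "cis (- ((x + z) \<bullet> \<xi>)) * f (x + z) = cis (- (z \<bullet> \<xi>)) * (cis (- (x \<bullet> \<xi>)) * f (x + z))"
      by (simp only: mult.assoc)
  qed
  also have "\<dots> = cis (- (z \<bullet> \<xi>)) * fourier (\<lambda>x. f (x + z)) \<xi>"
    by (simp add: fourier_def)
  finally have "cis (z \<bullet> \<xi>) * fourier f \<xi> = (cis (z \<bullet> \<xi>) * cis (- (z \<bullet> \<xi>))) * fourier (\<lambda>x. f (x + z)) \<xi>"
    by simp
  then show ?thesis
    by (simp only: cis_mult) simp
qed

lemma fourier_add: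
  assumes "integrable lborel f" "integrable lborel g"
  shows "fourier (\<lambda>x. f x + g x) \<xi> = fourier f \<xi> + fourier g \<xi>"
proof -
  have *: "integrable lborel (\<lambda>x. cis (- (x \<bullet> \<xi>)) * h x)" if "integrable lborel h" for h :: "real^'a \<Rightarrow> complex"
  proof (rule Bochner_Integration.integrable_bound[OF that])
    show "(\<lambda>x. cis (- (x \<bullet> \<xi>)) * h x) \<in> borel_measurable lborel"
      using borel_measurable_integrable[OF that] by measurable
  qed (simp add: norm_mult)
  show ?thesis
    unfolding fourier_def using *[OF assms(1)] *[OF assms(2)] by (simp add: distrib_left)
qed

lemma fourier_cmult: "fourier (\<lambda>x. c * f x) \<xi> = c * fourier f \<xi>"
  by (simp add: fourier_def mult.left_commute[of _ c])

lemma fourier_sum: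
  assumes "finite A" "\<And>j. j \<in> A \<Longrightarrow> integrable lborel (f j)"
  shows "fourier (\<lambda>x. \<Sum>j\<in>A. f j x) \<xi> = (\<Sum>j\<in>A. fourier (f j) \<xi>)"
  using assms
proof (induction A rule: finite_induct)
  case empty
  show ?case by (simp add: fourier_def)
next
  case (insert j A)
  then show ?case
    by (simp add: fourier_add Bochner_Integration.integrable_sum)
qed

lemma norm_cis_minus_one_square: "(norm (cis t - 1))\<^sup>2 = 2 * (1 - cos t)"
proof -
  have "(norm (cis t - 1))\<^sup>2 = (cos t - 1)\<^sup>2 + (sin t)\<^sup>2"
    by (simp add: cmod_power2)
  also have "\<dots> = 2 * (1 - cos t)"
    using sin_cos_squared_add[of t] by (simp add: power2_diff)
  finally show ?thesis .
qed

lemma inverse_fourier_eq: "inverse_fourier h x = fourier h (- x) / of_real ((2 * pi) ^ CARD('n))"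
  for h :: "real^'n::finite \<Rightarrow> complex"
  by (simp add: inverse_fourier_def fourier_def inner_commute)

text \<open>If the left integrand is integrable, Parseval gives equality; otherwise its integral is
  0 by convention and the bound is trivial. The inequality points in the direction that is wanted,
  because this quantity enters the theorem with the factor -c1.\<close>

lemma integral_inverse_fourier_square_le:
  fixes h :: "real^'n::finite \<Rightarrow> complex"
  assumes h: "integrable lborel h" and cont: "continuous_on UNIV h" and bound: "\<And>x. norm (h x) \<le> C"
  shows "(LINT x|lborel. (norm (inverse_fourier h x))\<^sup>2) \<le> (LINT \<xi>|lborel. (norm (h \<xi>))\<^sup>2) / (2 * pi) ^ CARD('n)"
proof -
  have [measurable]: "h \<in> borel_measurable borel"
    using h by (auto dest: borel_measurable_integrable)
  define c where "c = (2 * pi) ^ CARD('n)"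
  have c: "c > 0" by (simp add: c_def)
  have eq: "(LINT x|lborel. (norm (inverse_fourier h x))\<^sup>2) = (LINT x|lborel. (norm (fourier h x))\<^sup>2) / c\<^sup>2"
  proof -
    have "(LINT x|lborel. (norm (inverse_fourier h x))\<^sup>2) = (LINT x|lborel. (norm (fourier h (- x)))\<^sup>2 / c\<^sup>2)"
      unfolding inverse_fourier_eq c_def[symmetric]
      by (intro Bochner_Integration.integral_cong refl) (simp add: norm_divide power_divide)
    also have "\<dots> = (LINT x|lborel. (norm (fourier h x))\<^sup>2 / c\<^sup>2)"
      by (rule lborel_integral_uminus)
    finally show ?thesis by simp
  qed
  show ?thesis
  proof (cases "integrable lborel (\<lambda>x. (norm (fourier h x))\<^sup>2)")
    case True
    then have "integrable lborel (\<lambda>x. complex_of_real ((norm (fourier h x))\<^sup>2))"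
      by (rule integrable_of_real)
    then have int: "integrable lborel (\<lambda>x. fourier h x * cnj (fourier h x))"
      by (simp only: complex_norm_square)
    have "complex_of_real (LINT x|lborel. (norm (fourier h x))\<^sup>2) = (LINT x|lborel. fourier h x * cnj (fourier h x))"
      by (simp only: complex_norm_square integral_complex_of_real[symmetric])
    also have "\<dots> = c *\<^sub>R (LINT x|lborel. h x * cnj (h x))"
      unfolding c_def by (rule fourier_parseval[OF h h cont bound int])
    also have "\<dots> = complex_of_real (c * (LINT x|lborel. (norm (h x))\<^sup>2))"
      by (simp only: complex_norm_square scaleR_conv_of_real of_real_mult integral_complex_of_real[symmetric])
    finally have "(LINT x|lborel. (norm (fourier h x))\<^sup>2) = c * (LINT x|lborel. (norm (h x))\<^sup>2)"
      by (simp only: of_real_eq_iff)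
    then show ?thesis
      unfolding eq c_def[symmetric] using c by (simp add: power2_eq_square)
  next
    case False
    have "(LINT x|lborel. (norm (fourier h x))\<^sup>2) = 0"
      using False by (rule not_integrable_integral_eq)
    then show ?thesis
      unfolding eq c_def[symmetric] using c by (auto intro!: divide_nonneg_pos integral_nonneg_AE)
  qed
qed

context weighted_schwartz
begin

definition fu where "fu = fourier (\<lambda>x. complex_of_real (u x))"
definition fv where "fv = fourier (\<lambda>x. complex_of_real (v x))"
definition fw where "fw = fourier (\<lambda>x. complex_of_real (u x * F (s x)))"

text \<open>By Tonelli the tail estimate can be applied at r = \<sigma> \<bullet> x + \<omega> for
  each fixed x; the weight it produces turns u^2 into v^2.\<close>

lemma nn_integral_H_le:
  assumes D: "D \<ge> 0" "\<And>r. (\<integral>\<^sup>+z. ennreal (norm z powr - (real DIM(real^'n) + a + 1) *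
      \<bar>F (r + \<tau> \<bullet> z) - F r\<bar>) * indicator {z. 1 < norm z} z \<partial>lborel) \<le> ennreal (D * jweight (2 * \<gamma>) r)"
  shows "(\<integral>\<^sup>+z. ennreal (norm z powr - (real DIM(real^'n) + a + 1) * H \<tau> z) * indicator {z. 1 < norm z} z \<partial>lborel) \<le> ennreal (D * Y)"
proof -
  define p where "p = - (real DIM(real^'n) + a + 1)"
  define \<Phi> where "\<Phi> = (\<lambda>z x. ennreal (norm z powr p * \<bar>F (s x + \<tau> \<bullet> z) - F (s x)\<bar>) * indicator {z. 1 < norm z} z)"
  have [measurable]: "case_prod \<Phi> \<in> borel_measurable (borel \<Otimes>\<^sub>M borel)"
    unfolding \<Phi>_def by measurable
  have H: "ennreal (norm z powr p * H \<tau> z) * indicator {z. 1 < norm z} z = (\<integral>\<^sup>+x. ennreal ((u x)\<^sup>2) * \<Phi> z x \<partial>lborel)" for z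
  proof -
    have "ennreal (H \<tau> z) = (\<integral>\<^sup>+x. ennreal ((u x)\<^sup>2 * \<bar>F (s x + \<tau> \<bullet> z) - F (s x)\<bar>) \<partial>lborel)"
      unfolding H_def by (rule nn_integral_eq_integral[symmetric, OF integrable_H]) auto
    moreover have "H \<tau> z \<ge> 0"
      unfolding H_def by (intro integral_nonneg_AE) auto
    ultimately have "ennreal (norm z powr p * H \<tau> z) * indicator {z. 1 < norm z} z =
        (ennreal (norm z powr p) * indicator {z. 1 < norm z} z) * (\<integral>\<^sup>+x. ennreal ((u x)\<^sup>2 * \<bar>F (s x + \<tau> \<bullet> z) - F (s x)\<bar>) \<partial>lborel)"
      by (simp add: ennreal_mult mult_ac)
    also have "\<dots> = (\<integral>\<^sup>+x. (ennreal (norm z powr p) * indicator {z. 1 < norm z} z) * ennreal ((u x)\<^sup>2 * \<bar>F (s x + \<tau> \<bullet> z) - F (s x)\<bar>) \<partial>lborel)"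
      by (rule nn_integral_cmult[symmetric]) measurable
    also have "\<dots> = (\<integral>\<^sup>+x. ennreal ((u x)\<^sup>2) * \<Phi> z x \<partial>lborel)"
      by (intro nn_integral_cong) (simp add: \<Phi>_def ennreal_mult mult_ac)
    finally show ?thesis .
  qed
  have "(\<integral>\<^sup>+z. ennreal (norm z powr p * H \<tau> z) * indicator {z. 1 < norm z} z \<partial>lborel) =
      (\<integral>\<^sup>+z. \<integral>\<^sup>+x. ennreal ((u x)\<^sup>2) * \<Phi> z x \<partial>lborel \<partial>lborel)"
    by (simp only: H)
  also have "\<dots> = (\<integral>\<^sup>+x. \<integral>\<^sup>+z. ennreal ((u x)\<^sup>2) * \<Phi> z x \<partial>lborel \<partial>lborel)"
    by (rule lborel_pair.Fubini') measurable
  also have "\<dots> = (\<integral>\<^sup>+x. ennreal ((u x)\<^sup>2) * (\<integral>\<^sup>+z. \<Phi> z x \<partial>lborel) \<partial>lborel)"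
    by (intro nn_integral_cong nn_integral_cmult) measurable
  also have "\<dots> \<le> (\<integral>\<^sup>+x. ennreal (D * (v x)\<^sup>2) \<partial>lborel)"
  proof (rule nn_integral_mono)
    fix x
    have "ennreal ((u x)\<^sup>2) * (\<integral>\<^sup>+z. \<Phi> z x \<partial>lborel) \<le> ennreal ((u x)\<^sup>2) * ennreal (D * jweight (2 * \<gamma>) (s x))"
      unfolding \<Phi>_def p_def by (intro mult_left_mono D(2)) auto
    also have "\<dots> = ennreal (D * (v x)\<^sup>2)"
      unfolding v_square using D(1)
      by (subst ennreal_mult[symmetric]) (auto simp: jweight_nonneg power2_eq_square mult_ac)
    finally show "ennreal ((u x)\<^sup>2) * (\<integral>\<^sup>+z. \<Phi> z x \<partial>lborel) \<le> ennreal (D * (v x)\<^sup>2)" .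
  qed
  also have "\<dots> = ennreal (D * Y)"
    unfolding Y_def using integrable_v_square D(1)
    by (subst nn_integral_eq_integral) auto
  finally show ?thesis
    unfolding p_def .
qed

text \<open>Split at |z| = 1: inside, the cubic bound is absorbed by \<open>riesz_weight\<close>;
  outside, so is the linear term of \<open>far_estimate\<close>, while the increments are handled by
  the tail bound. The factor in front of \<open>Y\<close> involves neither u nor \<omega> once N and
  D are given.\<close>

lemma error_estimate:
  fixes e :: "real^'n"
  assumes a: "1 \<le> a" "a < 2"
    and N: "N \<ge> 0" "\<And>z. norm z \<le> 1 \<Longrightarrow> \<bar>g z - \<sigma> \<bullet> z / 4 * B z\<bar> \<le> N * \<bar>\<sigma> \<bullet> z\<bar> ^ 3 * Y"
    and D: "D \<ge> 0" "\<And>r \<tau>. \<tau> \<in> {\<sigma>, - \<sigma>} \<Longrightarrow> (\<integral>\<^sup>+z. ennreal (norm z powr - (real DIM(real^'n) + a + 1) *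
      \<bar>F (r + \<tau> \<bullet> z) - F r\<bar>) * indicator {z. 1 < norm z} z \<partial>lborel) \<le> ennreal (D * jweight (2 * \<gamma>) r)"
  shows "(\<integral>\<^sup>+z. ennreal \<bar>riesz_kernel a e z * (g z - \<sigma> \<bullet> z / 4 * B z)\<bar> \<partial>lborel) \<le>
    ennreal (norm e * ((N * norm \<sigma> ^ 3 + 2 * norm \<sigma>) * (LINT z|lborel. riesz_weight a (z :: real^'n)) + D) * Y)"
proof -
  define p where "p = - (real DIM(real^'n) + a + 1)"
  \<comment> \<open>The first summand serves |z| \<le> 1; the second rounds up the factor 3/2 of
    \<open>far_estimate\<close>.\<close>
  define A where "A = N * norm \<sigma> ^ 3 + 2 * norm \<sigma>"
  have A: "A \<ge> 0" using N(1) by (simp add: A_def)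
  have H0: "H \<tau> z \<ge> 0" for \<tau> z
    unfolding H_def by (intro integral_nonneg_AE) auto
  let ?J = "\<lambda>\<tau> z. ennreal (norm z powr p * H \<tau> z) * indicator {z. 1 < norm z} z"
  have pt: "ennreal \<bar>riesz_kernel a e z * (g z - \<sigma> \<bullet> z / 4 * B z)\<bar> \<le>
      ennreal (A * Y * norm e * riesz_weight a z) + ennreal (norm e / 4) * (?J \<sigma> z + ?J (- \<sigma>) z)" for z
  proof (cases "norm z \<le> 1")
    case True
    have "\<bar>\<sigma> \<bullet> z\<bar> ^ 3 \<le> (norm \<sigma> * norm z) ^ 3"
      by (intro power_mono Cauchy_Schwarz_ineq2) auto
    also have "\<dots> = norm \<sigma> ^ 3 * (min 1 ((norm z)\<^sup>2) * norm z)"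
    proof -
      have "(norm z)\<^sup>2 \<le> 1"
        using True by (intro power_le_one) auto
      then show ?thesis
        by (simp add: min_absorb2 power_mult_distrib power3_eq_cube power2_eq_square)
    qed
    finally have "N * \<bar>\<sigma> \<bullet> z\<bar> ^ 3 * Y \<le> N * (norm \<sigma> ^ 3 * (min 1 ((norm z)\<^sup>2) * norm z)) * Y"
      using N(1) Y_nonneg by (intro mult_left_mono mult_right_mono)
    also have "\<dots> = (N * norm \<sigma> ^ 3) * (Y * (min 1 ((norm z)\<^sup>2) * norm z))"
      by (simp add: mult_ac)
    also have "\<dots> \<le> A * (Y * (min 1 ((norm z)\<^sup>2) * norm z))"
      using Y_nonneg by (intro mult_right_mono) (auto simp: A_def)
    finally have "\<bar>g z - \<sigma> \<bullet> z / 4 * B z\<bar> \<le> (A * Y) * (min 1 ((norm z)\<^sup>2) * norm z)"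
      using N(2)[OF True] by (simp add: mult.assoc)
    from riesz_kernel_dominated[OF this, where a = a and \<eta> = e]
    have "\<bar>riesz_kernel a e z * (g z - \<sigma> \<bullet> z / 4 * B z)\<bar> \<le> A * Y * norm e * riesz_weight a z"
      using A Y_nonneg by (simp add: mult.commute[of "riesz_kernel a e z"])
    then have "ennreal \<bar>riesz_kernel a e z * (g z - \<sigma> \<bullet> z / 4 * B z)\<bar> \<le> ennreal (A * Y * norm e * riesz_weight a z)"
      by (rule ennreal_leI)
    then show ?thesis
      by (rule order_trans) simp
  next
    case False
    define q where "q = 3 / 2 * \<bar>\<sigma> \<bullet> z\<bar> * Y"
    have "\<bar>\<sigma> \<bullet> z\<bar> \<le> norm \<sigma> * norm z"
      by (rule Cauchy_Schwarz_ineq2)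
    moreover have "3 / 2 * norm \<sigma> \<le> A"
      using N(1) by (simp add: A_def)
    ultimately have "3 / 2 * \<bar>\<sigma> \<bullet> z\<bar> \<le> A * norm z"
      using mult_right_mono[of "3 / 2 * norm \<sigma>" A "norm z"] by (simp add: mult_ac)
    from mult_right_mono[OF this Y_nonneg] have "q \<le> A * Y * norm z"
      by (simp add: q_def mult_ac)
    moreover have "min 1 ((norm z)\<^sup>2) = 1"
      using False by (simp add: min_absorb1 one_le_power)
    moreover have "q \<ge> 0"
      using Y_nonneg by (simp add: q_def)
    ultimately have "\<bar>q\<bar> \<le> (A * Y) * (min 1 ((norm z)\<^sup>2) * norm z)"
      by simp
    from riesz_kernel_dominated[OF this, where a = a and \<eta> = e]
    have q: "\<bar>riesz_kernel a e z\<bar> * q \<le> A * Y * norm e * riesz_weight a z"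
      using A Y_nonneg \<open>q \<ge> 0\<close> by (simp add: abs_mult mult.commute)
    have "\<bar>riesz_kernel a e z * (g z - \<sigma> \<bullet> z / 4 * B z)\<bar> \<le> \<bar>riesz_kernel a e z\<bar> * ((H \<sigma> z + H (- \<sigma>) z) / 4 + q)"
      unfolding abs_mult q_def by (intro mult_left_mono far_estimate) auto
    also have "\<dots> = \<bar>riesz_kernel a e z\<bar> * ((H \<sigma> z + H (- \<sigma>) z) / 4) + \<bar>riesz_kernel a e z\<bar> * q"
      by (rule distrib_left)
    also have "\<dots> \<le> (norm e * norm z powr p) * ((H \<sigma> z + H (- \<sigma>) z) / 4) + A * Y * norm e * riesz_weight a z"
      unfolding p_def by (intro add_mono mult_right_mono riesz_kernel_le q divide_nonneg_pos add_nonneg_nonneg H0) auto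
    also have "\<dots> = A * Y * norm e * riesz_weight a z + norm e / 4 * (norm z powr p * H \<sigma> z + norm z powr p * H (- \<sigma>) z)"
      by (simp add: field_simps)
    finally have "ennreal \<bar>riesz_kernel a e z * (g z - \<sigma> \<bullet> z / 4 * B z)\<bar> \<le>
        ennreal (A * Y * norm e * riesz_weight a z + norm e / 4 * (norm z powr p * H \<sigma> z + norm z powr p * H (- \<sigma>) z))"
      by (rule ennreal_leI)
    also have "\<dots> = ennreal (A * Y * norm e * riesz_weight a z) + ennreal (norm e / 4) * (?J \<sigma> z + ?J (- \<sigma>) z)"
    proof -
      have eq: "ennreal (x + c * (y1 + y2)) = ennreal x + ennreal c * (ennreal y1 + ennreal y2)"
        if "x \<ge> 0" "c \<ge> 0" "y1 \<ge> 0" "y2 \<ge> 0" for x c y1 y2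
        using that by (simp add: ennreal_mult)
      have ind: "indicator {z. 1 < norm z} z = (1 :: ennreal)"
        using False by simp
      show ?thesis
        unfolding ind mult_1_right by (rule eq) (use A Y_nonneg H0 riesz_weight_nonneg[of a z] in \<open>auto intro!: mult_nonneg_nonneg\<close>)
    qed
    finally show ?thesis .
  qed
  have [measurable]: "H \<tau> \<in> borel_measurable borel" for \<tau>
  proof -
    have "(\<lambda>(z, x). (u x)\<^sup>2 * \<bar>F (s x + \<tau> \<bullet> z) - F (s x)\<bar>) \<in> borel_measurable (borel \<Otimes>\<^sub>M borel)"
      by measurable
    then have "(\<lambda>(z, x). (u x)\<^sup>2 * \<bar>F (s x + \<tau> \<bullet> z) - F (s x)\<bar>) \<in> borel_measurable (borel \<Otimes>\<^sub>M lborel)"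
      by (simp cong: measurable_cong_sets)
    from lborel.borel_measurable_lebesgue_integral[OF this] show ?thesis
      by (simp add: H_def[abs_def])
  qed
  have "(\<integral>\<^sup>+z. ennreal \<bar>riesz_kernel a e z * (g z - \<sigma> \<bullet> z / 4 * B z)\<bar> \<partial>lborel) \<le>
      (\<integral>\<^sup>+z. ennreal (A * Y * norm e * riesz_weight a z) + ennreal (norm e / 4) * (?J \<sigma> z + ?J (- \<sigma>) z) \<partial>lborel)"
    by (rule nn_integral_mono) (rule pt)
  also have "\<dots> = (\<integral>\<^sup>+z. ennreal (A * Y * norm e * riesz_weight a z) \<partial>(lborel :: (real^'n) measure)) +
      ennreal (norm e / 4) * ((\<integral>\<^sup>+z. ?J \<sigma> z \<partial>lborel) + (\<integral>\<^sup>+z. ?J (- \<sigma>) z \<partial>lborel))"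
    by (simp add: nn_integral_add nn_integral_cmult)
  also have "\<dots> \<le> ennreal (A * Y * norm e * (LINT z|lborel. riesz_weight a (z :: real^'n))) +
      ennreal (norm e / 4) * (ennreal (D * Y) + ennreal (D * Y))"
  proof (intro add_mono mult_left_mono)
    show "(\<integral>\<^sup>+z. ennreal (A * Y * norm e * riesz_weight a z) \<partial>(lborel :: (real^'n) measure)) \<le>
        ennreal (A * Y * norm e * (LINT z|lborel. riesz_weight a (z :: real^'n)))"
      using integrable_riesz_weight[OF a, where 'a = "real^'n"] A Y_nonneg
      by (subst nn_integral_eq_integral) (auto simp: riesz_weight_nonneg)
    show "(\<integral>\<^sup>+z. ?J \<sigma> z \<partial>lborel) \<le> ennreal (D * Y)" "(\<integral>\<^sup>+z. ?J (- \<sigma>) z \<partial>lborel) \<le> ennreal (D * Y)"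
      unfolding p_def by (rule nn_integral_H_le[OF D(1) D(2)], simp)+
  qed auto
  also have "\<dots> = ennreal (A * Y * norm e * (LINT z|lborel. riesz_weight a (z :: real^'n)) + norm e / 4 * (D * Y + D * Y))"
  proof -
    have "(LINT z|lborel. riesz_weight a (z :: real^'n)) \<ge> 0"
      by (intro integral_nonneg_AE) (simp add: riesz_weight_nonneg)
    then show ?thesis
      using A Y_nonneg D(1) by (simp add: ennreal_plus[symmetric] ennreal_mult[symmetric] del: ennreal_plus)
  qed
  also have "\<dots> \<le> ennreal (norm e * (A * (LINT z|lborel. riesz_weight a (z :: real^'n)) + D) * Y)"
  proof (rule ennreal_leI)
    have "0 \<le> norm e * (D * Y)"
      using D(1) Y_nonneg by simp
    then show "A * Y * norm e * (LINT z|lborel. riesz_weight a (z :: real^'n)) + norm e / 4 * (D * Y + D * Y) \<le>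
        norm e * (A * (LINT z|lborel. riesz_weight a (z :: real^'n)) + D) * Y"
      by (simp add: field_simps)
  qed
  finally show ?thesis
    by (simp add: A_def)
qed

end

section \<open>Passage to the frequency side\<close>

lemma schwartz_of_real_integrable: "schwartz f \<Longrightarrow> integrable lborel (\<lambda>x. complex_of_real (f x))"
  by (intro integrable_of_real schwartz_integrable)

lemma powr_le_one_plus_square:
  fixes r b :: real
  assumes "r \<ge> 0" "0 \<le> b" "b \<le> 2"
  shows "r powr b \<le> (1 + r)\<^sup>2"
proof -
  have "r powr b \<le> (1 + r) powr b"
    using assms by (intro powr_mono2) auto
  also have "\<dots> \<le> (1 + r) powr 2"
    using assms by (intro powr_mono) auto
  also have "\<dots> = (1 + r)\<^sup>2"
    using assms by simp
  finally show ?thesis .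
qed

context weighted_schwartz
begin

lemma integrable_fu: "integrable lborel (\<lambda>\<xi>. (1 + norm \<xi>) ^ m * norm (fu \<xi>))"
  unfolding fu_def by (rule integrable_fourier_schwartz[OF u])

lemma integrable_fv: "integrable lborel (\<lambda>\<xi>. (1 + norm \<xi>) ^ m * norm (fv \<xi>))"
  unfolding fv_def by (rule integrable_fourier_schwartz[OF schwartz_v])

lemma measurable_fourier_facts [measurable]:
  "fu \<in> borel_measurable borel" "fv \<in> borel_measurable borel" "fw \<in> borel_measurable borel"
  unfolding fu_def fv_def fw_def by measurable

lemma integrable_uF: "integrable lborel (\<lambda>x. u x * F (s x))"
proof (rule Bochner_Integration.integrable_bound)
  show "integrable lborel (\<lambda>x. M * \<bar>u x\<bar>)"
    using schwartz_integrable[OF u] by (intro integrable_mult_right integrable_abs)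
  show "AE x in lborel. norm (u x * F (s x)) \<le> norm (M * \<bar>u x\<bar>)"
  proof (rule AE_I2)
    fix x
    have "norm (u x * F (s x)) \<le> M * \<bar>u x\<bar>"
      using mult_right_mono[OF F_bounded[of "s x"], of "\<bar>u x\<bar>"] by (simp add: abs_mult mult.commute)
    then show "norm (u x * F (s x)) \<le> norm (M * \<bar>u x\<bar>)"
      unfolding real_norm_def by (rule order_trans[OF _ abs_ge_self])
  qed
qed measurable

lemma integrable_uF_complex: "integrable lborel (\<lambda>x. complex_of_real (u x * F (s x)))"
  using integrable_uF by (rule integrable_of_real)

definition Cw where "Cw = (LINT x|lborel. norm (complex_of_real (u x * F (s x))))"

lemma norm_fw_le: "norm (fw \<xi>) \<le> Cw"
  unfolding fw_def Cw_def by (rule norm_fourier_le)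

lemma Cw_nonneg: "Cw \<ge> 0"
  using norm_fw_le[of 0] norm_ge_zero order_trans by blast

definition Cv where "Cv = (LINT x|lborel. norm (complex_of_real (v x)))"

lemma norm_fv_le: "norm (fv \<xi>) \<le> Cv"
  unfolding fv_def Cv_def by (rule norm_fourier_le)

lemma norm_fv_square_le: "(norm (fv \<xi>))\<^sup>2 \<le> Cv * norm (fv \<xi>)"
  using mult_right_mono[OF norm_fv_le norm_ge_zero, of \<xi> "fv \<xi>"] by (simp add: power2_eq_square)

lemma integrable_fv_square: "integrable lborel (\<lambda>\<xi>. (1 + norm \<xi>)\<^sup>2 * (norm (fv \<xi>))\<^sup>2)"
proof (rule Bochner_Integration.integrable_bound)
  show "integrable lborel (\<lambda>\<xi>. Cv * ((1 + norm \<xi>)\<^sup>2 * norm (fv \<xi>)))"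
    using integrable_fv by (rule integrable_mult_right)
  show "AE \<xi> in lborel. norm ((1 + norm \<xi>)\<^sup>2 * (norm (fv \<xi>))\<^sup>2) \<le> norm (Cv * ((1 + norm \<xi>)\<^sup>2 * norm (fv \<xi>)))"
  proof (rule AE_I2)
    fix \<xi> :: "real^'n"
    have "(1 + norm \<xi>)\<^sup>2 * (norm (fv \<xi>))\<^sup>2 \<le> (1 + norm \<xi>)\<^sup>2 * (Cv * norm (fv \<xi>))"
      by (intro mult_left_mono norm_fv_square_le) auto
    also have "\<dots> = Cv * ((1 + norm \<xi>)\<^sup>2 * norm (fv \<xi>))"
      by (rule mult.left_commute)
    finally have "norm ((1 + norm \<xi>)\<^sup>2 * (norm (fv \<xi>))\<^sup>2) \<le> Cv * ((1 + norm \<xi>)\<^sup>2 * norm (fv \<xi>))"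
      by simp
    then show "norm ((1 + norm \<xi>)\<^sup>2 * (norm (fv \<xi>))\<^sup>2) \<le> norm (Cv * ((1 + norm \<xi>)\<^sup>2 * norm (fv \<xi>)))"
      unfolding real_norm_def by (rule order_trans[OF _ abs_ge_self])
  qed
qed measurable

text \<open>Parseval for a translation difference: its multiplier has squared modulus |e^(i z
  \<bullet> \<xi>) - 1|^2 = 2 (1 - cos (z \<bullet> \<xi>)).\<close>

lemma B_fourier: "(LINT \<xi>|lborel. 2 * (1 - cos (z \<bullet> \<xi>)) * (norm (fv \<xi>))\<^sup>2) = (2 * pi) ^ CARD('n) * B z"
proof -
  let ?f = "\<lambda>x. complex_of_real (v (x + z)) + complex_of_real (- 1) * complex_of_real (v x)"
  have vi: "integrable lborel (\<lambda>x. complex_of_real (v (x + z)))" "integrable lborel (\<lambda>x. complex_of_real (- 1) * complex_of_real (v x))"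
    using schwartz_of_real_integrable[OF schwartz_v]
      lborel_integrable_shift[of "\<lambda>x. complex_of_real (v x)" z] by auto
  have fi: "integrable lborel ?f"
    using vi by (rule Bochner_Integration.integrable_add)
  have "fourier ?f \<xi> = cis (z \<bullet> \<xi>) * fv \<xi> + complex_of_real (- 1) * fv \<xi>" for \<xi>
    unfolding fourier_add[OF vi] fourier_cmult fv_def
    using fourier_shift[of "\<lambda>x. complex_of_real (v x)" z \<xi>] by simp
  then have ff: "fourier ?f \<xi> = (cis (z \<bullet> \<xi>) - 1) * fv \<xi>" for \<xi>
    by (simp add: left_diff_distrib)
  have sq: "fourier ?f \<xi> * cnj (fourier ?f \<xi>) = complex_of_real (2 * (1 - cos (z \<bullet> \<xi>)) * (norm (fv \<xi>))\<^sup>2)" for \<xi>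
    unfolding complex_norm_square[symmetric] ff norm_mult power_mult_distrib norm_cis_minus_one_square by simp
  obtain C where C: "\<And>x. \<bar>v x\<bar> \<le> C"
    using schwartz_bounded[OF schwartz_v] by blast
  have int: "integrable lborel (\<lambda>\<xi>. 2 * (1 - cos (z \<bullet> \<xi>)) * (norm (fv \<xi>))\<^sup>2)"
  proof (rule Bochner_Integration.integrable_bound)
    show "integrable lborel (\<lambda>\<xi>. 4 * ((1 + norm \<xi>)\<^sup>2 * (norm (fv \<xi>))\<^sup>2))"
      using integrable_fv_square by (rule integrable_mult_right)
    show "AE \<xi> in lborel. norm (2 * (1 - cos (z \<bullet> \<xi>)) * (norm (fv \<xi>))\<^sup>2) \<le> norm (4 * ((1 + norm \<xi>)\<^sup>2 * (norm (fv \<xi>))\<^sup>2))"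
    proof (rule AE_I2)
      fix \<xi> :: "real^'n"
      have "2 * (1 - cos (z \<bullet> \<xi>)) \<le> 2 * 2"
        by (intro mult_left_mono one_minus_cos_le) auto
      also have "2 * 2 \<le> 4 * (1 + norm \<xi>)\<^sup>2"
        using one_le_power[of "1 + norm \<xi>" 2] by simp
      finally have "2 * (1 - cos (z \<bullet> \<xi>)) * (norm (fv \<xi>))\<^sup>2 \<le> 4 * (1 + norm \<xi>)\<^sup>2 * (norm (fv \<xi>))\<^sup>2"
        by (rule mult_right_mono) simp
      then show "norm (2 * (1 - cos (z \<bullet> \<xi>)) * (norm (fv \<xi>))\<^sup>2) \<le> norm (4 * ((1 + norm \<xi>)\<^sup>2 * (norm (fv \<xi>))\<^sup>2))"
        using one_minus_cos_le(3)[of "z \<bullet> \<xi>"] by (simp add: abs_mult mult.assoc)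
    qed
  qed measurable
  have "complex_of_real (LINT \<xi>|lborel. 2 * (1 - cos (z \<bullet> \<xi>)) * (norm (fv \<xi>))\<^sup>2) =
      (LINT \<xi>|lborel. fourier ?f \<xi> * cnj (fourier ?f \<xi>))"
    unfolding sq by (rule integral_complex_of_real[symmetric])
  also have "\<dots> = (2 * pi) ^ CARD('n) *\<^sub>R (LINT x|lborel. ?f x * cnj (?f x))"
  proof (rule fourier_parseval[OF fi fi])
    show "continuous_on UNIV ?f"
      by (intro continuous_intros continuous_on_compose2[OF schwartz_continuous[OF schwartz_v]]) auto
    show "norm (?f x) \<le> 2 * C" for x
    proof -
      have "?f x = complex_of_real (v (x + z) - v x)" by simp
      then have "norm (?f x) = \<bar>v (x + z) - v x\<bar>" by (simp only: norm_of_real)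
      then show ?thesis using C[of "x + z"] C[of x] by linarith
    qed
    show "integrable lborel (\<lambda>\<xi>. fourier ?f \<xi> * cnj (fourier ?f \<xi>))"
      unfolding sq using int by (rule integrable_of_real)
  qed
  also have "(\<lambda>x. ?f x * cnj (?f x)) = (\<lambda>x. complex_of_real ((v (x + z) - v x)\<^sup>2))"
    by (simp add: fun_eq_iff power2_eq_square)
  also have "(2 * pi) ^ CARD('n) *\<^sub>R (LINT x|lborel. complex_of_real ((v (x + z) - v x)\<^sup>2)) = complex_of_real ((2 * pi) ^ CARD('n) * B z)"
    unfolding B_def integral_complex_of_real scaleR_conv_of_real by simp
  finally show ?thesis
    by (simp only: of_real_eq_iff)
qed

text \<open>Parseval with all regularity on the side of u. For the transform of u \<Phi> only the
  bound \<open>Cw\<close> is used; the decay of \<open>fu\<close> alone makes the product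
  integrable.\<close>

lemma g_fourier:
  "(LINT \<xi>|lborel. complex_of_real (sin (z \<bullet> \<xi>) - z \<bullet> \<xi>) * (\<i> * fu \<xi> * cnj (fw \<xi>))) = complex_of_real ((2 * pi) ^ CARD('n) * g z)"
proof -
  let ?f1 = "\<lambda>x. (1 / 2) * complex_of_real (u (x + z))"
  let ?f2 = "\<lambda>x. (- 1 / 2) * complex_of_real (u (x + - z))"
  let ?f3 = "\<lambda>x. \<Sum>j\<in>UNIV. complex_of_real (- (z $ j)) * complex_of_real (partial_deriv j u x)"
  let ?f = "\<lambda>x. ?f1 x + (?f2 x + ?f3 x)"
  have i1: "integrable lborel ?f1" and i2: "integrable lborel ?f2"
    using schwartz_of_real_integrable[OF u]
      lborel_integrable_shift[of "\<lambda>x. complex_of_real (u x)" z] lborel_integrable_shift[of "\<lambda>x. complex_of_real (u x)" "- z"]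
    by (auto intro!: integrable_mult_right)
  have i3j: "integrable lborel (\<lambda>x. complex_of_real (- (z $ j)) * complex_of_real (partial_deriv j u x))" for j
    using schwartz_of_real_integrable[OF schwartz_partial_deriv[OF u]] by (rule integrable_mult_right)
  have i3: "integrable lborel ?f3"
    by (intro Bochner_Integration.integrable_sum i3j)
  have i23: "integrable lborel (\<lambda>x. ?f2 x + ?f3 x)"
    using i2 i3 by (rule Bochner_Integration.integrable_add)
  have fi: "integrable lborel ?f"
    using i1 i23 by (rule Bochner_Integration.integrable_add)
  have f_real: "?f x = complex_of_real ((u (x + z) - u (x - z)) / 2 - grad z x)" for x
    by (simp add: grad_def sum_negf field_simps)
  have ff: "fourier ?f \<xi> = complex_of_real (sin (z \<bullet> \<xi>) - z \<bullet> \<xi>) * (\<i> * fu \<xi>)" for \<xi>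
  proof -
    have "fourier ?f3 \<xi> = (\<Sum>j\<in>UNIV. complex_of_real (- (z $ j)) * (\<i> * of_real (\<xi> $ j) * fu \<xi>))"
      unfolding fourier_sum[OF finite i3j] fourier_cmult fourier_partial_deriv[OF u] fu_def ..
    also have "\<dots> = - complex_of_real (z \<bullet> \<xi>) * (\<i> * fu \<xi>)"
      by (simp add: inner_vec_def sum_distrib_left sum_distrib_right sum_negf mult_ac)
    finally have f3: "fourier ?f3 \<xi> = - complex_of_real (z \<bullet> \<xi>) * (\<i> * fu \<xi>)" .
    have "fourier ?f \<xi> = (1 / 2) * (cis (z \<bullet> \<xi>) * fu \<xi>) + ((- 1 / 2) * (cis (- z \<bullet> \<xi>) * fu \<xi>) + fourier ?f3 \<xi>)"
      unfolding fourier_add[OF i1 i23] fourier_add[OF i2 i3] fourier_cmult fu_def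
      using fourier_shift[of "\<lambda>x. complex_of_real (u x)" z \<xi>] fourier_shift[of "\<lambda>x. complex_of_real (u x)" "- z" \<xi>] by simp
    also have "\<dots> = ((cis (z \<bullet> \<xi>) - cis (- (z \<bullet> \<xi>))) / 2) * fu \<xi> - complex_of_real (z \<bullet> \<xi>) * (\<i> * fu \<xi>)"
      unfolding f3 by (simp add: field_simps)
    also have "(cis (z \<bullet> \<xi>) - cis (- (z \<bullet> \<xi>))) / 2 = \<i> * complex_of_real (sin (z \<bullet> \<xi>))"
      by (simp add: complex_eq_iff)
    finally show ?thesis
      by (simp add: algebra_simps)
  qed
  have int: "integrable lborel (\<lambda>\<xi>. fourier ?f \<xi> * cnj (fw \<xi>))"
  proof (rule Bochner_Integration.integrable_bound)
    show "integrable lborel (\<lambda>\<xi>. 2 * norm z * Cw * ((1 + norm \<xi>) ^ 1 * norm (fu \<xi>)))"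
      using integrable_fu by (rule integrable_mult_right)
    show "AE \<xi> in lborel. norm (fourier ?f \<xi> * cnj (fw \<xi>)) \<le> norm (2 * norm z * Cw * ((1 + norm \<xi>) ^ 1 * norm (fu \<xi>)))"
    proof (rule AE_I2)
      fix \<xi> :: "real^'n"
      have "\<bar>sin (z \<bullet> \<xi>) - z \<bullet> \<xi>\<bar> \<le> 2 * (norm z * norm \<xi>)"
        using abs_sin_diff_le(2)[of "z \<bullet> \<xi>"] Cauchy_Schwarz_ineq2[of z \<xi>] by linarith
      also have "\<dots> \<le> 2 * (norm z * (1 + norm \<xi>))"
        by (intro mult_left_mono) auto
      finally have "\<bar>sin (z \<bullet> \<xi>) - z \<bullet> \<xi>\<bar> * norm (fu \<xi>) * norm (fw \<xi>) \<le> 2 * (norm z * (1 + norm \<xi>)) * norm (fu \<xi>) * Cw"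
        using Cw_nonneg by (intro mult_mono norm_fw_le mult_right_mono) auto
      then have "norm (fourier ?f \<xi> * cnj (fw \<xi>)) \<le> 2 * norm z * Cw * ((1 + norm \<xi>) ^ 1 * norm (fu \<xi>))"
        unfolding ff norm_mult norm_of_real complex_mod_cnj norm_ii mult_1_left power_one_right
        by (simp only: mult_ac)
      then show "norm (fourier ?f \<xi> * cnj (fw \<xi>)) \<le> norm (2 * norm z * Cw * ((1 + norm \<xi>) ^ 1 * norm (fu \<xi>)))"
        by (rule order_trans) simp
    qed
    show "(\<lambda>\<xi>. fourier ?f \<xi> * cnj (fw \<xi>)) \<in> borel_measurable lborel"
      unfolding ff by measurable
  qed
  obtain C where C: "\<And>x. \<bar>u x\<bar> \<le> C"
    using schwartz_bounded[OF u] by blast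
  obtain D where D: "\<And>j x. \<bar>partial_deriv j u x\<bar> \<le> D j"
    using schwartz_bounded[OF schwartz_partial_deriv[OF u]] by metis
  have "(LINT \<xi>|lborel. fourier ?f \<xi> * cnj (fw \<xi>)) =
      (2 * pi) ^ CARD('n) *\<^sub>R (LINT x|lborel. ?f x * cnj (complex_of_real (u x * F (s x))))"
    unfolding fw_def
  proof (rule fourier_parseval[OF fi integrable_uF_complex])
    show "continuous_on UNIV ?f"
      by (intro continuous_intros continuous_on_compose2[OF schwartz_continuous[OF u]]
          schwartz_continuous[OF schwartz_partial_deriv[OF u]]) auto
    show "norm (?f x) \<le> C + (\<Sum>j\<in>UNIV. \<bar>z $ j\<bar> * D j)" for x
    proof -
      have "\<bar>grad z x\<bar> \<le> (\<Sum>j\<in>UNIV. \<bar>z $ j\<bar> * D j)"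
        unfolding grad_def by (rule order_trans[OF sum_abs]) (auto simp: abs_mult intro!: sum_mono mult_left_mono D)
      moreover have "\<bar>(u (x + z) - u (x - z)) / 2\<bar> \<le> C"
        using C[of "x + z"] C[of "x - z"] by (simp add: abs_le_iff field_simps)
      ultimately have "\<bar>(u (x + z) - u (x - z)) / 2 - grad z x\<bar> \<le> C + (\<Sum>j\<in>UNIV. \<bar>z $ j\<bar> * D j)"
        by linarith
      then show ?thesis
        unfolding f_real norm_of_real .
    qed
    show "integrable lborel (\<lambda>\<xi>. fourier ?f \<xi> * cnj (fourier (\<lambda>x. complex_of_real (u x * F (s x))) \<xi>))"
      using int unfolding fw_def .
  qed
  also have "\<dots> = complex_of_real ((2 * pi) ^ CARD('n) * g z)"
    unfolding f_real
    unfolding complex_cnj_complex_of_real of_real_mult[symmetric] integral_complex_of_real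
    by (simp add: g_def scaleR_conv_of_real)
  finally show ?thesis
    unfolding ff by (simp only: mult.assoc)
qed

end

section \<open>The pairing as a frequency integral\<close>

lemma integrable_cmult_cancel:
  fixes f :: "'a \<Rightarrow> real"
  assumes "b \<noteq> 0" "integrable M (\<lambda>x. b * f x)"
  shows "integrable M f"
  using integrable_mult_right[OF assms(2), of "inverse b"] assms(1) by (simp flip: mult.assoc)

context weighted_schwartz
begin

text \<open>The function |\<nabla>|^a u need not be a Schwartz function, since |\<xi>|^a is not
  smooth at 0. The derivative is therefore taken under the inversion integral, where the decay of
  \<open>fu\<close> absorbs the extra factor \<xi>_k.\<close>

lemma partial_abs_nabla:
  assumes a: "1 \<le> a" "a < 2"
  shows "partial_deriv k (abs_nabla a u) x =
    Re (LINT \<xi>|lborel. cis (x \<bullet> \<xi>) * (\<i> * of_real (\<xi> $ k * norm \<xi> powr a) * fu \<xi>)) / (2 * pi) ^ CARD('n)"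
proof -
  define m where "m = (\<lambda>\<xi>. complex_of_real (norm \<xi> powr a) * fu \<xi>)"
  have [measurable]: "m \<in> borel_measurable borel"
    unfolding m_def by measurable
  have m_le: "norm (m \<xi>) \<le> (1 + norm \<xi>)\<^sup>2 * norm (fu \<xi>)" for \<xi>
    unfolding m_def norm_mult norm_of_real using powr_le_one_plus_square[of "norm \<xi>" a] a
    by (intro mult_right_mono) auto
  have mi: "integrable lborel (\<lambda>\<xi>. cis (y \<bullet> \<xi>) * m \<xi>)" for y
  proof (rule Bochner_Integration.integrable_bound[OF integrable_fu[of 2]])
    show "AE \<xi> in lborel. norm (cis (y \<bullet> \<xi>) * m \<xi>) \<le> norm ((1 + norm \<xi>)\<^sup>2 * norm (fu \<xi>))"
      using m_le by (simp add: norm_mult)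
  qed measurable
  have nabla: "abs_nabla a u y = (LINT \<xi>|lborel. Re (cis (y \<bullet> \<xi>) * m \<xi>)) / (2 * pi) ^ CARD('n)" for y
  proof -
    have "abs_nabla a u y = Re ((LINT \<xi>|lborel. cis (y \<bullet> \<xi>) * m \<xi>) / of_real ((2 * pi) ^ CARD('n)))"
      by (simp add: abs_nabla_def fourier_multiplier_def inverse_fourier_def m_def fu_def)
    then show ?thesis
      by (simp only: Re_divide_of_real integral_Re[OF mi])
  qed
  define f where "f = (\<lambda>t \<xi>. Re (cis ((x + t *\<^sub>R axis k 1) \<bullet> \<xi>) * m \<xi>))"
  define f' where "f' = (\<lambda>t \<xi>. Re (cis ((x + t *\<^sub>R axis k 1) \<bullet> \<xi>) * (\<i> * of_real (\<xi> $ k) * m \<xi>)))"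
  have "((\<lambda>t. LINT \<xi>|lborel. f t \<xi>) has_real_derivative (LINT \<xi>|lborel. f' 0 \<xi>)) (at 0)"
  proof (rule has_real_derivative_integral)
    show "integrable lborel (f t)" for t
      unfolding f_def using mi by (rule integrable_Re)
    show "((\<lambda>t. f t \<xi>) has_real_derivative f' t \<xi>) (at t)" for t \<xi>
      unfolding f_def f'_def inner_add_left inner_scaleR_left inner_axis'
      by (auto intro!: derivative_eq_intros simp: algebra_simps)
    show "integrable lborel (\<lambda>\<xi>. (1 + norm \<xi>) ^ 3 * norm (fu \<xi>))"
      by (rule integrable_fu)
    show "\<bar>f' t \<xi>\<bar> \<le> (1 + norm \<xi>) ^ 3 * norm (fu \<xi>)" for t \<xi>
    proof -
      have "\<bar>f' t \<xi>\<bar> \<le> norm (cis ((x + t *\<^sub>R axis k 1) \<bullet> \<xi>) * (\<i> * of_real (\<xi> $ k) * m \<xi>))"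
        unfolding f'_def by (rule abs_Re_le_cmod)
      also have "\<dots> = \<bar>\<xi> $ k\<bar> * norm (m \<xi>)"
        by (simp add: norm_mult)
      also have "\<dots> \<le> (1 + norm \<xi>) * ((1 + norm \<xi>)\<^sup>2 * norm (fu \<xi>))"
        using component_le_norm_cart[of \<xi> k] by (intro mult_mono m_le) auto
      also have "\<dots> = (1 + norm \<xi>) ^ 3 * norm (fu \<xi>)"
        by (simp only: power3_eq_cube power2_eq_square mult.assoc)
      finally show ?thesis .
    qed
    show "f' 0 \<in> borel_measurable lborel"
      unfolding f'_def by measurable
  qed
  then have "((\<lambda>t. abs_nabla a u (x + t *\<^sub>R axis k 1)) has_real_derivative (LINT \<xi>|lborel. f' 0 \<xi>) / (2 * pi) ^ CARD('n)) (at 0)"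
    unfolding nabla f_def by (rule DERIV_cdivide)
  then have "partial_deriv k (abs_nabla a u) x = (LINT \<xi>|lborel. f' 0 \<xi>) / (2 * pi) ^ CARD('n)"
    unfolding partial_deriv_def by (rule DERIV_imp_deriv)
  also have "(LINT \<xi>|lborel. f' 0 \<xi>) =
      Re (LINT \<xi>|lborel. cis (x \<bullet> \<xi>) * (\<i> * of_real (\<xi> $ k * norm \<xi> powr a) * fu \<xi>))"
  proof -
    have "integrable lborel (\<lambda>\<xi>. cis (x \<bullet> \<xi>) * (\<i> * of_real (\<xi> $ k) * m \<xi>))"
    proof (rule Bochner_Integration.integrable_bound[OF integrable_fu[of 3]])
      show "AE \<xi> in lborel. norm (cis (x \<bullet> \<xi>) * (\<i> * of_real (\<xi> $ k) * m \<xi>)) \<le> norm ((1 + norm \<xi>) ^ 3 * norm (fu \<xi>))"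
      proof (rule AE_I2)
        fix \<xi> :: "real^'n"
        have "\<bar>\<xi> $ k\<bar> * norm (m \<xi>) \<le> (1 + norm \<xi>) * ((1 + norm \<xi>)\<^sup>2 * norm (fu \<xi>))"
          using component_le_norm_cart[of \<xi> k] by (intro mult_mono m_le) auto
        also have "\<dots> = (1 + norm \<xi>) ^ 3 * norm (fu \<xi>)"
          by (simp only: power3_eq_cube power2_eq_square mult.assoc)
        also have "\<dots> \<le> norm ((1 + norm \<xi>) ^ 3 * norm (fu \<xi>))"
          by simp
        finally show "norm (cis (x \<bullet> \<xi>) * (\<i> * of_real (\<xi> $ k) * m \<xi>)) \<le> norm ((1 + norm \<xi>) ^ 3 * norm (fu \<xi>))"
          by (simp add: norm_mult)
      qed
    qed measurable
    from integral_Re[OF this] show ?thesis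
      by (simp add: f'_def m_def mult.assoc)
  qed
  finally show ?thesis .
qed

text \<open>The operator is already given by an inversion integral, so Fubini alone moves the
  exponential onto u \<Phi> and produces the conjugate transform.\<close>

lemma pairing_fourier:
  assumes a: "1 \<le> a" "a < 2"
  shows "(LINT x|lborel. u x * F (s x) * partial_deriv k (abs_nabla a u) x) =
    Re (LINT \<xi>|lborel. (\<i> * of_real (\<xi> $ k * norm \<xi> powr a) * fu \<xi>) * cnj (fw \<xi>)) / (2 * pi) ^ CARD('n)"
proof -
  define G where "G = (\<lambda>\<xi>. \<i> * of_real (\<xi> $ k * norm \<xi> powr a) * fu \<xi>)"
  have [measurable]: "G \<in> borel_measurable borel"
    unfolding G_def by measurable
  have Gi: "integrable lborel G"
  proof (rule Bochner_Integration.integrable_bound[OF integrable_fu[of 3]])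
    show "AE \<xi> in lborel. norm (G \<xi>) \<le> norm ((1 + norm \<xi>) ^ 3 * norm (fu \<xi>))"
    proof (rule AE_I2)
      fix \<xi> :: "real^'n"
      have "\<bar>\<xi> $ k\<bar> * norm \<xi> powr a * norm (fu \<xi>) \<le> (1 + norm \<xi>) * (1 + norm \<xi>)\<^sup>2 * norm (fu \<xi>)"
        using component_le_norm_cart[of \<xi> k] powr_le_one_plus_square[of "norm \<xi>" a] a
        by (intro mult_mono) auto
      also have "(1 + norm \<xi>) * (1 + norm \<xi>)\<^sup>2 = (1 + norm \<xi>) ^ 3"
        by (simp only: power3_eq_cube power2_eq_square mult.assoc)
      finally have "norm (G \<xi>) \<le> (1 + norm \<xi>) ^ 3 * norm (fu \<xi>)"
        unfolding G_def norm_mult norm_of_real abs_mult by simp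
      then show "norm (G \<xi>) \<le> norm ((1 + norm \<xi>) ^ 3 * norm (fu \<xi>))"
        by (rule order_trans) simp
    qed
  qed measurable
  define W where "W = (\<lambda>x. complex_of_real (u x * F (s x)))"
  have [measurable]: "W \<in> borel_measurable borel"
    unfolding W_def by measurable
  have Wi: "integrable lborel W"
    unfolding W_def by (rule integrable_uF_complex)
  have Qi: "integrable (lborel \<Otimes>\<^sub>M lborel) (\<lambda>(x, \<xi>). W x * (cis (x \<bullet> \<xi>) * G \<xi>))"
    by (rule integrable_pair_dominated[where g = "\<lambda>x. norm (W x)" and h = "\<lambda>\<xi>. norm (G \<xi>)"])
       (use Wi Gi in \<open>auto simp: norm_mult\<close>)
  have inner: "(LINT x|lborel. W x * (cis (x \<bullet> \<xi>) * G \<xi>)) = G \<xi> * cnj (fw \<xi>)" for \<xi>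
  proof -
    have "cnj (fw \<xi>) = (LINT x|lborel. cis (x \<bullet> \<xi>) * W x)"
      unfolding fw_def fourier_def by (simp add: W_def cis_cnj flip: Bochner_Integration.integral_cnj)
    moreover have "(LINT x|lborel. W x * (cis (x \<bullet> \<xi>) * G \<xi>)) = (LINT x|lborel. G \<xi> * (cis (x \<bullet> \<xi>) * W x))"
      by (simp add: mult_ac)
    ultimately show ?thesis by simp
  qed
  have "(LINT x|lborel. u x * F (s x) * partial_deriv k (abs_nabla a u) x) =
      (LINT x|lborel. Re (LINT \<xi>|lborel. W x * (cis (x \<bullet> \<xi>) * G \<xi>)) / (2 * pi) ^ CARD('n))"
    unfolding partial_abs_nabla[OF a] by (simp add: W_def G_def)
  also have "\<dots> = (LINT x|lborel. Re (LINT \<xi>|lborel. W x * (cis (x \<bullet> \<xi>) * G \<xi>))) / (2 * pi) ^ CARD('n)"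
    by simp
  also have "(LINT x|lborel. Re (LINT \<xi>|lborel. W x * (cis (x \<bullet> \<xi>) * G \<xi>))) =
      Re (LINT x|lborel. (LINT \<xi>|lborel. W x * (cis (x \<bullet> \<xi>) * G \<xi>)))"
    using lborel_pair.integrable_fst[OF Qi] by (rule integral_Re)
  also have "(LINT x|lborel. (LINT \<xi>|lborel. W x * (cis (x \<bullet> \<xi>) * G \<xi>))) = (LINT \<xi>|lborel. G \<xi> * cnj (fw \<xi>))"
    using lborel_pair.Fubini_integral[OF Qi] unfolding inner by (rule sym)
  finally show ?thesis
    unfolding G_def .
qed

section \<open>Kernel representation of the pairing and of the leading form\<close>

context
  fixes a c :: real and k :: 'n and e :: "real^'n"
  assumes a: "1 \<le> a" "a < 2" and c: "c > 0"
    and symbol: "\<And>\<xi> \<eta> :: real^'n. riesz_symbol a \<xi> \<eta> = - c * (norm \<xi> powr a * (\<xi> \<bullet> \<eta>))"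
    and e: "e = axis k 1"
begin

lemma inner_e: "\<xi> \<bullet> e = \<xi> $ k" and norm_e: "norm e = 1"
  by (simp_all add: e inner_axis)

text \<open>One absolutely convergent double integral in \<xi> and z, evaluated in both orders.
  Integrating in \<xi> first gives the kernel times \<open>g\<close> by Parseval; integrating in z
  first gives the symbol of the kernel, a multiple -c of that of the operator.\<close>

lemma pairing_kernel:
  "integrable lborel (\<lambda>z. riesz_kernel a e z * g z)"
  "(LINT x|lborel. u x * F (s x) * partial_deriv k (abs_nabla a u) x) =
    - (1 / c) * (LINT z|lborel. riesz_kernel a e z * g z)"
proof -
  define Q where "Q = (\<lambda>\<xi> z. complex_of_real ((sin (z \<bullet> \<xi>) - z \<bullet> \<xi>) * riesz_kernel a e z) * (\<i> * fu \<xi> * cnj (fw \<xi>)))"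
  have Qi: "integrable (lborel \<Otimes>\<^sub>M lborel) (case_prod Q)"
  proof (rule integrable_pair_dominated[where g = "\<lambda>\<xi>. 2 * Cw * ((1 + norm \<xi>) ^ 3 * norm (fu \<xi>))" and h = "riesz_weight a"])
    show "case_prod Q \<in> borel_measurable (lborel \<Otimes>\<^sub>M lborel)"
      unfolding Q_def by measurable
    show "integrable lborel (\<lambda>\<xi>. 2 * Cw * ((1 + norm \<xi>) ^ 3 * norm (fu \<xi>)))"
      using integrable_fu by (rule integrable_mult_right)
    show "integrable lborel (riesz_weight a :: real^'n \<Rightarrow> real)"
      by (rule integrable_riesz_weight[OF a])
    show "norm (Q \<xi> z) \<le> 2 * Cw * ((1 + norm \<xi>) ^ 3 * norm (fu \<xi>)) * riesz_weight a z" for \<xi> z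
    proof -
      have "\<bar>(sin (z \<bullet> \<xi>) - z \<bullet> \<xi>) * riesz_kernel a e z\<bar> \<le> 2 * (1 + norm \<xi>) ^ 3 * norm e * riesz_weight a z"
        by (rule riesz_kernel_dominated[OF abs_sin_diff_inner_le]) simp
      then have "\<bar>(sin (z \<bullet> \<xi>) - z \<bullet> \<xi>) * riesz_kernel a e z\<bar> * (norm (fu \<xi>) * norm (fw \<xi>)) \<le>
          (2 * (1 + norm \<xi>) ^ 3 * riesz_weight a z) * (norm (fu \<xi>) * Cw)"
        by (intro mult_mono norm_fw_le) (auto simp: norm_e riesz_weight_nonneg)
      then show ?thesis
        unfolding Q_def norm_mult norm_of_real complex_mod_cnj norm_ii mult_1_left by (simp only: mult_ac)
    qed
  qed
  have z_int: "(LINT \<xi>|lborel. Q \<xi> z) = complex_of_real ((2 * pi) ^ CARD('n) * (riesz_kernel a e z * g z))" for z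
  proof -
    have "(LINT \<xi>|lborel. Q \<xi> z) =
        complex_of_real (riesz_kernel a e z) * (LINT \<xi>|lborel. complex_of_real (sin (z \<bullet> \<xi>) - z \<bullet> \<xi>) * (\<i> * fu \<xi> * cnj (fw \<xi>)))"
      unfolding Q_def integral_mult_right_zero[symmetric]
      by (intro Bochner_Integration.integral_cong refl) (simp only: of_real_mult mult_ac)
    then show ?thesis
      unfolding g_fourier by (simp add: mult_ac)
  qed
  have \<xi>_int: "(LINT z|lborel. Q \<xi> z) = complex_of_real (- c) * ((\<i> * of_real (\<xi> $ k * norm \<xi> powr a) * fu \<xi>) * cnj (fw \<xi>))" for \<xi>
  proof -
    have "(LINT z|lborel. Q \<xi> z) = complex_of_real (riesz_symbol a \<xi> e) * (\<i> * fu \<xi> * cnj (fw \<xi>))"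
      unfolding Q_def riesz_symbol_def integral_complex_of_real[symmetric] by simp
    then show ?thesis
      unfolding symbol inner_e by (simp add: mult_ac)
  qed
  have "integrable lborel (\<lambda>z. complex_of_real ((2 * pi) ^ CARD('n) * (riesz_kernel a e z * g z)))"
    using lborel_pair.integrable_snd[OF Qi] unfolding z_int .
  then have "integrable lborel (\<lambda>z. Re (complex_of_real ((2 * pi) ^ CARD('n) * (riesz_kernel a e z * g z))))"
    by (rule integrable_Re)
  then show "integrable lborel (\<lambda>z. riesz_kernel a e z * g z)"
    by simp
  have "complex_of_real ((2 * pi) ^ CARD('n) * (LINT z|lborel. riesz_kernel a e z * g z)) =
      (LINT z|lborel. (LINT \<xi>|lborel. Q \<xi> z))"
    unfolding z_int integral_complex_of_real by simp
  also have "\<dots> = (LINT \<xi>|lborel. (LINT z|lborel. Q \<xi> z))"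
    by (rule lborel_pair.Fubini_integral[OF Qi])
  also have "\<dots> = complex_of_real (- c) * (LINT \<xi>|lborel. (\<i> * of_real (\<xi> $ k * norm \<xi> powr a) * fu \<xi>) * cnj (fw \<xi>))"
    unfolding \<xi>_int by (rule integral_mult_right_zero)
  finally have "Re (complex_of_real ((2 * pi) ^ CARD('n) * (LINT z|lborel. riesz_kernel a e z * g z))) =
      Re (complex_of_real (- c) * (LINT \<xi>|lborel. (\<i> * of_real (\<xi> $ k * norm \<xi> powr a) * fu \<xi>) * cnj (fw \<xi>)))"
    by (rule arg_cong)
  moreover have "Re (complex_of_real r * x) = r * Re x" for r x
    by simp
  ultimately have "(2 * pi) ^ CARD('n) * (LINT z|lborel. riesz_kernel a e z * g z) =
      - c * Re (LINT \<xi>|lborel. (\<i> * of_real (\<xi> $ k * norm \<xi> powr a) * fu \<xi>) * cnj (fw \<xi>))"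
    by (simp only: Re_complex_of_real)
  then show "(LINT x|lborel. u x * F (s x) * partial_deriv k (abs_nabla a u) x) =
    - (1 / c) * (LINT z|lborel. riesz_kernel a e z * g z)"
    unfolding pairing_fourier[OF a] using c by (simp add: field_simps)
qed

text \<open>The same exchange for the leading form: the \<xi>-integral gives \<open>B\<close> by
  Parseval, and the z-integral gives the derivative of the symbol along \<sigma>. The 2 of the
  right-hand side comes from |e^(i t) - 1|^2 = 2 (1 - cos t).\<close>

lemma commutator_kernel:
  "integrable lborel (\<lambda>z. (\<sigma> \<bullet> z) * riesz_kernel a e z * B z)"
  "integrable lborel (\<lambda>\<xi>. (norm (fv \<xi>))\<^sup>2 * (norm \<xi> powr a * \<sigma> $ k + a * norm \<xi> powr (a - 2) * (\<xi> \<bullet> \<sigma>) * \<xi> $ k))"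
  "(2 * pi) ^ CARD('n) * (LINT z|lborel. (\<sigma> \<bullet> z) * riesz_kernel a e z * B z) =
    2 * c * (LINT \<xi>|lborel. (norm (fv \<xi>))\<^sup>2 * (norm \<xi> powr a * \<sigma> $ k + a * norm \<xi> powr (a - 2) * (\<xi> \<bullet> \<sigma>) * \<xi> $ k))"
proof -
  define R where "R = (\<lambda>\<xi> z. 2 * (norm (fv \<xi>))\<^sup>2 * ((1 - cos (z \<bullet> \<xi>)) * (\<sigma> \<bullet> z) * riesz_kernel a e z))"
  let ?m = "\<lambda>\<xi>. norm \<xi> powr a * \<sigma> $ k + a * norm \<xi> powr (a - 2) * (\<xi> \<bullet> \<sigma>) * \<xi> $ k"
  have Ri: "integrable (lborel \<Otimes>\<^sub>M lborel) (case_prod R)"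
  proof (rule integrable_pair_dominated[where g = "\<lambda>\<xi>. 4 * norm \<sigma> * ((1 + norm \<xi>)\<^sup>2 * (norm (fv \<xi>))\<^sup>2)" and h = "riesz_weight a"])
    show "case_prod R \<in> borel_measurable (lborel \<Otimes>\<^sub>M lborel)"
      unfolding R_def by measurable
    show "integrable lborel (\<lambda>\<xi>. 4 * norm \<sigma> * ((1 + norm \<xi>)\<^sup>2 * (norm (fv \<xi>))\<^sup>2))"
      using integrable_fv_square by (rule integrable_mult_right)
    show "integrable lborel (riesz_weight a :: real^'n \<Rightarrow> real)"
      by (rule integrable_riesz_weight[OF a])
    show "norm (R \<xi> z) \<le> 4 * norm \<sigma> * ((1 + norm \<xi>)\<^sup>2 * (norm (fv \<xi>))\<^sup>2) * riesz_weight a z" for \<xi> z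
    proof -
      have "\<bar>(1 - cos (z \<bullet> \<xi>)) * (\<sigma> \<bullet> z)\<bar> \<le> (2 * (1 + norm \<xi>) ^ 2 * min 1 ((norm z)\<^sup>2)) * (norm \<sigma> * norm z)"
        unfolding abs_mult abs_of_nonneg[OF one_minus_cos_le(3)]
        by (intro mult_mono one_minus_cos_inner_le Cauchy_Schwarz_ineq2) auto
      then have "\<bar>(1 - cos (z \<bullet> \<xi>)) * (\<sigma> \<bullet> z)\<bar> \<le> (2 * (1 + norm \<xi>)\<^sup>2 * norm \<sigma>) * (min 1 ((norm z)\<^sup>2) * norm z)"
        by (simp only: mult_ac)
      from riesz_kernel_dominated[OF this, where a = a and \<eta> = e]
      have "\<bar>(1 - cos (z \<bullet> \<xi>)) * (\<sigma> \<bullet> z) * riesz_kernel a e z\<bar> \<le> 2 * (1 + norm \<xi>)\<^sup>2 * norm \<sigma> * riesz_weight a z"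
        by (simp add: norm_e)
      then have "2 * (norm (fv \<xi>))\<^sup>2 * \<bar>(1 - cos (z \<bullet> \<xi>)) * (\<sigma> \<bullet> z) * riesz_kernel a e z\<bar> \<le>
          2 * (norm (fv \<xi>))\<^sup>2 * (2 * (1 + norm \<xi>)\<^sup>2 * norm \<sigma> * riesz_weight a z)"
        by (intro mult_left_mono) auto
      also have "\<dots> = 4 * norm \<sigma> * ((1 + norm \<xi>)\<^sup>2 * (norm (fv \<xi>))\<^sup>2) * riesz_weight a z"
        by simp
      finally show ?thesis
        unfolding R_def real_norm_def abs_mult[of "2 * (norm (fv \<xi>))\<^sup>2"] by simp
    qed
  qed
  have z_int: "(LINT \<xi>|lborel. R \<xi> z) = (2 * pi) ^ CARD('n) * ((\<sigma> \<bullet> z) * riesz_kernel a e z * B z)" for z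
  proof -
    have "(LINT \<xi>|lborel. R \<xi> z) = (\<sigma> \<bullet> z) * riesz_kernel a e z * (LINT \<xi>|lborel. 2 * (1 - cos (z \<bullet> \<xi>)) * (norm (fv \<xi>))\<^sup>2)"
      unfolding R_def integral_mult_right_zero[symmetric]
      by (intro Bochner_Integration.integral_cong refl) (simp only: mult_ac)
    then show ?thesis
      unfolding B_fourier by (simp only: mult_ac)
  qed
  have \<xi>_int: "(LINT z|lborel. R \<xi> z) = 2 * c * ((norm (fv \<xi>))\<^sup>2 * ?m \<xi>)" for \<xi>
  \<comment> \<open>The derivative formula excludes \<xi> = 0, where both sides vanish: the left
    because 1 - cos 0 = 0, the right because of its factors at the zero vector.\<close>
  proof (cases "\<xi> = 0")
    case False
    have "(LINT z|lborel. R \<xi> z) = 2 * (norm (fv \<xi>))\<^sup>2 * (LINT z|lborel. (1 - cos (z \<bullet> \<xi>)) * (\<sigma> \<bullet> z) * riesz_kernel a e z)"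
      unfolding R_def by (rule integral_mult_right_zero)
    then show ?thesis
      unfolding riesz_commutator_symbol[OF a symbol False] inner_e by (simp only: mult_ac)
  qed (simp add: R_def)
  have "integrable lborel (\<lambda>z. (2 * pi) ^ CARD('n) * ((\<sigma> \<bullet> z) * riesz_kernel a e z * B z))"
    using lborel_pair.integrable_snd[OF Ri] unfolding z_int .
  then show "integrable lborel (\<lambda>z. (\<sigma> \<bullet> z) * riesz_kernel a e z * B z)"
    by (rule integrable_cmult_cancel[rotated]) simp
  have "integrable lborel (\<lambda>\<xi>. 2 * c * ((norm (fv \<xi>))\<^sup>2 * ?m \<xi>))"
    using lborel_pair.integrable_fst[OF Ri] unfolding \<xi>_int .
  then show "integrable lborel (\<lambda>\<xi>. (norm (fv \<xi>))\<^sup>2 * ?m \<xi>)"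
    by (rule integrable_cmult_cancel[rotated]) (use c in simp)
  have "(LINT z|lborel. (LINT \<xi>|lborel. R \<xi> z)) = (LINT \<xi>|lborel. (LINT z|lborel. R \<xi> z))"
    by (rule lborel_pair.Fubini_integral[OF Ri])
  then show "(2 * pi) ^ CARD('n) * (LINT z|lborel. (\<sigma> \<bullet> z) * riesz_kernel a e z * B z) =
    2 * c * (LINT \<xi>|lborel. (norm (fv \<xi>))\<^sup>2 * ?m \<xi>)"
    unfolding z_int \<xi>_int by (simp only: integral_mult_right_zero)
qed

lemma abs_nabla_square_le:
  "(LINT x|lborel. \<bar>abs_nabla (a / 2) v x\<bar>\<^sup>2) \<le> (LINT \<xi>|lborel. norm \<xi> powr a * (norm (fv \<xi>))\<^sup>2) / (2 * pi) ^ CARD('n)"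
  "integrable lborel (\<lambda>\<xi>. norm \<xi> powr a * (norm (fv \<xi>))\<^sup>2)"
proof -
  define h where "h = (\<lambda>\<xi>. complex_of_real (norm \<xi> powr (a / 2)) * fv \<xi>)"
  have [measurable]: "h \<in> borel_measurable borel"
    unfolding h_def by measurable
  have h_le: "norm (h \<xi>) \<le> (1 + norm \<xi>)\<^sup>2 * norm (fv \<xi>)" for \<xi>
    unfolding h_def norm_mult norm_of_real using powr_le_one_plus_square[of "norm \<xi>" "a / 2"] a
    by (intro mult_right_mono) auto
  have sq: "(norm (h \<xi>))\<^sup>2 = norm \<xi> powr a * (norm (fv \<xi>))\<^sup>2" for \<xi>
  proof -
    have "(norm \<xi> powr (a / 2))\<^sup>2 = norm \<xi> powr a"
      unfolding power2_eq_square powr_add[symmetric] by simp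
    then show ?thesis
      unfolding h_def norm_mult power_mult_distrib by simp
  qed
  obtain C where C: "\<And>\<xi>. (1 + norm \<xi>)\<^sup>2 * norm (fv \<xi>) \<le> C"
    using fourier_rapid_decay[OF schwartz_v, of 2] unfolding fv_def by blast
  have eq: "\<bar>abs_nabla (a / 2) v x\<bar> = norm (inverse_fourier h x)" for x
  proof -
    have "complex_of_real (abs_nabla (a / 2) v x) = inverse_fourier h x"
      unfolding complex_of_real_abs_nabla fourier_multiplier_def h_def fv_def ..
    then show ?thesis
      by (metis norm_of_real)
  qed
  show "(LINT x|lborel. \<bar>abs_nabla (a / 2) v x\<bar>\<^sup>2) \<le> (LINT \<xi>|lborel. norm \<xi> powr a * (norm (fv \<xi>))\<^sup>2) / (2 * pi) ^ CARD('n)"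
    unfolding eq sq[symmetric]
  proof (rule integral_inverse_fourier_square_le)
    show "integrable lborel h"
      by (rule Bochner_Integration.integrable_bound[OF integrable_fv[of 2]]) (use h_le in auto)
    show "continuous_on UNIV h"
      unfolding h_def fv_def using a
      by (intro continuous_intros continuous_on_powr' continuous_fourier schwartz_of_real_integrable schwartz_v) auto
    show "norm (h \<xi>) \<le> C" for \<xi>
      using h_le C by (rule order_trans)
  qed
  show "integrable lborel (\<lambda>\<xi>. norm \<xi> powr a * (norm (fv \<xi>))\<^sup>2)"
  proof (rule Bochner_Integration.integrable_bound[OF integrable_fv_square])
    show "AE \<xi> in lborel. norm (norm \<xi> powr a * (norm (fv \<xi>))\<^sup>2) \<le> norm ((1 + norm \<xi>)\<^sup>2 * (norm (fv \<xi>))\<^sup>2)"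
      using powr_le_one_plus_square[of _ a] a by (auto simp: abs_mult intro!: AE_I2 mult_right_mono)
  qed measurable
qed

text \<open>The leading form enters the pairing with the factor -1/(4c) and equals 2c times its
  frequency integral up to the Parseval constant. So half of the symbol survives, which explains the
  factor 2 in the hypothesis on \<open>c1\<close>; the constant c remains only in the error.\<close>

lemma coercive_estimate:
  assumes N: "N \<ge> 0" "\<And>z. norm z \<le> 1 \<Longrightarrow> \<bar>g z - \<sigma> \<bullet> z / 4 * B z\<bar> \<le> N * \<bar>\<sigma> \<bullet> z\<bar> ^ 3 * Y"
    and D: "D \<ge> 0" "\<And>r \<tau>. \<tau> \<in> {\<sigma>, - \<sigma>} \<Longrightarrow> (\<integral>\<^sup>+z. ennreal (norm z powr - (real DIM(real^'n) + a + 1) *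
      \<bar>F (r + \<tau> \<bullet> z) - F r\<bar>) * indicator {z. 1 < norm z} z \<partial>lborel) \<le> ennreal (D * jweight (2 * \<gamma>) r)"
    and c1: "c1 \<ge> 0" "\<And>\<xi>. 2 * c1 * norm \<xi> powr a \<le> norm \<xi> powr a * \<sigma> $ k + a * norm \<xi> powr (a - 2) * (\<xi> \<bullet> \<sigma>) * \<xi> $ k"
  shows "(LINT x|lborel. u x * F (s x) * partial_deriv k (abs_nabla a u) x) \<le>
    - c1 * (LINT x|lborel. \<bar>abs_nabla (a / 2) v x\<bar>\<^sup>2) +
    ((N * norm \<sigma> ^ 3 + 2 * norm \<sigma>) * (LINT z|lborel. riesz_weight a (z :: real^'n)) + D) / c * Y"
proof -
  define E where "E = (N * norm \<sigma> ^ 3 + 2 * norm \<sigma>) * (LINT z|lborel. riesz_weight a (z :: real^'n)) + D"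
  have E: "E \<ge> 0"
    unfolding E_def using N(1) D(1)
    by (intro add_nonneg_nonneg mult_nonneg_nonneg integral_nonneg_AE) (auto simp: riesz_weight_nonneg)
  let ?k = "riesz_kernel a e"
  let ?X = "LINT x|lborel. \<bar>abs_nabla (a / 2) v x\<bar>\<^sup>2"
  let ?err = "\<lambda>z. ?k z * (g z - \<sigma> \<bullet> z / 4 * B z)"
  have err_eq: "?err z = ?k z * g z - 1 / 4 * ((\<sigma> \<bullet> z) * ?k z * B z)" for z
    by (simp add: algebra_simps)
  have erri: "integrable lborel ?err"
    unfolding err_eq using pairing_kernel(1) commutator_kernel(1) by auto
  have "ennreal (LINT z|lborel. \<bar>?err z\<bar>) = (\<integral>\<^sup>+z. ennreal \<bar>?err z\<bar> \<partial>lborel)"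
    by (rule nn_integral_eq_integral[symmetric]) (use erri in auto)
  also have "\<dots> \<le> ennreal (E * Y)"
    using error_estimate[OF a N D, of e] by (simp add: norm_e E_def)
  finally have "(LINT z|lborel. \<bar>?err z\<bar>) \<le> E * Y"
    using E Y_nonneg by (subst (asm) ennreal_le_iff) auto
  moreover have "- (LINT z|lborel. ?err z) \<le> (LINT z|lborel. \<bar>?err z\<bar>)"
    using integral_abs_bound[of lborel ?err] by linarith
  ultimately have err: "- (LINT z|lborel. ?err z) \<le> E * Y"
    by linarith
  have split: "(LINT z|lborel. ?k z * g z) = (LINT z|lborel. ?err z) + 1 / 4 * (LINT z|lborel. (\<sigma> \<bullet> z) * ?k z * B z)"
    unfolding err_eq using pairing_kernel(1) commutator_kernel(1) by simp
  have "2 * c1 * (LINT \<xi>|lborel. norm \<xi> powr a * (norm (fv \<xi>))\<^sup>2) \<le>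
      (LINT \<xi>|lborel. (norm (fv \<xi>))\<^sup>2 * (norm \<xi> powr a * \<sigma> $ k + a * norm \<xi> powr (a - 2) * (\<xi> \<bullet> \<sigma>) * \<xi> $ k))"
    unfolding integral_mult_right_zero[symmetric]
  proof (rule integral_mono[OF _ commutator_kernel(2)])
    show "integrable lborel (\<lambda>\<xi>. 2 * c1 * (norm \<xi> powr a * (norm (fv \<xi>))\<^sup>2))"
      using abs_nabla_square_le(2) by (rule integrable_mult_right)
    show "2 * c1 * (norm \<xi> powr a * (norm (fv \<xi>))\<^sup>2) \<le>
        (norm (fv \<xi>))\<^sup>2 * (norm \<xi> powr a * \<sigma> $ k + a * norm \<xi> powr (a - 2) * (\<xi> \<bullet> \<sigma>) * \<xi> $ k)" for \<xi>
      using mult_left_mono[OF c1(2)[of \<xi>] zero_le_power2[of "norm (fv \<xi>)"]] by (simp add: mult_ac)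
  qed
  then have "2 * c * (2 * c1 * (LINT \<xi>|lborel. norm \<xi> powr a * (norm (fv \<xi>))\<^sup>2)) \<le>
      (2 * pi) ^ CARD('n) * (LINT z|lborel. (\<sigma> \<bullet> z) * ?k z * B z)"
    unfolding commutator_kernel(3) using c by (intro mult_left_mono) auto
  moreover have "(2 * pi) ^ CARD('n) * (4 * c * c1 * ?X) \<le> 2 * c * (2 * c1 * (LINT \<xi>|lborel. norm \<xi> powr a * (norm (fv \<xi>))\<^sup>2))"
  proof -
    have "(2 * pi) ^ CARD('n) * ?X \<le> (LINT \<xi>|lborel. norm \<xi> powr a * (norm (fv \<xi>))\<^sup>2)"
      using abs_nabla_square_le(1) by (simp add: field_simps)
    then have "4 * c * c1 * ((2 * pi) ^ CARD('n) * ?X) \<le> 4 * c * c1 * (LINT \<xi>|lborel. norm \<xi> powr a * (norm (fv \<xi>))\<^sup>2)"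
      using c c1(1) by (intro mult_left_mono) auto
    then show ?thesis by (simp add: mult_ac)
  qed
  ultimately have "(2 * pi) ^ CARD('n) * (4 * c * c1 * ?X) \<le> (2 * pi) ^ CARD('n) * (LINT z|lborel. (\<sigma> \<bullet> z) * ?k z * B z)"
    by linarith
  then have "4 * c * c1 * ?X \<le> (LINT z|lborel. (\<sigma> \<bullet> z) * ?k z * B z)"
    by (rule mult_left_le_imp_le) simp
  with err split have "c * (c1 * ?X) - E * Y \<le> (LINT z|lborel. ?k z * g z)"
    by simp
  then have "- (1 / c) * (LINT z|lborel. ?k z * g z) \<le> - (1 / c) * (c * (c1 * ?X) - E * Y)"
    using c by (intro mult_left_mono_neg) auto
  also have "\<dots> = - c1 * ?X + E / c * Y"
    using c by (simp add: field_simps)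
  finally show ?thesis
    unfolding pairing_kernel(2) E_def .
qed

end

end

section \<open>The coercive estimate\<close>

lemma symbol_lower_bound:
  fixes \<sigma> \<xi> :: "real^'n::finite"
  assumes "2 * b * (norm \<xi>)\<^sup>2 \<le> (norm \<xi>)\<^sup>2 * \<sigma> $ k + a * (\<xi> \<bullet> \<sigma>) * \<xi> $ k"
  shows "2 * b * norm \<xi> powr a \<le> norm \<xi> powr a * \<sigma> $ k + a * norm \<xi> powr (a - 2) * (\<xi> \<bullet> \<sigma>) * \<xi> $ k"
proof (cases "\<xi> = 0")
  case False
  have "norm \<xi> powr a = norm \<xi> powr (a - 2) * (norm \<xi>)\<^sup>2"
  proof -
    have "norm \<xi> powr (a - 2) * (norm \<xi>)\<^sup>2 = norm \<xi> powr ((a - 2) + 2)"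
      using False unfolding powr_add by simp
    then show ?thesis by simp
  qed
  with mult_left_mono[OF assms powr_ge_zero[of "norm \<xi>" "a - 2"]] show ?thesis
    by (simp add: algebra_simps)
qed simp

text \<open>Without the mixed term the form is \<sigma>_k ((1 + a) \<xi>_k^2 + \<rho>^2), where
  \<rho> is the length of the other components of \<xi>. By Cauchy-Schwarz the mixed term is at most
  a \<rho> \<tau> |\<xi>_k|. Writing a = 2 \<theta> sqrt(1 + a) sqrt(a / (2 (1 + a))) with \<theta>
  = sqrt(a / 2) isolates the factor of the cone condition, and 2 x y \<le> x^2 + y^2 bounds the rest
  by \<theta> times the form without mixed term. The fraction 1 - \<theta> remains.\<close>

lemma quadratic_form_lower_bound:
  fixes \<sigma> \<xi> :: "real^'n::finite"
  assumes a: "1 \<le> a" "a \<le> 2"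
    and \<sigma>: "\<sigma> $ k > sqrt (a / (2 * (1 + a))) * sqrt (\<Sum>j\<in>UNIV - {k}. (\<sigma> $ j)\<^sup>2)"
  shows "(1 - sqrt (a / 2)) * \<sigma> $ k * (norm \<xi>)\<^sup>2 \<le> (norm \<xi>)\<^sup>2 * \<sigma> $ k + a * (\<xi> \<bullet> \<sigma>) * \<xi> $ k"
proof -
  define \<tau> where "\<tau> = sqrt (\<Sum>j\<in>UNIV - {k}. (\<sigma> $ j)\<^sup>2)"
  define \<rho> where "\<rho> = sqrt (\<Sum>j\<in>UNIV - {k}. (\<xi> $ j)\<^sup>2)"
  define m where "m = (\<Sum>j\<in>UNIV - {k}. \<xi> $ j * \<sigma> $ j)"
  define \<theta> where "\<theta> = sqrt (a / 2)"
  have nonneg: "\<tau> \<ge> 0" "\<rho> \<ge> 0" "\<theta> \<ge> 0"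
    using a by (simp_all add: \<tau>_def \<rho>_def \<theta>_def sum_nonneg)
  have \<sigma>k: "\<sigma> $ k \<ge> 0"
    using \<sigma> a by (smt (verit) mult_nonneg_nonneg real_sqrt_ge_zero sum_nonneg zero_le_power2 divide_nonneg_pos)
  have norm2: "(norm \<xi>)\<^sup>2 = (\<xi> $ k)\<^sup>2 + \<rho>\<^sup>2"
  proof -
    have "(norm \<xi>)\<^sup>2 = (\<Sum>j\<in>UNIV. (\<xi> $ j)\<^sup>2)"
      unfolding power2_norm_eq_inner inner_vec_def by (simp add: power2_eq_square)
    also have "\<dots> = (\<xi> $ k)\<^sup>2 + (\<Sum>j\<in>UNIV - {k}. (\<xi> $ j)\<^sup>2)"
      by (rule sum.remove) auto
    finally show ?thesis
      by (simp add: \<rho>_def sum_nonneg)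
  qed
  have inner: "\<xi> \<bullet> \<sigma> = \<xi> $ k * \<sigma> $ k + m"
    unfolding inner_vec_def m_def by (subst sum.remove[of _ k]) auto
  have "\<bar>m\<bar> \<le> (\<Sum>j\<in>UNIV - {k}. \<bar>\<xi> $ j\<bar> * \<bar>\<sigma> $ j\<bar>)"
    unfolding m_def by (rule order_trans[OF sum_abs]) (simp add: abs_mult)
  also have "\<dots> \<le> \<rho> * \<tau>"
    using L2_set_mult_ineq[of "\<lambda>j. \<xi> $ j" "\<lambda>j. \<sigma> $ j" "UNIV - {k}"] by (simp add: L2_set_def \<rho>_def \<tau>_def)
  finally have m: "\<bar>m\<bar> \<le> \<rho> * \<tau>" .
  have a_eq: "a = 2 * \<theta> * sqrt (1 + a) * sqrt (a / (2 * (1 + a)))"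
  proof -
    have "\<theta> * sqrt (1 + a) * sqrt (a / (2 * (1 + a))) = sqrt ((a / 2) * (1 + a) * (a / (2 * (1 + a))))"
      by (simp only: \<theta>_def real_sqrt_mult)
    also have "(a / 2) * (1 + a) * (a / (2 * (1 + a))) = (a / 2)\<^sup>2"
    proof -
      have eq: "(a / 2) * b * (a / (2 * b)) = (a / 2)\<^sup>2" if "b \<noteq> 0" for b
        using that by (simp add: power2_eq_square)
      show ?thesis
        by (rule eq) (use a in simp)
    qed
    finally show ?thesis
      using a by simp
  qed
  have "a * (\<rho> * \<tau>) * \<bar>\<xi> $ k\<bar> = 2 * \<theta> * sqrt (1 + a) * \<rho> * \<bar>\<xi> $ k\<bar> * (sqrt (a / (2 * (1 + a))) * \<tau>)"
    by (subst a_eq) (simp only: mult_ac)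
  also have "\<dots> \<le> 2 * \<theta> * sqrt (1 + a) * \<rho> * \<bar>\<xi> $ k\<bar> * \<sigma> $ k"
    using \<sigma> nonneg a unfolding \<tau>_def[symmetric] by (intro mult_left_mono mult_nonneg_nonneg) auto
  also have "\<dots> = \<theta> * \<sigma> $ k * (2 * (sqrt (1 + a) * \<bar>\<xi> $ k\<bar>) * \<rho>)"
    by (simp only: mult_ac)
  also have "\<dots> \<le> \<theta> * \<sigma> $ k * ((sqrt (1 + a) * \<bar>\<xi> $ k\<bar>)\<^sup>2 + \<rho>\<^sup>2)"
    using nonneg \<sigma>k zero_le_power2[of "sqrt (1 + a) * \<bar>\<xi> $ k\<bar> - \<rho>"]
    by (intro mult_left_mono) (auto simp: power2_diff)
  also have "(sqrt (1 + a) * \<bar>\<xi> $ k\<bar>)\<^sup>2 = (1 + a) * (\<xi> $ k)\<^sup>2"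
    using a by (simp add: power_mult_distrib)
  finally have cross: "a * (\<rho> * \<tau>) * \<bar>\<xi> $ k\<bar> \<le> \<theta> * \<sigma> $ k * ((1 + a) * (\<xi> $ k)\<^sup>2 + \<rho>\<^sup>2)" .
  have "\<bar>a * m * \<xi> $ k\<bar> \<le> a * (\<rho> * \<tau>) * \<bar>\<xi> $ k\<bar>"
    unfolding abs_mult using m a by (intro mult_right_mono mult_mono) auto
  with cross have lower: "- (a * m * \<xi> $ k) \<le> \<theta> * \<sigma> $ k * ((1 + a) * (\<xi> $ k)\<^sup>2 + \<rho>\<^sup>2)"
    by linarith
  have "\<theta> \<le> 1"
    using a by (simp add: \<theta>_def)
  then have "0 \<le> (1 - \<theta>) * \<sigma> $ k * (a * (\<xi> $ k)\<^sup>2)"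
    using \<sigma>k a by (intro mult_nonneg_nonneg) auto
  with lower show ?thesis
    unfolding norm2 inner \<theta>_def[symmetric] by (simp add: algebra_simps power2_eq_square)
qed

text \<open>An arbitrary index \<open>k\<close> plays the part of the first coordinate. The
  constants are fixed before \<omega> and u are introduced, which expresses that they depend on the
  remaining data only.\<close>

theorem lemma1p1:
  fixes \<alpha> \<gamma> :: real and \<sigma> :: "real^'n::finite" and k :: 'n
  assumes "1 \<le> \<alpha>" "\<alpha> < 2"
    and "1 / 2 < \<gamma>" "\<gamma> \<le> (\<alpha> + 1) / 2"
    and "\<sigma> $ k > sqrt (\<alpha> / (2 * (1 + \<alpha>))) * sqrt (\<Sum>j\<in>UNIV - {k}. (\<sigma> $ j)\<^sup>2)"
  shows
    "let admissible = (\<lambda>c\<^sub>1 :: real. \<exists>c\<^sub>2 > 0. \<forall>\<omega> :: real. \<forall>u :: real^'n \<Rightarrow> real. schwartz u \<longrightarrow>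
           (LINT x|lborel. u x * weight_varphi \<gamma> \<omega> \<sigma> x * partial_deriv k (abs_nabla \<alpha> u) x)
           \<le> - c\<^sub>1 * (LINT x|lborel. \<bar>abs_nabla (\<alpha> / 2) (\<lambda>y. u y * weight_phi \<gamma> \<omega> \<sigma> y) x\<bar>\<^sup>2)
             + c\<^sub>2 * (LINT x|lborel. (u x)\<^sup>2 * (weight_phi \<gamma> \<omega> \<sigma> x)\<^sup>2))
     in (\<exists>c\<^sub>1 > 0. admissible c\<^sub>1)
        \<and> (CARD('n) = 1 \<longrightarrow> admissible ((\<alpha> + 1) / 2 * \<sigma> $ k))
        \<and> (CARD('n) \<ge> 2 \<and> (\<forall>j. j \<noteq> k \<longrightarrow> \<sigma> $ j = 0) \<longrightarrow> admissible (\<sigma> $ k / 2))"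
proof -
  define admissible where "admissible = (\<lambda>c\<^sub>1 :: real. \<exists>c\<^sub>2 > 0. \<forall>\<omega> :: real. \<forall>u :: real^'n \<Rightarrow> real. schwartz u \<longrightarrow>
           (LINT x|lborel. u x * weight_varphi \<gamma> \<omega> \<sigma> x * partial_deriv k (abs_nabla \<alpha> u) x)
           \<le> - c\<^sub>1 * (LINT x|lborel. \<bar>abs_nabla (\<alpha> / 2) (\<lambda>y. u y * weight_phi \<gamma> \<omega> \<sigma> y) x\<bar>\<^sup>2)
             + c\<^sub>2 * (LINT x|lborel. (u x)\<^sup>2 * (weight_phi \<gamma> \<omega> \<sigma> x)\<^sup>2))"
  obtain c where c: "c > 0" "\<And>\<xi> \<eta> :: real^'n. riesz_symbol \<alpha> \<xi> \<eta> = - c * (norm \<xi> powr \<alpha> * (\<xi> \<bullet> \<eta>))"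
    using riesz_symbol_eq[OF assms(1,2), where 'n = 'n] by blast
  \<comment> \<open>The range \<open>norm \<sigma>\<close> is what |\<sigma> \<bullet> z| can reach
    on the unit ball.\<close>
  obtain C where C: "C \<ge> 0"
    "\<And>s t. \<bar>t\<bar> \<le> norm \<sigma> \<Longrightarrow>
      \<bar>(jprim \<gamma> (s + t) - jprim \<gamma> (s - t)) / 2 - t * jweight (2 * \<gamma>) s\<bar> \<le> C * \<bar>t\<bar> ^ 3 * jweight (2 * \<gamma>) s"
    "\<And>s t. \<bar>t\<bar> \<le> norm \<sigma> \<Longrightarrow>
      \<bar>jprim \<gamma> (s + t) - jprim \<gamma> s - t * (jweight \<gamma> s * jweight \<gamma> (s + t))\<bar> \<le> C * \<bar>t\<bar> ^ 3 * jweight (2 * \<gamma>) s"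
    "\<And>s t. \<bar>t\<bar> \<le> norm \<sigma> \<Longrightarrow>
      \<bar>2 * jweight \<gamma> s - jweight \<gamma> (s + t) - jweight \<gamma> (s - t)\<bar> \<le> C * t\<^sup>2 * jweight \<gamma> s"
    "\<And>s t. \<bar>t\<bar> \<le> norm \<sigma> \<Longrightarrow> jweight (2 * \<gamma>) s \<le> C * jweight (2 * \<gamma>) (s + t)"
    using jprim_local_estimates[OF assms(3), of "norm \<sigma>"] by blast
  have \<alpha>: "\<alpha> > 0" "2 * \<gamma> \<le> \<alpha> + 1"
    using assms by auto
  let ?I = "\<lambda>\<tau> r. \<integral>\<^sup>+z. ennreal (norm z powr - (real DIM(real^'n) + \<alpha> + 1) *
      \<bar>jprim \<gamma> (r + \<tau> \<bullet> z) - jprim \<gamma> r\<bar>) * indicator {z. 1 < norm z} z \<partial>lborel"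
  obtain D1 where D1: "D1 \<ge> 0" "\<And>r. ?I \<sigma> r \<le> ennreal (D1 * jweight (2 * \<gamma>) r)"
    using jprim_tail_estimate[OF assms(3) \<alpha>, of \<sigma>] by blast
  obtain D2 where D2: "D2 \<ge> 0" "\<And>r. ?I (- \<sigma>) r \<le> ennreal (D2 * jweight (2 * \<gamma>) r)"
    using jprim_tail_estimate[OF assms(3) \<alpha>, of "- \<sigma>"] by blast
  define N where "N = 2 * C + C\<^sup>2"
  define D where "D = D1 + D2"
  have N: "N \<ge> 0" and D0: "D \<ge> 0"
    using C(1) D1(1) D2(1) by (simp_all add: N_def D_def)
  have D: "?I \<tau> r \<le> ennreal (D * jweight (2 * \<gamma>) r)" if "\<tau> \<in> {\<sigma>, - \<sigma>}" for \<tau> r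
  proof -
    have "ennreal (D1 * jweight (2 * \<gamma>) r) \<le> ennreal (D * jweight (2 * \<gamma>) r)"
      "ennreal (D2 * jweight (2 * \<gamma>) r) \<le> ennreal (D * jweight (2 * \<gamma>) r)"
      unfolding D_def using D1(1) D2(1) by (intro ennreal_leI mult_right_mono jweight_nonneg; simp)+
    then show ?thesis
      using that D1(2)[of r] D2(2)[of r] by (auto intro: order_trans)
  qed
  define E where "E = ((N * norm \<sigma> ^ 3 + 2 * norm \<sigma>) * (LINT z|lborel. riesz_weight \<alpha> (z :: real^'n)) + D) / c"
  have E: "E \<ge> 0"
    unfolding E_def using N D0 c(1)
    by (intro divide_nonneg_pos add_nonneg_nonneg mult_nonneg_nonneg integral_nonneg_AE) (auto simp: riesz_weight_nonneg)
  have admissibleI: "admissible b"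
    if b: "b \<ge> 0" "\<And>\<xi>. 2 * b * (norm \<xi>)\<^sup>2 \<le> (norm \<xi>)\<^sup>2 * \<sigma> $ k + \<alpha> * (\<xi> \<bullet> \<sigma>) * \<xi> $ k" for b
    unfolding admissible_def
  \<comment> \<open>\<open>E\<close> is only known to be nonnegative, and a positive constant is
    wanted.\<close>
  proof (intro exI[of _ "E + 1"] conjI allI impI)
    show "E + 1 > 0" using E by simp
    fix \<omega> :: real and u :: "real^'n \<Rightarrow> real"
    assume u: "schwartz u"
    interpret weighted_schwartz \<gamma> \<omega> \<sigma> u
      using assms(3) u by unfold_locales
    have v: "(\<lambda>y. u y * weight_phi \<gamma> \<omega> \<sigma> y) = v"
      by (simp add: fun_eq_iff v_def weight_phi_eq)
    have Y: "(LINT x|lborel. (u x)\<^sup>2 * (weight_phi \<gamma> \<omega> \<sigma> x)\<^sup>2) = Y"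
      by (simp add: Y_def v_def weight_phi_eq power_mult_distrib)
    have near: "\<bar>g z - \<sigma> \<bullet> z / 4 * B z\<bar> \<le> N * \<bar>\<sigma> \<bullet> z\<bar> ^ 3 * Y" if "norm z \<le> 1" for z
      unfolding N_def
    proof (rule near_estimate[OF _ C])
      have "\<bar>\<sigma> \<bullet> z\<bar> \<le> norm \<sigma> * norm z"
        by (rule Cauchy_Schwarz_ineq2)
      also have "\<dots> \<le> norm \<sigma> * 1"
        using that by (intro mult_left_mono) auto
      finally show "\<bar>\<sigma> \<bullet> z\<bar> \<le> norm \<sigma>" by simp
    qed
    have "(LINT x|lborel. u x * jprim \<gamma> (\<sigma> \<bullet> x + \<omega>) * partial_deriv k (abs_nabla \<alpha> u) x) \<le>
        - b * (LINT x|lborel. \<bar>abs_nabla (\<alpha> / 2) v x\<bar>\<^sup>2) + E * Y"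
      unfolding E_def
      by (rule coercive_estimate[OF assms(1,2) c refl N near D0 D b(1) symbol_lower_bound[OF b(2)]])
    also have "\<dots> \<le> - b * (LINT x|lborel. \<bar>abs_nabla (\<alpha> / 2) v x\<bar>\<^sup>2) + (E + 1) * Y"
      using Y_nonneg by (simp add: distrib_right)
    finally show "(LINT x|lborel. u x * weight_varphi \<gamma> \<omega> \<sigma> x * partial_deriv k (abs_nabla \<alpha> u) x)
           \<le> - b * (LINT x|lborel. \<bar>abs_nabla (\<alpha> / 2) (\<lambda>y. u y * weight_phi \<gamma> \<omega> \<sigma> y) x\<bar>\<^sup>2)
             + (E + 1) * (LINT x|lborel. (u x)\<^sup>2 * (weight_phi \<gamma> \<omega> \<sigma> x)\<^sup>2)"
      unfolding v Y weight_varphi_eq .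
  qed
  have \<sigma>k: "\<sigma> $ k > 0"
  proof -
    have "0 \<le> sqrt (\<alpha> / (2 * (1 + \<alpha>))) * sqrt (\<Sum>j\<in>UNIV - {k}. (\<sigma> $ j)\<^sup>2)"
      using assms(1) by (intro mult_nonneg_nonneg) (auto simp: sum_nonneg)
    with assms(5) show ?thesis by linarith
  qed
  \<comment> \<open>Half of the margin from \<open>quadratic_form_lower_bound\<close>; it is
    positive because \<alpha> < 2.\<close>
  have general: "\<exists>b > 0. admissible b"
  proof (intro exI conjI)
    have "sqrt (\<alpha> / 2) < 1"
      using assms(2) by (subst real_sqrt_lt_1_iff) simp
    then show pos: "(1 - sqrt (\<alpha> / 2)) * \<sigma> $ k / 2 > 0"
      using \<sigma>k by simp
    show "admissible ((1 - sqrt (\<alpha> / 2)) * \<sigma> $ k / 2)"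
    proof (rule admissibleI)
      show "2 * ((1 - sqrt (\<alpha> / 2)) * \<sigma> $ k / 2) * (norm \<xi>)\<^sup>2 \<le> (norm \<xi>)\<^sup>2 * \<sigma> $ k + \<alpha> * (\<xi> \<bullet> \<sigma>) * \<xi> $ k" for \<xi>
        using quadratic_form_lower_bound[OF assms(1) less_imp_le[OF assms(2)] assms(5), of \<xi>] by simp
    qed (use pos in simp)
  qed
  have parallel: "\<xi> \<bullet> \<sigma> = \<xi> $ k * \<sigma> $ k" if "\<And>j. j \<noteq> k \<Longrightarrow> \<sigma> $ j = 0" for \<xi> :: "real^'n"
  proof -
    have "\<xi> \<bullet> \<sigma> = (\<Sum>j\<in>{k}. \<xi> $ j * \<sigma> $ j)"
      unfolding inner_vec_def inner_real_def by (rule sum.mono_neutral_right) (use that in auto)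
    then show ?thesis by simp
  qed
  \<comment> \<open>In one dimension the quadratic form is exactly (1 + \<alpha>) \<sigma>_k
    |\<xi>|^2, so half of its coefficient is attained without loss.\<close>
  have one: "admissible ((\<alpha> + 1) / 2 * \<sigma> $ k)" if card: "CARD('n) = 1"
  proof (rule admissibleI)
    obtain i :: 'n where i: "UNIV = {i}"
      by (rule card_1_singletonE[OF card])
    then have all_k: "j = k" for j :: 'n
      by (metis UNIV_I singletonD)
    show "2 * ((\<alpha> + 1) / 2 * \<sigma> $ k) * (norm \<xi>)\<^sup>2 \<le> (norm \<xi>)\<^sup>2 * \<sigma> $ k + \<alpha> * (\<xi> \<bullet> \<sigma>) * \<xi> $ k" for \<xi>
    proof -
      have "(norm \<xi>)\<^sup>2 = (\<Sum>j\<in>UNIV. \<xi> $ j * \<xi> $ j)"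
        by (simp add: power2_norm_eq_inner inner_vec_def)
      also have "(UNIV :: 'n set) = {k}"
        using all_k by auto
      finally have "(norm \<xi>)\<^sup>2 = \<xi> $ k * \<xi> $ k" by simp
      moreover have "\<xi> \<bullet> \<sigma> = \<xi> $ k * \<sigma> $ k"
        using all_k by (intro parallel) auto
      ultimately show ?thesis
        by (simp add: algebra_simps)
    qed
  qed (use assms(1) \<sigma>k in auto)
  \<comment> \<open>The term \<alpha> \<sigma>_k \<xi>_k^2 is nonnegative and is dropped. It
    vanishes for \<xi> orthogonal to the axis, so in dimension at least two it could not raise the
    bound.\<close>
  have axial: "admissible (\<sigma> $ k / 2)" if "\<forall>j. j \<noteq> k \<longrightarrow> \<sigma> $ j = 0"
  proof (rule admissibleI)
    show "2 * (\<sigma> $ k / 2) * (norm \<xi>)\<^sup>2 \<le> (norm \<xi>)\<^sup>2 * \<sigma> $ k + \<alpha> * (\<xi> \<bullet> \<sigma>) * \<xi> $ k" for \<xi>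
    proof -
      have "0 \<le> \<alpha> * \<sigma> $ k * (\<xi> $ k)\<^sup>2"
        using assms(1) \<sigma>k by simp
      moreover have "\<xi> \<bullet> \<sigma> = \<xi> $ k * \<sigma> $ k"
        using that by (intro parallel) auto
      ultimately show ?thesis
        by (simp add: power2_eq_square mult_ac)
    qed
  qed (use \<sigma>k in simp)
  show ?thesis
    unfolding Let_def admissible_def[symmetric] using general one axial by blast
qed

end
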